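(* Let $\dot x=g(x)$, $x\in\mathbb{C}^n$, be semi-quasihomogeneous with exponents $s_1,\dots,s_n$, $g=g_m+\tilde g$, where $g_m$ is quasi-homogeneous of degree $m$. Let $c\neq0$ satisfy $Hc+g_m(c)=0$, let $x_0(t)=t^{-H}c$ be the corresponding particular solution of the truncated system $\dot x=g_m(x)$, and let $\lambda_1,\dots,\lambda_n$ be the Kovalevskaya exponents. Suppose $\dot x=g(x)$ possesses an analytic (polynomial, in the negatively semi-quasihomogeneous case) tensor invariant $T$ of type $(p,q)$ in a neighbourhood of the particular solution $x_0(t)$, with quasi-homogeneous expansion having leading term $T_l\not\equiv 0$ of degree $l$. Then the truncated system $\dot x=g_m(x)$ admits a quasi-homogeneous tensor invariant of type $(p,q)$ of degree $l$, and there exist $i_1,\dots,i_p,j_1,\dots,j_q\in\{1,\dots,n\}$ and $k_1,\dots,k_n\in\mathbb{N}$ such that $$-\frac{l}{m-1}+\sum_{j=1}^{n}k_{j}\lambda_{j}=\lambda_{i_{1}}+\cdots+\lambda_{i_{p}}-\lambda_{j_{1}}-\cdots-\lambda_{j_{q}}.$$ Moreover, if $l\ge0$ and the Kovalevskaya exponents are numbered so that $\lambda_1=-1$, then this condition can be rewritten as: there exist $i_1,\dots,i_p,j_1,\dots,j_q\in\{1,\dots,n\}$ and $k_1,\dots,k_n\in\mathbb{N}$ with $k_1\ge l$ such that $$\sum_{j=1}^{n}k_{j}\lambda_{j}=(m-1)\left(\lambda_{i_{1}}+\cdots+\lambda_{i_{p}}-\lambda_{j_{1}}-\cdots-\lam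bda_{j_{q}}\right).$$
   Context: $\mathbb{N}=\{0,1,2,\dots\}$. Einstein summation is used. Let $s_1,\dots,s_n\in\mathbb{N}$ and $m\in\mathbb{N}$, $m>1$. A vector field $g=(g^1,\dots,g^n)$ is quasi-homogeneous of degree $m$ with exponents $s_1,\dots,s_n$ if $g^j(\rho^{s_1}x^1,\dots,\rho^{s_n}x^n)=\rho^{s_j+m-1}g^j(x)$ for all $\rho>0$ and all $j$. The system $\dot x=g(x)$ is semi-quasihomogeneous if $g=g_m+\tilde g$, where $g_m$ is quasi-homogeneous of degree $m$ with exponents $s_1,\dots,s_n$ and $\tilde g$ is a sum of quasi-homogeneous vector fields (same exponents) of degrees all larger than $m$ (positively semi-quasihomogeneous) or all less than $m$ (negatively semi-quasihomogeneous). The truncated system is $\dot x=g_m(x)$. Put $\alpha=\frac1{m-1}$, $S=\mathrm{diag}(s_1,\dots,s_n)$, $H=\alpha S$. If $c\ne0$ satisfies $Hc+g_m(c)=0$, then $x_0(t)=t^{-H}c=t^{-\alpha S}c$ solves the truncated system. The matrix $K=H+\frac{\partial g_m}{\partial x}(c)$ is the Kovalevskaya matrix; its eigenvalues $\lambda_1,\dots,\lambda_n$ (with multiplicity) are the Kovalevskaya exponents (it is known that $-1$ is one of them). A tensor field of type $(p,q)$ is $T=T^{i_1\cdots i_p}_{j_1\cdots j_q}(x)\frac{\partial}{\partial x^{i_1}}\otimes\cdots\otimes\frac{\partial}{\partial x^{i_p}}\otimes dx^{j_1}\otimes\cdots\otimes dx^{j_q}$; it is analytic (polynomial) if all its components are.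 The Lie derivative along $F$ is $$(L_FT)^{i_1\cdots i_p}_{j_1\cdots j_q}=F^s\frac{\partial}{\partial x^s}T^{i_1\cdots i_p}_{j_1\cdots j_q}+T^{i_1\cdots i_p}_{kj_2\cdots j_q}\frac{\partial F^k}{\partial x^{j_1}}+\cdots+T^{i_1\cdots i_p}_{j_1\cdots j_{q-1}k}\frac{\partial F^k}{\partial x^{j_q}}-T^{ai_2\cdots i_p}_{j_1\cdots j_q}\frac{\partial F^{i_1}}{\partial x^a}-\cdots-T^{i_1\cdots i_{p-1}a}_{j_1\cdots j_q}\frac{\partial F^{i_p}}{\partial x^a},$$ and $T$ is a tensor invariant of $\dot x=F(x)$ if $L_FT=0$. A tensor field $T$ of type $(p,q)$ is quasi-homogeneous of degree $r$ with exponents $s_1,\dots,s_n$ if $T^{i_1\cdots i_p}_{j_1\cdots j_q}(\rho^{s_1}x^1,\dots,\rho^{s_n}x^n)=\rho^{r-s_{j_1}-\cdots-s_{j_q}+s_{i_1}+\cdots+s_{i_p}}T^{i_1\cdots i_p}_{j_1\cdots j_q}(x)$ for all $\rho>0$ and all indices. The degree may be positive, zero or negative. Standing convention: for positively semi-quasihomogeneous systems one considers analytic tensor invariants, written as $T=T_l+T_{l+1}+T_{l+2}+\cdots$; for negatively semi-quasihomogeneous systems one considers polynomial tensor invariants, written as a finite sum $T=T_l+T_{l-1}+\cdots+T_{l-L}$ with $L<l$; here each $T_r$ is quasi-homogeneous of degree $r$ with exponents $s_1,\dots,s_n$, each component $(T_r)^{i_1\cdots i_p}_{j_1\cdots j_q}$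 being a sum of monomials $a_{k_1\cdots k_n}(x^1)^{k_1}\cdots(x^n)^{k_n}$ with $s_1k_1+\cdots+s_nk_n=r-s_{j_1}-\cdots-s_{j_q}+s_{i_1}+\cdots+s_{i_p}$. $T_l$ is the leading term. *)

theory Defs
  imports "HOL-Analysis.Analysis"
begin

type_synonym 'n vector_field = "complex^'n \<Rightarrow> complex^'n"

text \<open>Components \<open>T I J x\<close> of a tensor field: \<open>I\<close> lists the upper (contravariant) and \<open>J\<close> the lower
  (covariant) indices. For a field of type \<open>(p,q)\<close> only \<open>length I = p\<close>, \<open>length J = q\<close> matter.\<close>
type_synonym 'n tensor_field = "'n list \<Rightarrow> 'n list \<Rightarrow> complex^'n \<Rightarrow> complex"

definition partial_deriv :: "'n::finite \<Rightarrow> (complex^'n \<Rightarrow> complex) \<Rightarrow> complex^'n \<Rightarrow> complex" where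
  "partial_deriv i f x = deriv (\<lambda>z. f (x + axis i z)) 0"

definition monomial :: "('n::finite \<Rightarrow> nat) \<Rightarrow> complex^'n \<Rightarrow> complex" where
  "monomial k x = (\<Prod>i\<in>UNIV. (x $ i) ^ k i)"

text \<open>Analyticity in several variables (the library's \<open>analytic_on\<close> is for one variable): local
  expansion into an unconditionally convergent power series.\<close>
definition mv_analytic_on :: "(complex^'n::finite \<Rightarrow> complex) \<Rightarrow> (complex^'n) set \<Rightarrow> bool" where
  "mv_analytic_on f U \<longleftrightarrow>
     (\<forall>a\<in>U. \<exists>r>0. \<exists>b :: ('n \<Rightarrow> nat) \<Rightarrow> complex.
        \<forall>x\<in>ball a r. ((\<lambda>k. b k * monomial k (x - a)) has_sum f x) UNIV)"

definition analytic_vector_field_on :: "'n::finite vector_field \<Rightarrow> (complex^'n) set \<Rightarrow> bool" where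
  "analytic_vector_field_on F U \<longleftrightarrow> (\<forall>j. mv_analytic_on (\<lambda>x. F x $ j) U)"

definition analytic_tensor_field_on ::
    "nat \<Rightarrow> nat \<Rightarrow> 'n::finite tensor_field \<Rightarrow> (complex^'n) set \<Rightarrow> bool" where
  "analytic_tensor_field_on p q T U \<longleftrightarrow>
     (\<forall>I J. length I = p \<longrightarrow> length J = q \<longrightarrow> mv_analytic_on (T I J) U)"

definition lie_derivative :: "'n::finite vector_field \<Rightarrow> 'n tensor_field \<Rightarrow> 'n tensor_field" where
  "lie_derivative F T I J x =
     (\<Sum>s\<in>UNIV. F x $ s * partial_deriv s (T I J) x)
     + (\<Sum>b<length J. \<Sum>k\<in>UNIV. T I (J[b := k]) x * partial_deriv (J ! b) (\<lambda>y. F y $ k) x)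
     - (\<Sum>a<length I. \<Sum>k\<in>UNIV. T (I[a := k]) J x * partial_deriv k (\<lambda>y. F y $ (I ! a)) x)"

definition tensor_invariant_on ::
    "nat \<Rightarrow> nat \<Rightarrow> 'n::finite vector_field \<Rightarrow> 'n tensor_field \<Rightarrow> (complex^'n) set \<Rightarrow> bool" where
  "tensor_invariant_on p q F T U \<longleftrightarrow>
     analytic_tensor_field_on p q T U \<and>
     (\<forall>I J. length I = p \<longrightarrow> length J = q \<longrightarrow> (\<forall>x\<in>U. lie_derivative F T I J x = 0))"

definition tensor_nonzero_on ::
    "nat \<Rightarrow> nat \<Rightarrow> 'n tensor_field \<Rightarrow> (complex^'n) set \<Rightarrow> bool" where
  "tensor_nonzero_on p q T U \<longleftrightarrow>
     (\<exists>I J. length I = p \<and> length J = q \<and> (\<exists>x\<in>U. T I J x \<noteq> 0))"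

definition dilation :: "('n::finite \<Rightarrow> nat) \<Rightarrow> real \<Rightarrow> complex^'n \<Rightarrow> complex^'n" where
  "dilation s \<rho> x = (\<chi> i. of_real (\<rho> ^ s i) * x $ i)"

text \<open>Integer degrees are allowed, since the lower-order terms of a negatively semi-quasihomogeneous
  field may have degree \<open>\<le> 0\<close>.\<close>
definition quasi_homogeneous_vector_field ::
    "('n::finite \<Rightarrow> nat) \<Rightarrow> int \<Rightarrow> 'n vector_field \<Rightarrow> bool" where
  "quasi_homogeneous_vector_field s d F \<longleftrightarrow>
     (\<forall>\<rho>>0. \<forall>x j. F (dilation s \<rho> x) $ j = of_real (\<rho> powi (int (s j) + d - 1)) * F x $ j)"

definition component_degree :: "('n \<Rightarrow> nat) \<Rightarrow> int \<Rightarrow> 'n list \<Rightarrow> 'n list \<Rightarrow> int" where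
  "component_degree s r I J = r - (\<Sum>j\<leftarrow>J. int (s j)) + (\<Sum>i\<leftarrow>I. int (s i))"

definition quasi_homogeneous_tensor_field ::
    "('n::finite \<Rightarrow> nat) \<Rightarrow> nat \<Rightarrow> nat \<Rightarrow> int \<Rightarrow> 'n tensor_field \<Rightarrow> bool" where
  "quasi_homogeneous_tensor_field s p q r T \<longleftrightarrow>
     (\<forall>I J. length I = p \<longrightarrow> length J = q \<longrightarrow>
        (\<forall>\<rho>>0. \<forall>x. T I J (dilation s \<rho> x)
                    = of_real (\<rho> powi component_degree s r I J) * T I J x))"

text \<open>Sums of monomials of weighted degree \<open>w\<close>. If some \<open>s i = 0\<close>, infinitely many monomials share a
  weighted degree, so in the analytic case the sum may be a series, convergent on the domain \<open>U\<close>.\<close>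
definition weighted_series_on ::
    "('n::finite \<Rightarrow> nat) \<Rightarrow> int \<Rightarrow> (complex^'n \<Rightarrow> complex) \<Rightarrow> (complex^'n) set \<Rightarrow> bool" where
  "weighted_series_on s w f U \<longleftrightarrow>
     (\<exists>a. (\<forall>k. a k \<noteq> 0 \<longrightarrow> int (\<Sum>i\<in>UNIV. s i * k i) = w) \<and>
          (\<forall>x\<in>U. ((\<lambda>k. a k * monomial k x) has_sum f x) UNIV))"

definition weighted_polynomial ::
    "('n::finite \<Rightarrow> nat) \<Rightarrow> int \<Rightarrow> (complex^'n \<Rightarrow> complex) \<Rightarrow> bool" where
  "weighted_polynomial s w f \<longleftrightarrow>
     (\<exists>a. finite {k. a k \<noteq> 0} \<and>
          (\<forall>k. a k \<noteq> 0 \<longrightarrow> int (\<Sum>i\<in>UNIV. s i * k i) = w) \<and>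
          (\<forall>x. f x = (\<Sum>k | a k \<noteq> 0. a k * monomial k x)))"

text \<open>The two kinds of semi-quasihomogeneity: all other degrees larger (\<open>Positive\<close>) or smaller
  (\<open>Negative\<close>) than the leading one.\<close>
datatype kind = Positive | Negative

fun direction :: "kind \<Rightarrow> int" where
  "direction Positive = 1"
| "direction Negative = - 1"

text \<open>\<open>g = gm + (\<Sum>k. G k)\<close> on \<open>U\<close>, where \<open>G k\<close> has degree \<open>m + (k + 1)\<close>, resp. \<open>m - (k + 1)\<close>.
  The fields \<open>G k\<close> may vanish, so finite sums are included.\<close>
definition semi_quasihomogeneous_on ::
    "kind \<Rightarrow> ('n::finite \<Rightarrow> nat) \<Rightarrow> nat \<Rightarrow> 'n vector_field \<Rightarrow> 'n vector_field
      \<Rightarrow> (complex^'n) set \<Rightarrow> bool" where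
  "semi_quasihomogeneous_on \<sigma> s m g gm U \<longleftrightarrow>
     analytic_vector_field_on g U \<and>
     analytic_vector_field_on gm U \<and> quasi_homogeneous_vector_field s (int m) gm \<and>
     (\<exists>G. (\<forall>k. analytic_vector_field_on (G k) U \<and>
               quasi_homogeneous_vector_field s (int m + direction \<sigma> * int (Suc k)) (G k)) \<and>
          (\<forall>x\<in>U. (\<lambda>k. G k x) sums (g x - gm x)))"

text \<open>The homogeneous pieces in the expansion of a tensor invariant: in the positive case their
  components are (convergent) sums of monomials, in the negative case they are polynomials.\<close>
definition homogeneous_term_on ::
    "kind \<Rightarrow> ('n::finite \<Rightarrow> nat) \<Rightarrow> nat \<Rightarrow> nat \<Rightarrow> int \<Rightarrow> 'n tensor_field \<Rightarrow> (complex^'n) set \<Rightarrow> bool"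
  where
  "homogeneous_term_on \<sigma> s p q r T U \<longleftrightarrow>
     quasi_homogeneous_tensor_field s p q r T \<and>
     (\<forall>I J. length I = p \<longrightarrow> length J = q \<longrightarrow>
        (case \<sigma> of
           Positive \<Rightarrow> weighted_series_on s (component_degree s r I J) (T I J) U
         | Negative \<Rightarrow> weighted_polynomial s (component_degree s r I J) (T I J)))"

text \<open>\<open>TT r\<close> is the term of degree \<open>r\<close> and \<open>l\<close> is the leading degree:
  \<open>T = TT l + TT (l + 1) + \<dots>\<close> on \<open>U\<close>, resp. \<open>T = TT l + TT (l - 1) + \<dots> + TT (l - L)\<close>.
  In the negative case \<open>T\<close> is therefore a polynomial tensor field.\<close>
definition quasi_homogeneous_expansion_on ::
    "kind \<Rightarrow> ('n::finite \<Rightarrow> nat) \<Rightarrow> nat \<Rightarrow> nat \<Rightarrow> int \<Rightarrow> 'n tensor_field \<Rightarrow> (int \<Rightarrow> 'n tensor_field)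
      \<Rightarrow> (complex^'n) set \<Rightarrow> bool" where
  "quasi_homogeneous_expansion_on \<sigma> s p q l T TT U \<longleftrightarrow>
     (case \<sigma> of
        Positive \<Rightarrow>
          (\<forall>r\<ge>l. homogeneous_term_on Positive s p q r (TT r) U) \<and>
          (\<forall>I J. length I = p \<longrightarrow> length J = q \<longrightarrow>
             (\<forall>x\<in>U. (\<lambda>k. TT (l + int k) I J x) sums T I J x))
      | Negative \<Rightarrow>
          (\<exists>L::nat. int L < l \<and>
             (\<forall>r\<in>{l - int L..l}. homogeneous_term_on Negative s p q r (TT r) U) \<and>
             (\<forall>I J. length I = p \<longrightarrow> length J = q \<longrightarrow>
                (\<forall>x. T I J x = (\<Sum>r\<in>{l - int L..l}. TT r I J x)))))"

definition alpha :: "nat \<Rightarrow> real" where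
  "alpha m = 1 / (real m - 1)"

definition H_matrix :: "('n::finite \<Rightarrow> nat) \<Rightarrow> nat \<Rightarrow> complex^'n^'n" where
  "H_matrix s m = (\<chi> i j. if i = j then of_real (alpha m * real (s i)) else 0)"

text \<open>The diagonal matrix power \<open>t\<^sup>-\<^sup>H\<close> applied to \<open>c\<close>, for \<open>t > 0\<close>.\<close>
definition particular_solution :: "('n::finite \<Rightarrow> nat) \<Rightarrow> nat \<Rightarrow> complex^'n \<Rightarrow> real \<Rightarrow> complex^'n" where
  "particular_solution s m c t = (\<chi> i. of_real (t powr (- (alpha m * real (s i)))) * c $ i)"

definition kovalevskaya_matrix ::
    "('n::finite \<Rightarrow> nat) \<Rightarrow> nat \<Rightarrow> 'n vector_field \<Rightarrow> complex^'n \<Rightarrow> complex^'n^'n" where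
  "kovalevskaya_matrix s m gm c =
     H_matrix s m + (\<chi> i j. partial_deriv j (\<lambda>x. gm x $ i) c)"

text \<open>\<open>ev\<close> lists the eigenvalues of \<open>K\<close> with algebraic multiplicity, i.e. the roots of the
  characteristic polynomial. The numbering is by the coordinate index type and otherwise arbitrary.\<close>
definition eigenvalue_enumeration :: "complex^'n^'n \<Rightarrow> ('n::finite \<Rightarrow> complex) \<Rightarrow> bool" where
  "eigenvalue_enumeration K ev \<longleftrightarrow> (\<forall>z. det (mat z - K) = (\<Prod>i\<in>UNIV. z - ev i))"

end

theory Submission
  imports Defs "HOL-Complex_Analysis.Complex_Analysis"
    "HOL-Computational_Algebra.Fundamental_Theorem_Algebra"
begin

text \<open>
  Along a dilation, the quasi-homogeneous expansions of \<open>g\<close> and \<open>T\<close> become power series in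
  \<open>\<epsilon> = \<rho>\<close> (positive case) or \<open>\<epsilon> = 1 / \<rho>\<close> (negative case), and \<open>L\<^sub>g T\<close> becomes, up to a power of \<open>\<rho>\<close>,
  a power series in \<open>\<epsilon>\<close> whose constant term is the Lie derivative of the leading term \<open>\<tau>\<close> of \<open>T\<close> along the
  truncated field \<open>g\<^sub>m\<close>. It vanishes for \<open>\<epsilon>\<close> slightly below \<open>1\<close>, hence identically. Differentiating the
  expansions term by term needs locally bounded terms. As the expansions are only assumed to converge
  pointwise, Baire's theorem gives such bounds merely on a dense open set; continuity extends the
  conclusion \<open>L\<^bsub>g\<^sub>m\<^esub> \<tau> = 0\<close> to all of \<open>U\<close> (\<open>truncated_lie_derivative\<close>, \<open>leading_term_invariant\<close>).

  For the resonance relation, let \<open>c\<^sub>0\<close> be the point of the particular solution at some time \<open>t\<close>. It is a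
  zero of the field \<open>F = g\<^sub>m + (\<alpha> / t) E\<close>, where \<open>E\<close> is the Euler field with components \<open>s\<^sub>i x\<^sub>i\<close>. Euler's
  identity \<open>L\<^sub>E \<tau> = l \<tau>\<close> gives \<open>L\<^sub>F \<tau> = (\<alpha> l / t) \<tau>\<close> (\<open>lie_derivative_plus_euler\<close>), and the Jacobian
  matrix of \<open>F\<close> at \<open>c\<^sub>0\<close> is conjugate to \<open>K / t\<close> (\<open>quasi_homogeneous_partial_deriv\<close>,
  \<open>kovalevskaya_eigenvalue_transfer\<close>). The tensor \<open>\<tau>\<close> does not vanish identically near \<open>c\<^sub>0\<close>, by the
  identity theorem. Its partial derivatives of the lowest nonvanishing order \<open>d\<close> at \<open>c\<^sub>0\<close> form an array
  with \<open>d + q\<close> lower and \<open>p\<close> upper indices that is an eigenvector of the linearization of \<open>L\<^sub>F\<close>, a sum of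
  commuting operators each acting on one index (\<open>iterated_partial_lie_derivative\<close>). A common
  eigenvector of these operators exhibits \<open>\<alpha> l / t\<close> as a sum of \<open>d + q\<close> eigenvalues minus \<open>p\<close>
  eigenvalues of the linear part (\<open>index_operator_sum_eigenvalue\<close>, \<open>lie_derivative_eigenvalue\<close>). Counting
  how often each eigenvalue occurs among the first \<open>d\<close> of them gives the multiplicities \<open>k\<^sub>j\<close>.
\<close>

section \<open>Multi-indices and power series in several variables\<close>

lemma complex_summable_on_norm:
  fixes f :: "'a \<Rightarrow> complex"
  shows "f summable_on A \<Longrightarrow> (\<lambda>x. norm (f x)) summable_on A"
    and "(\<lambda>x. norm (f x)) summable_on A \<Longrightarrow> f summable_on A"
  by (simp_all only: summable_on_iff_abs_summable_on_complex)

lemma norm_monomial: "norm (monomial k x) = (\<Prod>i\<in>UNIV. norm (x $ i) ^ k i)"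
  by (simp add: monomial_def prod_norm [symmetric] norm_power)

lemma monomial_zero_index [simp]: "monomial (\<lambda>_. 0) x = 1"
  by (simp add: monomial_def)

lemma monomial_add_index: "monomial (\<lambda>i. j i + k i) x = monomial j x * monomial k x"
  by (simp add: monomial_def power_add prod.distrib)

lemma monomial_at_0: "monomial k 0 = (if k = (\<lambda>_. 0) then 1 else 0)"
proof (cases "k = (\<lambda>_. 0)")
  case False
  then obtain i where "k i \<noteq> 0" by auto
  then show ?thesis using False
    by (auto simp: monomial_def intro!: prod_zero)
qed simp

lemma monomial_axis:
  "monomial k (axis i z) = (if k = (\<lambda>_. 0)(i := k i) then z ^ k i else 0)"
proof (cases "k = (\<lambda>_. 0)(i := k i)")
  case True
  have "monomial k (axis i z) = (axis i z $ i) ^ k i * (\<Prod>j\<in>UNIV - {i}. (axis i z $ j) ^ k j)"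
    unfolding monomial_def by (rule prod.remove) auto
  also have "(\<Prod>j\<in>UNIV - {i}. (axis i z $ j) ^ k j) = 1"
    by (intro prod.neutral) (subst True, auto)
  finally show ?thesis using True by simp
next
  case False
  then obtain j where "j \<noteq> i" "k j \<noteq> 0" by fastforce
  then show ?thesis using False
    by (auto simp: monomial_def axis_def intro!: prod_zero bexI[of _ j])
qed

text \<open>The multi-index \<open>e\<^sub>i\<close> of the monomial \<open>x\<^sub>i\<close>.\<close>
definition unit_index :: "'n \<Rightarrow> 'n \<Rightarrow> nat" where
  "unit_index i = (\<lambda>j. if j = i then 1 else 0)"

lemma unit_index_simps [simp]: "unit_index i i = 1" "j \<noteq> i \<Longrightarrow> unit_index i j = 0"
  by (simp_all add: unit_index_def)

lemma unit_index_upd: "unit_index i = (\<lambda>_. 0)(i := 1)"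
  by (auto simp: unit_index_def)

lemma monomial_unit_index: "monomial (unit_index i) x = x $ i"
proof -
  have "monomial (unit_index i) x
      = (x $ i) ^ unit_index i i * (\<Prod>j\<in>UNIV - {i}. (x $ j) ^ unit_index i j)"
    unfolding monomial_def by (rule prod.remove) auto
  then show ?thesis by simp
qed

lemma atMost_index_PiE: "{..n :: 'n::finite \<Rightarrow> nat} = PiE UNIV (\<lambda>i. {..n i})"
  by (auto simp: le_fun_def PiE_def Pi_def)

lemma finite_atMost_index [simp]: "finite {..n :: 'n::finite \<Rightarrow> nat}"
  unfolding atMost_index_PiE by (rule finite_PiE) auto

text \<open>The multi-index binomial coefficient, as a complex number.\<close>
definition multi_choose :: "('n::finite \<Rightarrow> nat) \<Rightarrow> ('n \<Rightarrow> nat) \<Rightarrow> complex" where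
  "multi_choose n j = (\<Prod>i\<in>UNIV. of_nat (n i choose j i))"

lemma multi_binomial_aux:
  fixes a b :: "'n::finite \<Rightarrow> 'a::comm_ring_1"
  shows "(\<Prod>i\<in>UNIV. (a i + b i) ^ n i)
     = (\<Sum>j\<in>{..n}. \<Prod>i\<in>UNIV. of_nat (n i choose j i) * b i ^ j i * a i ^ (n i - j i))"
proof -
  have "(\<Prod>i\<in>UNIV. (a i + b i) ^ n i)
      = (\<Prod>i\<in>UNIV. \<Sum>j\<le>n i. of_nat (n i choose j) * b i ^ j * a i ^ (n i - j))"
    by (subst add.commute) (simp add: binomial_ring)
  then show ?thesis by (simp add: prod_sum_PiE atMost_index_PiE)
qed

lemma monomial_binomial:
  "monomial n (y + w)
     = (\<Sum>j\<in>{..n}. multi_choose n j * monomial (\<lambda>i. n i - j i) y * monomial j w)"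
  unfolding monomial_def multi_choose_def
  by (simp add: multi_binomial_aux prod.distrib mult_ac)

text \<open>The vector of moduli \<open>|y\<^sub>i| + |w\<^sub>i|\<close>: convergence there controls the double series that arises
  from expanding \<open>(y + w)\<^sup>k\<close>.\<close>
definition modulus_sum :: "complex^'n \<Rightarrow> complex^'n \<Rightarrow> complex^'n::finite" where
  "modulus_sum y w = (\<chi> i. of_real (norm (y $ i) + norm (w $ i)))"

lemma norm_monomial_modulus_sum:
  "norm (monomial n (modulus_sum y w))
     = (\<Sum>j\<in>{..n}. norm (multi_choose n j * monomial (\<lambda>i. n i - j i) y * monomial j w))"
proof -
  have "norm (monomial n (modulus_sum y w)) = (\<Prod>i\<in>UNIV. (norm (y $ i) + norm (w $ i)) ^ n i)"
    by (simp add: norm_monomial modulus_sum_def del: of_real_add)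
  then show ?thesis
    unfolding multi_binomial_aux
    by (simp add: norm_mult norm_monomial multi_choose_def prod_norm [symmetric] prod.distrib mult_ac)
qed

lemma norm_modulus_sum_le: "norm (modulus_sum y w) \<le> norm y + norm w"
proof -
  have "norm (modulus_sum y w) = L2_set (\<lambda>i. norm (y $ i) + norm (w $ i)) UNIV"
    by (simp add: norm_vec_def modulus_sum_def del: of_real_add)
  also have "\<dots> \<le> L2_set (\<lambda>i. norm (y $ i)) UNIV + L2_set (\<lambda>i. norm (w $ i)) UNIV"
    by (rule L2_set_triangle_ineq)
  finally show ?thesis by (simp add: norm_vec_def)
qed

lemma bij_betw_index_split:
  "bij_betw (\<lambda>(k, j). ((\<lambda>i. k i + j i) :: 'n::finite \<Rightarrow> nat, j)) UNIV (Sigma UNIV (\<lambda>n. {..n}))"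
  by (rule bij_betwI[where g = "\<lambda>(n, j). (\<lambda>i. n i - j i, j)"])
    (auto simp: le_fun_def)

text \<open>An absolutely convergent double sum over \<open>j \<le> n\<close> may be summed over \<open>k = n - j\<close> first.\<close>
lemma has_sum_index_split:
  fixes t :: "('n::finite \<Rightarrow> nat) \<Rightarrow> ('n \<Rightarrow> nat) \<Rightarrow> complex"
  assumes sm: "(\<lambda>n. \<Sum>j\<in>{..n}. norm (t n j)) summable_on UNIV"
  shows "\<And>j. (\<lambda>k. t (\<lambda>i. k i + j i) j) summable_on UNIV"
    and "((\<lambda>j. \<Sum>\<^sub>\<infinity>k. t (\<lambda>i. k i + j i) j) has_sum (\<Sum>\<^sub>\<infinity>n. \<Sum>j\<in>{..n}. t n j)) UNIV"
    and "(\<lambda>n. \<Sum>j\<in>{..n}. t n j) summable_on UNIV"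
proof -
  let ?T = "\<lambda>(n, j). t n j"
  have "(\<lambda>p. norm (?T p)) summable_on Sigma UNIV (\<lambda>n. {..n})"
    by (rule Infinite_Sum.abs_summable_on_Sigma_iff[THEN iffD2]) (use sm in \<open>simp add: sum_nonneg\<close>)
  then have S: "?T summable_on Sigma UNIV (\<lambda>n. {..n})"
    by (rule complex_summable_on_norm(2))
  then obtain s where s: "(?T has_sum s) (Sigma UNIV (\<lambda>n. {..n}))"
    by (auto simp: summable_on_def)
  have n: "((\<lambda>n. \<Sum>j\<in>{..n}. t n j) has_sum s) UNIV"
    by (rule has_sum_SigmaD[OF s]) (auto intro: has_sum_finiteI)
  have seq: "s = (\<Sum>\<^sub>\<infinity>n. \<Sum>j\<in>{..n}. t n j)" using n by (simp add: infsumI)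
  have "((\<lambda>p. ?T ((\<lambda>(k, j). ((\<lambda>i. k i + j i), j)) p)) has_sum s) UNIV"
    using s has_sum_reindex_bij_betw[OF bij_betw_index_split, of ?T s] by simp
  then have kj: "((\<lambda>(k, j). t (\<lambda>i. k i + j i) j) has_sum s) (UNIV \<times> UNIV)"
    by (simp add: case_prod_unfold)
  then have jk: "((\<lambda>(j, k). t (\<lambda>i. k i + j i) j) has_sum s) (UNIV \<times> UNIV)"
    by (subst (asm) has_sum_swap) simp
  show sj: "(\<lambda>k. t (\<lambda>i. k i + j i) j) summable_on UNIV" for j
    using summable_on_SigmaD1[OF has_sum_imp_summable[OF jk], of j] by simp
  show "((\<lambda>j. \<Sum>\<^sub>\<infinity>k. t (\<lambda>i. k i + j i) j) has_sum (\<Sum>\<^sub>\<infinity>n. \<Sum>j\<in>{..n}. t n j)) UNIV"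
    unfolding seq[symmetric]
    by (rule has_sum_SigmaD[OF jk]) (use sj in auto)
  show "(\<lambda>n. \<Sum>j\<in>{..n}. t n j) summable_on UNIV"
    using n by (rule has_sum_imp_summable)
qed

text \<open>The coefficients at \<open>y\<close> of a power series given by its coefficients \<open>b\<close> at the origin. Outside the
  domain of convergence the infinite sum has the value \<open>0\<close>, so its convergence is stated separately.\<close>
definition recentred_coeff ::
    "(('n::finite \<Rightarrow> nat) \<Rightarrow> complex) \<Rightarrow> complex^'n \<Rightarrow> ('n \<Rightarrow> nat) \<Rightarrow> complex" where
  "recentred_coeff b y j
     = (\<Sum>\<^sub>\<infinity>k. multi_choose (\<lambda>i. k i + j i) j * b (\<lambda>i. k i + j i) * monomial k y)"

text \<open>Expanding \<open>(y + w)\<^sup>k\<close> by the binomial theorem and collecting the powers of \<open>w\<close>. The third claim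
  requires \<open>w\<^sup>j \<noteq> 0\<close>, since only the product of the coefficient with \<open>w\<^sup>j\<close> is known to converge.\<close>
lemma recentre_power_series:
  fixes b :: "('n::finite \<Rightarrow> nat) \<Rightarrow> complex"
  assumes sm: "(\<lambda>k. b k * monomial k (modulus_sum y w)) summable_on UNIV"
  shows "((\<lambda>j. recentred_coeff b y j * monomial j w) has_sum (\<Sum>\<^sub>\<infinity>k. b k * monomial k (y + w))) UNIV"
    and "(\<lambda>k. b k * monomial k (y + w)) summable_on UNIV"
    and "\<And>j. monomial j w \<noteq> 0 \<Longrightarrow>
       ((\<lambda>k. multi_choose (\<lambda>i. k i + j i) j * b (\<lambda>i. k i + j i) * monomial k y)
          has_sum recentred_coeff b y j) UNIV"
proof -
  define t where "t n j = b n * (multi_choose n j * monomial (\<lambda>i. n i - j i) y * monomial j w)" for n j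
  have "(\<lambda>k. norm (b k * monomial k (modulus_sum y w))) summable_on UNIV"
    using sm by (simp only: summable_on_iff_abs_summable_on_complex)
  moreover have "norm (b n * monomial n (modulus_sum y w)) = (\<Sum>j\<in>{..n}. norm (t n j))" for n
    unfolding t_def norm_mult[of "b n"] norm_monomial_modulus_sum sum_distrib_left ..
  ultimately have sm': "(\<lambda>n. \<Sum>j\<in>{..n}. norm (t n j)) summable_on UNIV" by simp
  have sum_t: "(\<Sum>j\<in>{..n}. t n j) = b n * monomial n (y + w)" for n
    unfolding t_def monomial_binomial sum_distrib_left ..
  have t_add: "t (\<lambda>i. k i + j i) j
      = (multi_choose (\<lambda>i. k i + j i) j * b (\<lambda>i. k i + j i) * monomial k y) * monomial j w" for k j
    by (simp add: t_def mult_ac)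
  note H = has_sum_index_split[OF sm', unfolded sum_t t_add infsum_cmult_left']
  show "((\<lambda>j. recentred_coeff b y j * monomial j w) has_sum (\<Sum>\<^sub>\<infinity>k. b k * monomial k (y + w))) UNIV"
    using H(2) unfolding recentred_coeff_def .
  show "(\<lambda>k. b k * monomial k (y + w)) summable_on UNIV" by (rule H(3))
  show "((\<lambda>k. multi_choose (\<lambda>i. k i + j i) j * b (\<lambda>i. k i + j i) * monomial k y)
          has_sum recentred_coeff b y j) UNIV" if "monomial j w \<noteq> 0" for j
    using H(1)[of j] that unfolding recentred_coeff_def
    by (simp add: summable_on_cmult_left')
qed

lemma multi_choose_unit_index: "multi_choose (\<lambda>i. k i + unit_index i0 i) (unit_index i0) = of_nat (k i0 + 1)"
proof -
  have "multi_choose (\<lambda>i. k i + unit_index i0 i) (unit_index i0)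
     = of_nat ((k i0 + 1) choose 1) * (\<Prod>i\<in>UNIV - {i0}. of_nat ((k i + unit_index i0 i) choose unit_index i0 i))"
    unfolding multi_choose_def by (subst prod.remove[of _ i0]) auto
  also have "(\<Prod>i\<in>UNIV - {i0}. of_nat ((k i + unit_index i0 i) choose unit_index i0 i)) = (1::complex)"
    by (intro prod.neutral) auto
  finally show ?thesis by simp
qed

lemma norm_axis_complex: "norm (axis i z :: complex^'n::finite) = norm z"
proof -
  have "(\<Sum>j\<in>UNIV. (norm (axis i z $ j))\<^sup>2) = (\<Sum>j\<in>UNIV. if j = i then (norm z)\<^sup>2 else 0)"
    by (intro sum.cong) (auto simp: axis_def)
  then show ?thesis by (simp add: norm_vec_def L2_set_def)
qed

text \<open>Along a coordinate line only the monomials in that coordinate survive, so the one-variable theory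
  identifies the coefficients of order at most one.\<close>
lemma power_series_on_axis:
  assumes r: "r > 0"
    and f: "\<And>w. w \<in> ball 0 r \<Longrightarrow> ((\<lambda>j. c j * monomial j w) has_sum f (a + w)) UNIV"
  shows "(\<lambda>z. f (a + axis i z)) holomorphic_on ball 0 r"
    and "partial_deriv i f a = c (unit_index i)"
    and "f a = c (\<lambda>_. 0)"
proof -
  define u where "u n = ((\<lambda>_. 0)(i := n) :: 'a \<Rightarrow> nat)" for n :: nat
  have inj: "inj u"
    by (rule injI) (metis fun_upd_same u_def)
  have ser: "(\<lambda>n. c (u n) * z ^ n) sums f (a + axis i z)" if z: "z \<in> ball 0 r" for z
  proof -
    have "norm (axis i z) = norm z" by (simp add: norm_axis_complex)
    then have "((\<lambda>j. c j * monomial j (axis i z)) has_sum f (a + axis i z)) UNIV"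
      using z by (intro f) auto
    then have "((\<lambda>j. c j * monomial j (axis i z)) has_sum f (a + axis i z)) (range u)"
    proof (subst (asm) has_sum_cong_neutral)
      fix k assume "k \<in> UNIV - range u"
      then have "k \<noteq> (\<lambda>_. 0)(i := k i)" unfolding u_def by blast
      then show "c k * monomial k (axis i z) = 0" by (subst monomial_axis) simp
    qed auto
    then have "((\<lambda>n. c (u n) * monomial (u n) (axis i z)) has_sum f (a + axis i z)) UNIV"
      by (simp add: has_sum_reindex[OF inj] o_def)
    moreover have "monomial (u n) (axis i z) = z ^ n" for n
      by (subst monomial_axis) (simp add: u_def)
    ultimately show ?thesis by (simp add: has_sum_imp_sums)
  qed
  have zero: "c (u 0) = f a"
  proof -
    have "(\<lambda>n. c (u n) * 0 ^ n) sums f (a + axis i 0)" using r by (intro ser) auto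
    moreover have "axis i (0::complex) = 0" by (simp add: vec_eq_iff axis_def)
    ultimately have "(\<lambda>n. c (u n) * 0 ^ n) sums f a" by simp
    moreover have "(\<lambda>n. c (u n) * 0 ^ n) sums c (u 0)"
      using powser_sums_zero[of "\<lambda>n. c (u n)"] by simp
    ultimately show ?thesis by (rule sums_unique2[symmetric])
  qed
  then show "f a = c (\<lambda>_. 0)" by (simp add: u_def fun_upd_idem)
  show hol: "(\<lambda>z. f (a + axis i z)) holomorphic_on ball 0 r"
    by (rule power_series_holomorphic) (use ser in auto)
  have "((\<lambda>z. \<Sum>n. c (u n) * z ^ n) has_field_derivative (\<Sum>n. diffs (\<lambda>n. c (u n)) n * 0 ^ n)) (at 0)"
    by (rule termdiffs_strong'[where K = r]) (use ser r in \<open>auto simp: sums_iff\<close>)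
  then have "((\<lambda>z. \<Sum>n. c (u n) * z ^ n) has_field_derivative c (u 1)) (at 0)"
    by (simp add: diffs_def)
  then have "((\<lambda>z. f (a + axis i z)) has_field_derivative c (u 1)) (at 0)"
    by (rule has_field_derivative_transform_within_open[where S = "ball 0 r"])
      (use ser r in \<open>auto simp: sums_iff\<close>)
  then show "partial_deriv i f a = c (unit_index i)"
    unfolding partial_deriv_def u_def unit_index_upd by (rule DERIV_imp_deriv)
qed

section \<open>Analytic functions of several variables\<close>

text \<open>The function \<open>f\<close> is represented on the ball of radius \<open>r\<close> around \<open>a\<close> by the power series with
  coefficients \<open>b\<close>.\<close>
definition power_series_at ::
    "(complex^'n::finite \<Rightarrow> complex) \<Rightarrow> (('n \<Rightarrow> nat) \<Rightarrow> complex) \<Rightarrow> complex^'n \<Rightarrow> real \<Rightarrow> bool" where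
  "power_series_at f b a r \<longleftrightarrow>
     r > 0 \<and> (\<forall>x\<in>ball a r. ((\<lambda>k. b k * monomial k (x - a)) has_sum f x) UNIV)"

lemma mv_analytic_on_altdef: "mv_analytic_on f U \<longleftrightarrow> (\<forall>a\<in>U. \<exists>b r. power_series_at f b a r)"
  unfolding mv_analytic_on_def power_series_at_def by (rule ball_cong[OF refl]) blast

lemma power_series_atD:
  "power_series_at f b a r \<Longrightarrow> norm w < r \<Longrightarrow> ((\<lambda>k. b k * monomial k w) has_sum f (a + w)) UNIV"
  unfolding power_series_at_def by (drule conjunct2, drule bspec[of _ _ "a + w"]) (auto simp: dist_norm)

lemma power_series_atI:
  assumes "r > 0" "\<And>w. norm w < r \<Longrightarrow> ((\<lambda>k. b k * monomial k w) has_sum f (a + w)) UNIV"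
  shows "power_series_at f b a r"
  unfolding power_series_at_def using assms(1) assms(2)[of "x - a" for x]
  by (auto simp: dist_norm norm_minus_commute)

lemma power_series_at_axis:
  assumes "power_series_at f b a r"
  shows "(\<lambda>z. f (a + axis i z)) holomorphic_on ball 0 r"
    and "partial_deriv i f a = b (unit_index i)"
    and "f a = b (\<lambda>_. 0)"
proof -
  have "r > 0" using assms by (simp add: power_series_at_def)
  moreover have "((\<lambda>j. b j * monomial j w) has_sum f (a + w)) UNIV" if "w \<in> ball 0 r" for w
    using that by (intro power_series_atD[OF assms]) simp
  ultimately show "(\<lambda>z. f (a + axis i z)) holomorphic_on ball 0 r"
    "partial_deriv i f a = b (unit_index i)" "f a = b (\<lambda>_. 0)"
    using power_series_on_axis[of r b f a] by blast+
qed

lemma nonzero_vector_of_small_norm: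
  assumes "r > 0"
  obtains u :: "complex^'n::finite" and \<delta> :: real
  where "\<delta> > 0" "u = (\<chi> i. of_real \<delta>)" "norm u < r"
proof -
  have fin: "0 < real CARD('n)" by simp
  define \<delta> where "\<delta> = r / (2 * real CARD('n))"
  define u :: "complex^'n" where "u = (\<chi> i. of_real \<delta>)"
  have d: "\<delta> > 0" unfolding \<delta>_def using assms fin by simp
  have "norm u \<le> (\<Sum>i\<in>UNIV. norm (u $ i))"
    unfolding norm_vec_def by (rule L2_set_le_sum) simp
  also have "\<dots> = r / 2" using fin assms unfolding u_def \<delta>_def by (simp add: norm_divide)
  finally show thesis using that[OF d u_def] assms by simp
qed

lemma recentred_coeff_has_sum:
  assumes f: "power_series_at f b a r" and y: "norm y < r"
  shows "((\<lambda>k. multi_choose (\<lambda>i. k i + j i) j * b (\<lambda>i. k i + j i) * monomial k y)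
           has_sum recentred_coeff b y j) UNIV"
proof -
  have "r - norm y > 0" using y by simp
  from nonzero_vector_of_small_norm[OF this] obtain u :: "complex^'a" and \<delta>
    where u: "\<delta> > 0" "u = (\<chi> i. of_real \<delta>)" "norm u < r - norm y" by blast
  have "norm (modulus_sum y u) < r" using norm_modulus_sum_le[of y u] u(3) by simp
  from has_sum_imp_summable[OF power_series_atD[OF f this]]
  show ?thesis by (rule recentre_power_series(3)) (use u in \<open>simp add: monomial_def\<close>)
qed

lemma power_series_at_recentre:
  assumes f: "power_series_at f b a r" and y: "norm y < r"
  shows "power_series_at f (recentred_coeff b y) (a + y) (r - norm y)"
proof (rule power_series_atI)
  show "r - norm y > 0" using y by simp
next
  fix w :: "complex^'a" assume w: "norm w < r - norm y"
  have "norm (modulus_sum y w) < r" using norm_modulus_sum_le[of y w] w by simp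
  from recentre_power_series(1)[OF has_sum_imp_summable[OF power_series_atD[OF f this]]]
  have "((\<lambda>j. recentred_coeff b y j * monomial j w) has_sum (\<Sum>\<^sub>\<infinity>k. b k * monomial k (y + w))) UNIV" .
  moreover have "norm (y + w) < r" using norm_triangle_ineq[of y w] w by simp
  then have "(\<Sum>\<^sub>\<infinity>k. b k * monomial k (y + w)) = f (a + y + w)"
    using power_series_atD[OF f, of "y + w"] by (simp add: infsumI add.assoc)
  ultimately show "((\<lambda>j. recentred_coeff b y j * monomial j w) has_sum f (a + y + w)) UNIV" by simp
qed

text \<open>The coefficients of the partial derivative of a power series.\<close>
definition deriv_coeff :: "'n \<Rightarrow> (('n \<Rightarrow> nat) \<Rightarrow> complex) \<Rightarrow> ('n \<Rightarrow> nat) \<Rightarrow> complex" where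
  "deriv_coeff i b k = of_nat (k i + 1) * b (\<lambda>j. k j + unit_index i j)"

lemma deriv_coeff_commute: "deriv_coeff i (deriv_coeff j b) = deriv_coeff j (deriv_coeff i b)"
  by (rule ext) (auto simp: deriv_coeff_def unit_index_def algebra_simps)

text \<open>The partial derivative at \<open>a + w\<close> is the coefficient of the unit multi-index after recentring at
  \<open>a + w\<close>; as a function of \<open>w\<close> this coefficient is again a power series.\<close>
lemma power_series_at_partial_deriv:
  assumes f: "power_series_at f b a r"
  shows "power_series_at (partial_deriv i f) (deriv_coeff i b) a r"
proof (rule power_series_atI)
  show "r > 0" using f by (simp add: power_series_at_def)
next
  fix w :: "complex^'a" assume w: "norm w < r"
  have "partial_deriv i f (a + w) = recentred_coeff b w (unit_index i)"
    by (rule power_series_at_axis(2)[OF power_series_at_recentre[OF f w]])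
  then show "((\<lambda>k. deriv_coeff i b k * monomial k w) has_sum partial_deriv i f (a + w)) UNIV"
    using recentred_coeff_has_sum[OF f w, of "unit_index i"]
    by (simp add: multi_choose_unit_index deriv_coeff_def)
qed

lemma mv_analytic_on_partial_deriv:
  "mv_analytic_on f U \<Longrightarrow> mv_analytic_on (partial_deriv i f) U"
  unfolding mv_analytic_on_altdef using power_series_at_partial_deriv by blast

lemma partial_deriv_commute:
  assumes "mv_analytic_on f U" "x \<in> U"
  shows "partial_deriv i (partial_deriv j f) x = partial_deriv j (partial_deriv i f) x"
proof -
  obtain b r where f: "power_series_at f b x r" using assms unfolding mv_analytic_on_altdef by blast
  have "partial_deriv i (partial_deriv j f) x = deriv_coeff i (deriv_coeff j b) (\<lambda>_. 0)" for i j
    by (rule power_series_at_axis(3)[OF power_series_at_partial_deriv[OF power_series_at_partial_deriv[OF f]]])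
  then show ?thesis by (metis deriv_coeff_commute)
qed

lemma power_series_at_has_partial_deriv:
  assumes "power_series_at f b a r"
  shows "((\<lambda>z. f (a + axis i z)) has_field_derivative partial_deriv i f a) (at 0)"
  using power_series_at_axis(1)[OF assms, of i] assms unfolding partial_deriv_def
  by (intro holomorphic_derivI[OF _ open_ball]) (auto simp: power_series_at_def)

lemma has_partial_deriv:
  assumes "mv_analytic_on f U" "x \<in> U"
  shows "((\<lambda>z. f (x + axis i z)) has_field_derivative partial_deriv i f x) (at 0)"
  using assms power_series_at_has_partial_deriv unfolding mv_analytic_on_altdef by blast

lemma power_series_at_isCont:
  assumes f: "power_series_at f b a r"
  shows "isCont f a"
proof -
  have "r > 0" using f by (simp add: power_series_at_def)
  from nonzero_vector_of_small_norm[OF this] obtain u :: "complex^'a" and \<delta>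
    where u: "\<delta> > 0" "u = (\<chi> i. of_real \<delta>)" "norm u < r" by blast
  have "(\<lambda>k. norm (b k * monomial k u)) summable_on UNIV"
    using has_sum_imp_summable[OF power_series_atD[OF f u(3)]]
    by (simp only: summable_on_iff_abs_summable_on_complex)
  then obtain S where S: "((\<lambda>k. norm (b k * monomial k u)) has_sum S) UNIV"
    by (auto simp: summable_on_def)
  have bound: "norm (f (a + y) - f a) \<le> norm y / \<delta> * S" if y: "norm y < min \<delta> r" for y
  proof -
    have fa: "((\<lambda>k. b k * monomial k 0) has_sum f (a + 0)) UNIV"
      by (rule power_series_atD[OF f]) (use \<open>r > 0\<close> in simp)
    have "((\<lambda>k. b k * monomial k y + - (b k * monomial k 0)) has_sum f (a + y) + - f (a + 0)) UNIV"
      by (intro has_sum_add has_sum_uminusI power_series_atD[OF f] fa) (use y in auto)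
    moreover have "((\<lambda>k. norm y / \<delta> * norm (b k * monomial k u)) has_sum norm y / \<delta> * S) UNIV"
      by (rule has_sum_cmult_right[OF S])
    moreover have "norm (b k * monomial k y + - (b k * monomial k 0))
        \<le> norm y / \<delta> * norm (b k * monomial k u)" for k
    proof (cases "k = (\<lambda>_. 0)")
      case True
      then show ?thesis using u(1) by simp
    next
      case False
      then obtain i where "k i \<noteq> 0" by auto
      then have pos: "(\<Sum>i\<in>UNIV. k i) > 0" by (intro sum_pos2[of _ i]) auto
      \<comment> \<open>Every monomial of positive degree gains the factor \<open>t\<close> when its argument shrinks by \<open>t\<close>.\<close>
      define t where "t = norm y / \<delta>"
      have t: "0 \<le> t" "t \<le> 1" using u(1) y by (auto simp: t_def)
      have "norm (monomial k y) \<le> (\<Prod>i\<in>UNIV. (t * \<delta>) ^ k i)"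
        unfolding norm_monomial using u(1) Finite_Cartesian_Product.norm_nth_le[of y]
        by (intro prod_mono) (auto simp: t_def intro!: power_mono)
      also have "\<dots> = t ^ (\<Sum>i\<in>UNIV. k i) * norm (monomial k u)"
        using u(1) unfolding norm_monomial u(2)
        by (simp add: power_mult_distrib prod.distrib power_sum)
      also have "\<dots> \<le> t * norm (monomial k u)"
        using t pos power_decreasing[of 1 "\<Sum>i\<in>UNIV. k i" t] by (intro mult_right_mono) auto
      finally have "norm (b k) * norm (monomial k y) \<le> norm (b k) * (t * norm (monomial k u))"
        by (intro mult_left_mono) auto
      then show ?thesis using False by (simp add: monomial_at_0 norm_mult t_def mult_ac)
    qed
    ultimately have "norm (f (a + y) + - f (a + 0)) \<le> norm y / \<delta> * S"
      by (rule norm_infsum_le)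
    then show ?thesis by simp
  qed
  have "((\<lambda>y. f (a + y) - f a) \<longlongrightarrow> 0) (at 0)"
  proof (rule Lim_null_comparison)
    have "eventually (\<lambda>y::complex^'a. norm y < min \<delta> r) (at 0)"
      using u(1) \<open>r > 0\<close> by (intro eventually_at_in_open[of "ball 0 (min \<delta> r)", THEN eventually_mono]) auto
    then show "eventually (\<lambda>y. norm (f (a + y) - f a) \<le> norm y / \<delta> * S) (at 0)"
      by (rule eventually_mono) (rule bound)
    have "((\<lambda>y::complex^'a. norm y / \<delta> * S) \<longlongrightarrow> norm (0::complex^'a) / \<delta> * S) (at 0)"
      by (intro tendsto_intros) (use u(1) in auto)
    then show "((\<lambda>y::complex^'a. norm y / \<delta> * S) \<longlongrightarrow> 0) (at 0)" by simp
  qed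
  then show ?thesis
    unfolding isCont_iff by (simp add: LIM_zero_iff)
qed

lemma mv_analytic_on_continuous_on: "mv_analytic_on f U \<Longrightarrow> continuous_on U f"
  unfolding mv_analytic_on_altdef
  by (meson continuous_at_imp_continuous_on power_series_at_isCont)

lemma mv_analytic_on_const: "mv_analytic_on (\<lambda>_. c) U"
  unfolding mv_analytic_on_altdef
proof
  fix a :: "complex^'a"
  have "power_series_at (\<lambda>_. c) (\<lambda>k. if k = (\<lambda>_. 0) then c else 0) a 1"
    by (intro power_series_atI has_sum_finite_neutralI[of "{\<lambda>_. 0}"]) auto
  then show "\<exists>b r. power_series_at (\<lambda>_. c) b a r" by blast
qed

lemma mv_analytic_on_coord: "mv_analytic_on (\<lambda>x. x $ i) U"
  unfolding mv_analytic_on_altdef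
proof
  fix a :: "complex^'a"
  define b where "b k = (if k = (\<lambda>_. 0) then a $ i else if k = unit_index i then 1 else 0)" for k
  have ne: "unit_index i \<noteq> (\<lambda>_. 0)" by (metis unit_index_simps(1) zero_neq_one)
  have "power_series_at (\<lambda>x. x $ i) b a 1"
  proof (intro power_series_atI has_sum_finite_neutralI[of "{\<lambda>_. 0, unit_index i}"])
    fix w :: "complex^'a"
    show "(a + w) $ i = (\<Sum>k\<in>{\<lambda>_. 0, unit_index i}. b k * monomial k w)"
      using ne by (simp add: b_def monomial_unit_index)
  qed (auto simp: b_def)
  then show "\<exists>b r. power_series_at (\<lambda>x. x $ i) b a r" by blast
qed

lemma mv_analytic_on_add:
  assumes "mv_analytic_on f U" "mv_analytic_on g U"
  shows "mv_analytic_on (\<lambda>x. f x + g x) U"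
  unfolding mv_analytic_on_altdef
proof
  fix a assume "a \<in> U"
  then obtain b r c r' where fg: "power_series_at f b a r" "power_series_at g c a r'"
    using assms unfolding mv_analytic_on_altdef by blast
  then have "power_series_at (\<lambda>x. f x + g x) (\<lambda>k. b k + c k) a (min r r')"
    unfolding power_series_at_def by (auto simp: distrib_right intro!: has_sum_add)
  then show "\<exists>b r. power_series_at (\<lambda>x. f x + g x) b a r" by blast
qed

lemma has_sum_cauchy_product:
  fixes f g :: "('n::finite \<Rightarrow> nat) \<Rightarrow> complex"
  assumes f: "(f has_sum s) UNIV" and g: "(g has_sum t) UNIV"
  shows "((\<lambda>n. \<Sum>j\<in>{..n}. f (\<lambda>i. n i - j i) * g j) has_sum s * t) UNIV"
proof -
  let ?h = "\<lambda>(k, j). f k * g j"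
  have nf: "(\<lambda>k. norm (f k)) summable_on UNIV" and ng: "(\<lambda>k. norm (g k)) summable_on UNIV"
    by (rule complex_summable_on_norm(1)[OF has_sum_imp_summable[OF f]],
        rule complex_summable_on_norm(1)[OF has_sum_imp_summable[OF g]])
  have "(\<lambda>p. norm (?h p)) summable_on (UNIV \<times> UNIV)"
    by (rule Infinite_Sum.abs_summable_on_Sigma_iff[THEN iffD2])
      (use nf ng in \<open>simp add: norm_mult infsum_cmult_right' infsum_nonneg abs_mult
          summable_on_cmult_left summable_on_cmult_right\<close>)
  then have "?h summable_on (UNIV \<times> UNIV)" by (rule complex_summable_on_norm(2))
  then have h: "(?h has_sum s * t) (UNIV \<times> UNIV)"
    using has_sum_cmult_right[OF g] has_sum_cmult_left[OF f]
    by (intro has_sum_SigmaI[where g = "\<lambda>k. f k * t"]) auto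
  let ?h' = "\<lambda>(n, j). f (\<lambda>i. n i - j i) * g j"
  have "((\<lambda>p. ?h' ((\<lambda>(k, j). ((\<lambda>i. k i + j i), j)) p)) has_sum s * t) UNIV"
    using h by (simp add: case_prod_unfold)
  then have "(?h' has_sum s * t) (Sigma UNIV (\<lambda>n. {..n}))"
    using has_sum_reindex_bij_betw[OF bij_betw_index_split, of ?h' "s * t"] by simp
  then show ?thesis
    by (rule has_sum_SigmaD) (auto intro: has_sum_finiteI)
qed

lemma mv_analytic_on_mult:
  assumes "mv_analytic_on f U" "mv_analytic_on g U"
  shows "mv_analytic_on (\<lambda>x. f x * g x) U"
  unfolding mv_analytic_on_altdef
proof
  fix a assume "a \<in> U"
  then obtain b r c r' where fg: "power_series_at f b a r" "power_series_at g c a r'"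
    using assms unfolding mv_analytic_on_altdef by blast
  define d where "d n = (\<Sum>j\<in>{..n}. b (\<lambda>i. n i - j i) * c j)" for n
  have "power_series_at (\<lambda>x. f x * g x) d a (min r r')"
  proof (rule power_series_atI)
    show "min r r' > 0" using fg by (simp add: power_series_at_def)
  next
    fix w :: "complex^'a" assume w: "norm w < min r r'"
    have "monomial (\<lambda>i. n i - j i) w * monomial j w = monomial n w" if "j \<le> n" for n j :: "'a \<Rightarrow> nat"
    proof -
      have "(\<lambda>i. n i - j i + j i) = n" using that by (auto simp: le_fun_def)
      then show ?thesis by (metis monomial_add_index)
    qed
    then have "(\<Sum>j\<in>{..n}. b (\<lambda>i. n i - j i) * monomial (\<lambda>i. n i - j i) w * (c j * monomial j w))
        = d n * monomial n w" for n
      unfolding d_def sum_distrib_right by (intro sum.cong) (auto simp: mult_ac)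
    then show "((\<lambda>k. d k * monomial k w) has_sum f (a + w) * g (a + w)) UNIV"
      using has_sum_cauchy_product[OF power_series_atD[OF fg(1)] power_series_atD[OF fg(2)], of w w] w
      by simp
  qed
  then show "\<exists>b r. power_series_at (\<lambda>x. f x * g x) b a r" by blast
qed

lemma mv_analytic_on_cmult: "mv_analytic_on f U \<Longrightarrow> mv_analytic_on (\<lambda>x. c * f x) U"
  by (intro mv_analytic_on_mult mv_analytic_on_const)

lemma mv_analytic_on_sum:
  "(\<And>i. i \<in> I \<Longrightarrow> mv_analytic_on (f i) U) \<Longrightarrow> mv_analytic_on (\<lambda>x. \<Sum>i\<in>I. f i x) U"
proof (induction I rule: infinite_finite_induct)
  case (insert i I)
  then show ?case by (simp add: mv_analytic_on_add)
qed (auto simp: mv_analytic_on_const)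

section \<open>Iterated partial derivatives and the identity theorem\<close>

lemma partial_deriv_cong:
  assumes "open W" "x \<in> W" "\<And>y. y \<in> W \<Longrightarrow> f y = g y"
  shows "partial_deriv i f x = partial_deriv i g x"
proof -
  obtain e where e: "e > 0" "ball x e \<subseteq> W" using assms openE by blast
  have "\<forall>z\<in>ball 0 e. f (x + axis i z) = g (x + axis i z)"
    using e by (auto intro!: assms(3) simp: subset_iff dist_norm norm_axis_complex)
  moreover have "open (ball (0::complex) e)" "0 \<in> ball (0::complex) e" using e by auto
  ultimately have "eventually (\<lambda>z. f (x + axis i z) = g (x + axis i z)) (nhds 0)"
    unfolding eventually_nhds by blast
  then show ?thesis unfolding partial_deriv_def by (rule deriv_cong_ev) simp
qed

lemma partial_deriv_add:
  assumes "mv_analytic_on f U" "mv_analytic_on g U" "x \<in> U"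
  shows "partial_deriv i (\<lambda>x. f x + g x) x = partial_deriv i f x + partial_deriv i g x"
  unfolding partial_deriv_def[of i "\<lambda>x. f x + g x"]
  by (rule DERIV_imp_deriv[OF DERIV_add[OF has_partial_deriv[OF assms(1,3)] has_partial_deriv[OF assms(2,3)]]])

lemma axis_0: "axis i (0::complex) = 0"
  by (simp add: vec_eq_iff axis_def)

lemma partial_deriv_mult:
  assumes "mv_analytic_on f U" "mv_analytic_on g U" "x \<in> U"
  shows "partial_deriv i (\<lambda>x. f x * g x) x = partial_deriv i f x * g x + f x * partial_deriv i g x"
  using DERIV_imp_deriv[OF DERIV_mult[OF has_partial_deriv[OF assms(1,3), of i] has_partial_deriv[OF assms(2,3)]]]
  unfolding partial_deriv_def[of i "\<lambda>x. f x * g x"] by (simp add: axis_0 mult.commute)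

lemma partial_deriv_const [simp]: "partial_deriv i (\<lambda>_. c) x = 0"
  by (simp add: partial_deriv_def)

lemma partial_deriv_cmult:
  assumes "mv_analytic_on f U" "x \<in> U"
  shows "partial_deriv i (\<lambda>x. c * f x) x = c * partial_deriv i f x"
  using partial_deriv_mult[OF mv_analytic_on_const assms] by simp

lemma partial_deriv_coord: "partial_deriv i (\<lambda>x. x $ j) x = (if i = j then 1 else 0)"
proof -
  have "((\<lambda>z. (x + axis i z) $ j) has_field_derivative (if i = j then 1 else 0)) (at 0)"
    by (auto simp: axis_def intro!: derivative_eq_intros)
  then show ?thesis unfolding partial_deriv_def by (rule DERIV_imp_deriv)
qed

text \<open>Iterated partial derivatives, along a list of coordinate directions.\<close>
primrec iterated_partial ::
    "'n::finite list \<Rightarrow> (complex^'n \<Rightarrow> complex) \<Rightarrow> complex^'n \<Rightarrow> complex" where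
  "iterated_partial [] f = f"
| "iterated_partial (i # A) f = iterated_partial A (partial_deriv i f)"

lemma iterated_partial_cong:
  assumes "open W" "x \<in> W" "\<And>y. y \<in> W \<Longrightarrow> f y = g y"
  shows "iterated_partial A f x = iterated_partial A g x"
  using assms(3)
proof (induction A arbitrary: f g)
  case (Cons i A)
  have "partial_deriv i f y = partial_deriv i g y" if "y \<in> W" for y
    by (rule partial_deriv_cong[OF assms(1) that]) (rule Cons.prems)
  from Cons.IH[OF this] show ?case by simp
qed (use assms(2) in simp)

lemma mv_analytic_on_iterated_partial:
  "mv_analytic_on f U \<Longrightarrow> mv_analytic_on (iterated_partial A f) U"
  by (induction A arbitrary: f) (auto simp: mv_analytic_on_partial_deriv)

lemma iterated_partial_add:
  assumes "open U" "x \<in> U" "mv_analytic_on f U" "mv_analytic_on g U"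
  shows "iterated_partial A (\<lambda>x. f x + g x) x = iterated_partial A f x + iterated_partial A g x"
  using assms(3,4)
proof (induction A arbitrary: f g)
  case (Cons i A)
  have "iterated_partial A (partial_deriv i (\<lambda>x. f x + g x)) x
      = iterated_partial A (\<lambda>x. partial_deriv i f x + partial_deriv i g x) x"
    by (rule iterated_partial_cong[OF assms(1,2)]) (rule partial_deriv_add[OF Cons.prems])
  then show ?case using Cons by (simp add: mv_analytic_on_partial_deriv)
qed simp

lemma iterated_partial_zero: "iterated_partial A (\<lambda>_. 0) x = 0"
proof (induction A)
  case (Cons i A)
  have "partial_deriv i (\<lambda>_. 0) = (\<lambda>_::complex^'a. 0)" by (rule ext) simp
  then show ?case using Cons by simp
qed simp

lemma iterated_partial_cmult:
  assumes "open U" "x \<in> U" "mv_analytic_on f U"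
  shows "iterated_partial A (\<lambda>x. c * f x) x = c * iterated_partial A f x"
  using assms(3)
proof (induction A arbitrary: f)
  case (Cons i A)
  have "iterated_partial A (partial_deriv i (\<lambda>x. c * f x)) x
      = iterated_partial A (\<lambda>x. c * partial_deriv i f x) x"
    by (rule iterated_partial_cong[OF assms(1,2)]) (rule partial_deriv_cmult[OF Cons.prems])
  then show ?case using Cons by (simp add: mv_analytic_on_partial_deriv)
qed simp

lemma iterated_partial_sum:
  assumes "open U" "x \<in> U" "\<And>i. i \<in> I \<Longrightarrow> mv_analytic_on (f i) U"
  shows "iterated_partial A (\<lambda>x. \<Sum>i\<in>I. f i x) x = (\<Sum>i\<in>I. iterated_partial A (f i) x)"
  using assms(3)
proof (induction I rule: infinite_finite_induct)
  case (insert i I)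
  then show ?case
    by (simp add: iterated_partial_add[OF assms(1,2)] mv_analytic_on_sum)
qed (auto simp: iterated_partial_zero)

lemma iterated_partial_move:
  assumes "open U" "x \<in> U" "mv_analytic_on f U"
  shows "iterated_partial (s # B @ C) f x = iterated_partial (B @ s # C) f x"
  using assms(3)
proof (induction B arbitrary: f)
  case (Cons b B)
  have "iterated_partial (s # (b # B) @ C) f x = iterated_partial (B @ C) (partial_deriv b (partial_deriv s f)) x"
    by simp
  also have "\<dots> = iterated_partial (B @ C) (partial_deriv s (partial_deriv b f)) x"
    by (rule iterated_partial_cong[OF assms(1,2)]) (rule partial_deriv_commute[OF Cons.prems])
  also have "\<dots> = iterated_partial (B @ s # C) (partial_deriv b f) x"
    using Cons.IH[of "partial_deriv b f"] Cons.prems by (simp add: mv_analytic_on_partial_deriv)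
  finally show ?case by simp
qed simp

text \<open>If all derivatives of \<open>h\<close> of order below \<open>d\<close> vanish at \<open>c\<close>, then in the derivatives of \<open>F * h\<close>
  of order at most \<open>d\<close> no derivative may fall on \<open>F\<close>.\<close>
lemma iterated_partial_mult_vanishing:
  assumes "open U" "c \<in> U"
    and "mv_analytic_on F U" "mv_analytic_on h U"
    and "\<And>B. length B < d \<Longrightarrow> iterated_partial B h c = 0" "length A \<le> d"
  shows "iterated_partial A (\<lambda>x. F x * h x) c = F c * iterated_partial A h c"
  using assms(3-)
proof (induction A arbitrary: F h d)
  case (Cons i A)
  note an = mv_analytic_on_partial_deriv[OF Cons.prems(1)] mv_analytic_on_partial_deriv[OF Cons.prems(2)]
  have "iterated_partial (i # A) (\<lambda>x. F x * h x) c
      = iterated_partial A (\<lambda>x. partial_deriv i F x * h x + F x * partial_deriv i h x) c"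
    unfolding iterated_partial.simps
    by (rule iterated_partial_cong[OF assms(1,2)]) (rule partial_deriv_mult[OF Cons.prems(1,2)])
  also have "\<dots> = iterated_partial A (\<lambda>x. partial_deriv i F x * h x) c
      + iterated_partial A (\<lambda>x. F x * partial_deriv i h x) c"
    by (intro iterated_partial_add[OF assms(1,2)] mv_analytic_on_mult Cons.prems an)
  also have "iterated_partial A (\<lambda>x. partial_deriv i F x * h x) c = partial_deriv i F c * iterated_partial A h c"
    by (rule Cons.IH[OF an(1) Cons.prems(2) Cons.prems(3)]) (use Cons.prems(4) in auto)
  also have "iterated_partial A h c = 0" by (rule Cons.prems(3)) (use Cons.prems(4) in simp)
  also have "iterated_partial A (\<lambda>x. F x * partial_deriv i h x) c = F c * iterated_partial A (partial_deriv i h) c"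
  proof (rule Cons.IH[OF Cons.prems(1) an(2), of "d - 1"])
    fix B :: "'a list" assume "length B < d - 1"
    then show "iterated_partial B (partial_deriv i h) c = 0"
      using Cons.prems(3)[of "i # B"] by simp
  qed (use Cons.prems(4) in auto)
  finally show ?case by simp
qed simp

text \<open>If moreover \<open>F\<close> vanishes at \<open>c\<close>, then in the derivatives of order at most \<open>d + 1\<close> exactly one
  derivative must fall on \<open>F\<close>.\<close>
lemma iterated_partial_mult_first_order:
  assumes "open U" "c \<in> U" "F c = 0"
    and "mv_analytic_on F U" "mv_analytic_on h U"
    and "\<And>B. length B < d \<Longrightarrow> iterated_partial B h c = 0" "length A \<le> Suc d"
  shows "iterated_partial A (\<lambda>x. F x * h x) c
    = (\<Sum>a<length A. partial_deriv (A ! a) F c * iterated_partial (take a A @ drop (Suc a) A) h c)"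
  using assms(5-)
proof (induction A arbitrary: h d)
  case Nil
  then show ?case using assms(3) by simp
next
  case (Cons i A)
  note an = mv_analytic_on_partial_deriv[OF assms(4)] mv_analytic_on_partial_deriv[OF Cons.prems(1)]
  have "iterated_partial (i # A) (\<lambda>x. F x * h x) c
      = iterated_partial A (\<lambda>x. partial_deriv i F x * h x + F x * partial_deriv i h x) c"
    unfolding iterated_partial.simps
    by (rule iterated_partial_cong[OF assms(1,2)]) (rule partial_deriv_mult[OF assms(4) Cons.prems(1)])
  also have "\<dots> = iterated_partial A (\<lambda>x. partial_deriv i F x * h x) c
      + iterated_partial A (\<lambda>x. F x * partial_deriv i h x) c"
    by (intro iterated_partial_add[OF assms(1,2)] mv_analytic_on_mult Cons.prems an assms(4))
  also have "iterated_partial A (\<lambda>x. partial_deriv i F x * h x) c = partial_deriv i F c * iterated_partial A h c"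
    by (rule iterated_partial_mult_vanishing[OF assms(1,2) an(1) Cons.prems(1,2)])
      (use Cons.prems(3) in auto)
  also have "iterated_partial A (\<lambda>x. F x * partial_deriv i h x) c
     = (\<Sum>a<length A. partial_deriv (A ! a) F c * iterated_partial (take a A @ drop (Suc a) A) (partial_deriv i h) c)"
  proof (cases "d = 0")
    case True
    then show ?thesis using Cons.prems(3) assms(3) by simp
  next
    case False
    show ?thesis
    proof (rule Cons.IH[OF an(2), of "d - 1"])
      fix B :: "'a list" assume "length B < d - 1"
      then show "iterated_partial B (partial_deriv i h) c = 0"
        using Cons.prems(2)[of "i # B"] by simp
    qed (use Cons.prems(3) False in auto)
  qed
  finally show ?case by (simp add: sum.lessThan_Suc_shift del: sum.lessThan_Suc)
qed

lemma power_series_at_coeffs_zero: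
  assumes "power_series_at f b a r" "\<And>A. iterated_partial A f a = 0"
  shows "b k = 0"
  using assms
proof (induction "\<Sum>i\<in>UNIV. k i" arbitrary: k f b)
  case 0
  from 0(1) have "(\<Sum>i\<in>UNIV. k i) = 0" by (rule sym)
  then have "\<forall>i\<in>UNIV. k i = 0" by (subst (asm) sum_eq_0_iff) simp_all
  then have "k = (\<lambda>_. 0)" by (simp add: fun_eq_iff)
  then show ?case using 0(3)[of "[]"] power_series_at_axis(3)[OF 0(2)] by simp
next
  case (Suc N)
  have "k \<noteq> (\<lambda>_. 0)"
  proof
    assume "k = (\<lambda>_. 0)"
    with Suc(2) show False by simp
  qed
  then obtain i where i: "k i \<noteq> 0" by (meson ext)
  define k' where "k' = k(i := k i - 1)"
  have k: "k = (\<lambda>j. k' j + unit_index i j)" using i by (auto simp: k'_def unit_index_def)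
  have "(\<Sum>j\<in>UNIV. k j) = (\<Sum>j\<in>UNIV. k' j) + (\<Sum>j\<in>UNIV. unit_index i j)"
    by (subst k) (simp add: sum.distrib)
  then have N: "N = (\<Sum>j\<in>UNIV. k' j)" using Suc(2) by (simp add: unit_index_def)
  have "deriv_coeff i b k' = 0"
    by (rule Suc(1)[OF N power_series_at_partial_deriv[OF Suc(3)]])
      (use Suc(4)[of "i # A" for A] in simp)
  moreover have "of_nat (k' i + 1) \<noteq> (0::complex)" by (simp only: of_nat_eq_0_iff)
  ultimately have "b (\<lambda>j. k' j + unit_index i j) = 0" by (simp only: deriv_coeff_def mult_eq_0_iff simp_thms)
  then show ?case by (simp only: k[symmetric])
qed

text \<open>The identity theorem, in the form that the vanishing of the Taylor series propagates.\<close>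
lemma mv_analytic_on_identity:
  assumes V: "open V" "connected V" and f: "mv_analytic_on f V"
    and c: "c \<in> V" "\<And>A. iterated_partial A f c = 0" and x: "x \<in> V"
  shows "iterated_partial A f x = 0"
proof -
  define Z where "Z = {x \<in> V. \<forall>A. iterated_partial A f x = 0}"
  have "closedin (top_of_set V) {x \<in> V. iterated_partial A f x = 0}" for A
    by (rule continuous_closedin_preimage_constant[OF
          mv_analytic_on_continuous_on[OF mv_analytic_on_iterated_partial[OF f]]])
  then have "closedin (top_of_set V) (\<Inter>A. {x \<in> V. iterated_partial A f x = 0})"
    by (intro closedin_Inter) auto
  moreover have "(\<Inter>A. {x \<in> V. iterated_partial A f x = 0}) = Z" by (auto simp: Z_def)
  ultimately have clo: "closedin (top_of_set V) Z" by simp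
  have "open Z"
    unfolding open_contains_ball
  proof
    fix y assume "y \<in> Z"
    then have y: "y \<in> V" "\<And>A. iterated_partial A f y = 0" by (auto simp: Z_def)
    then obtain b r where b: "power_series_at f b y r" using f unfolding mv_analytic_on_altdef by blast
    obtain e where e: "e > 0" "ball y e \<subseteq> V" using V(1) y(1) openE by blast
    have r: "r > 0" using b by (simp add: power_series_at_def)
    have "f z = 0" if "z \<in> ball y (min e r)" for z
    proof -
      have "((\<lambda>k. b k * monomial k (z - y)) has_sum f z) UNIV"
        using b that by (simp add: power_series_at_def)
      then have "((\<lambda>_ :: 'a \<Rightarrow> nat. 0) has_sum f z) UNIV"
        using power_series_at_coeffs_zero[OF b y(2)] by simp
      then show ?thesis by (rule has_sum_unique) simp
    qed
    then have "iterated_partial A f z = 0" if "z \<in> ball y (min e r)" for A z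
      using iterated_partial_cong[OF open_ball that, of f "\<lambda>_. 0"] by (simp add: iterated_partial_zero)
    moreover have "ball y (min e r) \<subseteq> V" using e by auto
    ultimately have "ball y (min e r) \<subseteq> Z" unfolding Z_def by blast
    moreover have "min e r > 0" using e r by simp
    ultimately show "\<exists>e>0. ball y e \<subseteq> Z" by blast
  qed
  then have "openin (top_of_set V) Z" by (subst openin_open_eq[OF V(1)]) (auto simp: Z_def)
  with clo have "Z = {} \<or> Z = V" using V(2) unfolding connected_clopen by metis
  then show ?thesis using c x by (auto simp: Z_def)
qed

section \<open>Weighted homogeneous series centred at the origin\<close>

lemma summable_on_monomial_mono:
  fixes a :: "('n::finite \<Rightarrow> nat) \<Rightarrow> complex" and v x :: "complex^'n"
  assumes v: "(\<lambda>k. a k * monomial k v) summable_on UNIV" and le: "\<And>i. norm (x $ i) \<le> norm (v $ i)"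
  shows "(\<lambda>k. a k * monomial k x) summable_on UNIV"
proof (rule complex_summable_on_norm(2), rule Infinite_Sum.abs_summable_on_comparison_test'[OF complex_summable_on_norm(1)[OF v]])
  fix k
  have "norm (monomial k x) \<le> norm (monomial k v)"
    unfolding norm_monomial by (intro prod_mono conjI power_mono le) auto
  then show "norm (a k * monomial k x) \<le> norm (a k * monomial k v)"
    unfolding norm_mult by (intro mult_left_mono) auto
qed

text \<open>In an open set, every point can be moved so that the moduli of all its coordinates grow.\<close>
lemma enlarge_moduli:
  fixes c :: "complex^'n::finite"
  assumes "open U" "c \<in> U"
  obtains v :: "complex^'n" and \<delta> where "\<delta> > 0" "v \<in> U" "\<And>i. norm (v $ i) = norm (c $ i) + \<delta>"
proof -
  obtain e where e: "e > 0" "ball c e \<subseteq> U" using assms openE by blast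
  obtain u :: "complex^'n" and \<delta> where u: "\<delta> > 0" "u = (\<chi> i. of_real \<delta>)" "norm u < e"
    using nonzero_vector_of_small_norm[OF e(1)] by blast
  define d :: "complex^'n" where "d = (\<chi> i::'n. (if c $ i = 0 then 1 else sgn (c $ i)) * of_real \<delta>)"
  have "norm (d $ i) = norm (u $ i)" for i
    using u(1) by (simp add: d_def u(2) norm_mult norm_sgn)
  then have "norm d = norm u" by (simp add: norm_vec_def)
  then have "c + d \<in> U" using u(3) e by (auto simp: subset_iff dist_norm)
  moreover have "norm ((c + d) $ i) = norm (c $ i) + \<delta>" for i
  proof (cases "c $ i = 0")
    case False
    have "c $ i = of_real (norm (c $ i)) * sgn (c $ i)" using False by (simp add: sgn_eq)
    then have "(c + d) $ i = of_real (norm (c $ i) + \<delta>) * sgn (c $ i)"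
      using False by (simp add: d_def algebra_simps)
    then show ?thesis using False u(1) by (simp add: norm_mult norm_sgn del: of_real_add)
  qed (use u(1) in \<open>simp add: d_def\<close>)
  ultimately show thesis using that u(1) by blast
qed

lemma open_coordinate_polydisc: "open {x :: complex^'n::finite. \<forall>i. norm (x $ i) < R i}"
proof -
  have "open {x :: complex^'n. norm (x $ i) < R i}" for i
    by (intro open_Collect_less continuous_intros)
  then have "open (\<Inter>i. {x :: complex^'n. norm (x $ i) < R i})" by (intro open_INT) auto
  moreover have "(\<Inter>i. {x :: complex^'n. norm (x $ i) < R i}) = {x. \<forall>i. norm (x $ i) < R i}" by auto
  ultimately show ?thesis by simp
qed

lemma convex_coordinate_polydisc: "convex {x :: complex^'n::finite. \<forall>i. norm (x $ i) < R i}"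
proof -
  have "convex {x :: complex^'n. norm (x $ i) < R i}" for i
  proof -
    have "{x :: complex^'n. norm (x $ i) < R i} = (\<lambda>x. x $ i) -` ball 0 (R i)" by auto
    then show ?thesis
      by (simp add: convex_linear_vimage bounded_linear.linear bounded_linear_vec_nth)
  qed
  then have "convex (\<Inter>i. {x :: complex^'n. norm (x $ i) < R i})" by (intro convex_INT) auto
  moreover have "(\<Inter>i. {x :: complex^'n. norm (x $ i) < R i}) = {x. \<forall>i. norm (x $ i) < R i}" by auto
  ultimately show ?thesis by simp
qed

text \<open>A power series centred at the origin that converges on an open set \<open>U\<close>, which need not contain
  the origin, can be recentred at every point of \<open>U\<close>.\<close>
lemma global_series_recentre:
  fixes a :: "('n::finite \<Rightarrow> nat) \<Rightarrow> complex"
  assumes U: "open U" "y \<in> U" and f: "\<And>x. x \<in> U \<Longrightarrow> ((\<lambda>k. a k * monomial k x) has_sum f x) UNIV"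
  obtains r where "power_series_at f (recentred_coeff a y) y r"
    and "\<And>j. ((\<lambda>k. multi_choose (\<lambda>i. k i + j i) j * a (\<lambda>i. k i + j i) * monomial k y)
           has_sum recentred_coeff a y j) UNIV"
proof -
  obtain v :: "complex^'n" and \<delta> where v: "\<delta> > 0" "v \<in> U" "\<And>i. norm (v $ i) = norm (y $ i) + \<delta>"
    using enlarge_moduli[OF U] by metis
  obtain e where e: "e > 0" "ball y e \<subseteq> U" using U openE by blast
  have sm: "(\<lambda>k. a k * monomial k (modulus_sum y w)) summable_on UNIV"
    if "\<And>i. norm (w $ i) \<le> \<delta>" for w :: "complex^'n"
  proof (rule summable_on_monomial_mono[OF has_sum_imp_summable[OF f[OF v(2)]]])
    fix i
    show "norm (modulus_sum y w $ i) \<le> norm (v $ i)"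
      using that[of i] unfolding v(3) by (simp add: modulus_sum_def del: of_real_add)
  qed
  have "power_series_at f (recentred_coeff a y) y (min \<delta> e)"
  proof (rule power_series_atI)
    show "min \<delta> e > 0" using v e by simp
  next
    fix w :: "complex^'n" assume w: "norm w < min \<delta> e"
    have "norm (w $ i) \<le> \<delta>" for i using Finite_Cartesian_Product.norm_nth_le[of w i] w by linarith
    then have "((\<lambda>j. recentred_coeff a y j * monomial j w) has_sum (\<Sum>\<^sub>\<infinity>k. a k * monomial k (y + w))) UNIV"
      by (rule recentre_power_series(1)[OF sm])
    moreover have "y + w \<in> U" using w e by (auto simp: subset_iff dist_norm)
    ultimately show "((\<lambda>j. recentred_coeff a y j * monomial j w) has_sum f (y + w)) UNIV"
      using infsumI[OF f] by simp
  qed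
  moreover
  define u :: "complex^'n" where "u = (\<chi> i. of_real \<delta>)"
  have "((\<lambda>k. multi_choose (\<lambda>i. k i + j i) j * a (\<lambda>i. k i + j i) * monomial k y)
           has_sum recentred_coeff a y j) UNIV" for j
    by (rule recentre_power_series(3)[OF sm, of u]) (use v(1) in \<open>auto simp: u_def monomial_def\<close>)
  ultimately show thesis by (rule that)
qed

lemma global_series_mv_analytic_on:
  assumes U: "open U" and f: "\<And>x. x \<in> U \<Longrightarrow> ((\<lambda>k. a k * monomial k x) has_sum f x) UNIV"
  shows "mv_analytic_on f U"
  unfolding mv_analytic_on_altdef
proof
  fix y assume "y \<in> U"
  from global_series_recentre[OF U this f] obtain r where "power_series_at f (recentred_coeff a y) y r"
    by blast
  then show "\<exists>b r. power_series_at f b y r" by blast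
qed

text \<open>Such a series is determined by its germ at any point of \<open>U\<close>, even if \<open>U\<close> is disconnected:
  the series also converges on a polydisc around the origin that contains the given point.\<close>
lemma global_series_coeffs_zero:
  fixes a :: "('n::finite \<Rightarrow> nat) \<Rightarrow> complex"
  assumes U: "open U" "c \<in> U" and f: "\<And>x. x \<in> U \<Longrightarrow> ((\<lambda>k. a k * monomial k x) has_sum f x) UNIV"
    and van: "\<And>A. iterated_partial A f c = 0"
  shows "a k = 0"
proof -
  obtain v :: "complex^'n" and \<delta> where v: "\<delta> > 0" "v \<in> U" "\<And>i. norm (v $ i) = norm (c $ i) + \<delta>"
    using enlarge_moduli[OF U] by metis
  define P where "P = {x :: complex^'n. \<forall>i. norm (x $ i) < norm (v $ i)}"
  \<comment> \<open>The sum of the series on \<open>P\<close>; outside \<open>U\<close> nothing is known about \<open>f\<close>.\<close>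
  define h where "h x = (\<Sum>\<^sub>\<infinity>k. a k * monomial k x)" for x
  have P: "open P" "connected P" "c \<in> P" "0 \<in> P"
    using v(1) unfolding P_def
    by (auto simp: open_coordinate_polydisc convex_connected convex_coordinate_polydisc v(3) add_nonneg_pos)
  have h: "((\<lambda>k. a k * monomial k x) has_sum h x) UNIV" if "x \<in> P" for x
    unfolding h_def using that
    by (intro has_sum_infsum summable_on_monomial_mono[OF has_sum_imp_summable[OF f[OF v(2)]]])
      (auto simp: P_def less_imp_le)
  have h_an: "mv_analytic_on h P" by (rule global_series_mv_analytic_on[OF P(1) h])
  have "iterated_partial A h c = iterated_partial A f c" for A
  proof (rule iterated_partial_cong[of "U \<inter> P"])
    fix y assume "y \<in> U \<inter> P"
    then show "h y = f y" unfolding h_def by (intro infsumI f) simp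
  qed (use U P in \<open>auto simp: open_Int\<close>)
  then have "iterated_partial A h 0 = 0" for A
    using mv_analytic_on_identity[OF P(1,2) h_an P(3) _ P(4)] van by simp
  moreover obtain e where e: "e > 0" "ball 0 e \<subseteq> P" using P openE by blast
  have "power_series_at h a 0 e"
    using e h unfolding power_series_at_def by auto
  ultimately show ?thesis using power_series_at_coeffs_zero by blast
qed

lemma has_sum_finite_sum:
  fixes f :: "'i \<Rightarrow> 'a \<Rightarrow> complex"
  shows "(\<And>i. i \<in> I \<Longrightarrow> (f i has_sum S i) A) \<Longrightarrow> ((\<lambda>x. \<Sum>i\<in>I. f i x) has_sum (\<Sum>i\<in>I. S i)) A"
  by (induction I rule: infinite_finite_induct) (auto intro!: has_sum_add)

text \<open>Euler's identity for weighted homogeneous series.\<close>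
lemma weighted_series_euler:
  fixes s :: "'n::finite \<Rightarrow> nat"
  assumes U: "open U" "y \<in> U" and w: "\<And>k. a k \<noteq> 0 \<Longrightarrow> int (\<Sum>i\<in>UNIV. s i * k i) = d"
    and f: "\<And>x. x \<in> U \<Longrightarrow> ((\<lambda>k. a k * monomial k x) has_sum f x) UNIV"
  shows "(\<Sum>i\<in>UNIV. of_nat (s i) * y $ i * partial_deriv i f y) = of_int d * f y"
proof -
  obtain r where r: "power_series_at f (recentred_coeff a y) y r"
    and co: "\<And>j. ((\<lambda>k. multi_choose (\<lambda>i. k i + j i) j * a (\<lambda>i. k i + j i) * monomial k y)
           has_sum recentred_coeff a y j) UNIV"
    using global_series_recentre[OF U f] by blast
  have Euler_term: "((\<lambda>k. of_nat (k i) * (a k * monomial k y)) has_sum y $ i * partial_deriv i f y) UNIV" for i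
  proof -
    let ?g = "\<lambda>k. (\<lambda>j. k j + unit_index i j) :: 'n \<Rightarrow> nat"
    have inj: "inj ?g" by (rule injI) (auto simp: fun_eq_iff)
    have "((\<lambda>k. y $ i * (of_nat (k i + 1) * a (?g k) * monomial k y))
        has_sum y $ i * partial_deriv i f y) UNIV"
      using has_sum_cmult_right[OF co[of "unit_index i"]] power_series_at_axis(2)[OF r]
      by (simp add: multi_choose_unit_index del: of_nat_add of_nat_Suc)
    then have "((\<lambda>k. of_nat (?g k i) * (a (?g k) * monomial (?g k) y))
        has_sum y $ i * partial_deriv i f y) UNIV"
      by (simp add: monomial_add_index monomial_unit_index mult_ac)
    then have "((\<lambda>k. of_nat (k i) * (a k * monomial k y)) has_sum y $ i * partial_deriv i f y) (range ?g)"
      by (simp add: has_sum_reindex[OF inj] o_def)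
    then show ?thesis
    proof (rule has_sum_cong_neutral[THEN iffD1, rotated -1])
      fix k assume "k \<in> UNIV - range ?g"
      then have "k \<noteq> ?g (k(i := k i - 1))" by blast
      then have "k i = 0" by (auto simp: fun_eq_iff unit_index_def split: if_splits)
      then show "of_nat (k i) * (a k * monomial k y) = 0" by simp
    qed auto
  qed
  have "((\<lambda>k. \<Sum>i\<in>UNIV. of_nat (s i) * (of_nat (k i) * (a k * monomial k y)))
     has_sum (\<Sum>i\<in>UNIV. of_nat (s i) * (y $ i * partial_deriv i f y))) UNIV"
    by (intro has_sum_finite_sum has_sum_cmult_right Euler_term)
  moreover have "(\<Sum>i\<in>UNIV. of_nat (s i) * (of_nat (k i) * (a k * monomial k y)))
      = of_int d * (a k * monomial k y)" for k
  proof (cases "a k = 0")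
    case False
    have "(\<Sum>i\<in>UNIV. of_nat (s i) * (of_nat (k i) * (a k * monomial k y)))
       = of_int (int (\<Sum>i\<in>UNIV. s i * k i)) * (a k * monomial k y)"
      by (simp add: sum_distrib_left mult_ac)
    then show ?thesis unfolding w[OF False] .
  qed simp
  moreover have "((\<lambda>k. of_int d * (a k * monomial k y)) has_sum of_int d * f y) UNIV"
    by (intro has_sum_cmult_right f U)
  ultimately show ?thesis by (simp add: has_sum_unique mult.assoc)
qed

lemma weighted_polynomial_imp_series_on:
  assumes "weighted_polynomial s d f"
  shows "weighted_series_on s d f U"
proof -
  obtain a where a: "finite {k. a k \<noteq> 0}" "\<And>k. a k \<noteq> 0 \<Longrightarrow> int (\<Sum>i\<in>UNIV. s i * k i) = d"
    "\<And>x. f x = (\<Sum>k | a k \<noteq> 0. a k * monomial k x)"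
    using assms unfolding weighted_polynomial_def by blast
  have "((\<lambda>k. a k * monomial k x) has_sum f x) UNIV" for x
    by (rule has_sum_finite_neutralI[OF a(1)]) (auto simp: a(3))
  then show ?thesis using a(2) unfolding weighted_series_on_def by blast
qed

lemma homogeneous_term_on_weighted_series:
  assumes "homogeneous_term_on \<sigma> s p q r T U" "length I = p" "length J = q"
  shows "weighted_series_on s (component_degree s r I J) (T I J) U"
proof (cases \<sigma>)
  case Positive
  then show ?thesis using assms by (simp add: homogeneous_term_on_def)
next
  case Negative
  then show ?thesis
    using assms by (intro weighted_polynomial_imp_series_on) (simp add: homogeneous_term_on_def)
qed

lemma weighted_series_on_mv_analytic_on:
  "weighted_series_on s d f U \<Longrightarrow> open U \<Longrightarrow> mv_analytic_on f U"
  unfolding weighted_series_on_def using global_series_mv_analytic_on by blast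

text \<open>A weighted series that is not identically zero on \<open>U\<close> has a nonzero Taylor coefficient at every
  point of \<open>U\<close>.\<close>
lemma weighted_series_on_nonzero:
  assumes "weighted_series_on s d f U" "open U" "c \<in> U" "x \<in> U" "f x \<noteq> 0"
  obtains A where "iterated_partial A f c \<noteq> 0"
proof -
  obtain a where a: "\<And>x. x \<in> U \<Longrightarrow> ((\<lambda>k. a k * monomial k x) has_sum f x) UNIV"
    using assms(1) unfolding weighted_series_on_def by blast
  have "\<exists>A. iterated_partial A f c \<noteq> 0"
  proof (rule ccontr)
    assume "\<not> ?thesis"
    then have "a k = 0" for k using global_series_coeffs_zero[OF assms(2,3) a] by blast
    then have "((\<lambda>_ :: 'a \<Rightarrow> nat. 0) has_sum f x) UNIV" using a[OF assms(4)] by simp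
    then have "f x = 0" by (rule has_sum_unique) simp
    with assms(5) show False by simp
  qed
  then show thesis using that by blast
qed

lemma weighted_series_on_euler:
  assumes "weighted_series_on s d f U" "open U" "y \<in> U"
  shows "(\<Sum>i\<in>UNIV. of_nat (s i) * y $ i * partial_deriv i f y) = of_int d * f y"
proof -
  obtain a where "\<And>k. a k \<noteq> 0 \<Longrightarrow> int (\<Sum>i\<in>UNIV. s i * k i) = d"
    "\<And>x. x \<in> U \<Longrightarrow> ((\<lambda>k. a k * monomial k x) has_sum f x) UNIV"
    using assms(1) unfolding weighted_series_on_def by blast
  then show ?thesis by (rule weighted_series_euler[OF assms(2,3)])
qed

section \<open>Common eigenvectors of operators acting on the indices of an array\<close>

lemma sequence_linearly_dependent:
  fixes M :: "nat \<Rightarrow> 'a::euclidean_space"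
  obtains N u where "\<exists>i\<le>N. u i \<noteq> 0" "(\<Sum>i\<le>N. u i *\<^sub>R M i) = 0"
proof (cases "inj_on M {..DIM('a)}")
  case False
  then obtain i j where ij: "i \<noteq> j" "M i = M j" "i \<le> DIM('a)" "j \<le> DIM('a)"
    by (auto simp: inj_on_def)
  define u where "u k = (if k = i then 1 else if k = j then - 1 else (0::real))" for k
  have "(\<Sum>k\<le>DIM('a). u k *\<^sub>R M k) = (\<Sum>k\<in>{i, j}. u k *\<^sub>R M k)"
    by (rule sum.mono_neutral_right) (use ij in \<open>auto simp: u_def\<close>)
  also have "\<dots> = 0" using ij by (simp add: u_def)
  finally have "(\<Sum>k\<le>DIM('a). u k *\<^sub>R M k) = 0" .
  moreover have "\<exists>k\<le>DIM('a). u k \<noteq> 0" using ij by (intro exI[of _ i]) (simp add: u_def)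
  ultimately show thesis using that by blast
next
  case True
  then have "card (M ` {..DIM('a)}) = DIM('a) + 1" by (simp add: card_image)
  then have "dependent (M ` {..DIM('a)})" by (intro dependent_biggerset) auto
  then obtain u where u: "\<exists>v\<in>M ` {..DIM('a)}. u v \<noteq> 0" "(\<Sum>v\<in>M ` {..DIM('a)}. u v *\<^sub>R v) = 0"
    by (auto simp: dependent_finite)
  then show thesis using that[of "DIM('a)" "u \<circ> M"] by (auto simp: sum.reindex[OF True])
qed

text \<open>The powers of \<open>B\<close> are linearly dependent over the reals, which avoids the characteristic
  polynomial.\<close>
lemma matrix_annihilating_poly:
  fixes B :: "complex^'n^'n"
  obtains P :: "complex poly"
  where "P \<noteq> 0" "\<And>v. (\<Sum>i\<le>degree P. coeff P i *s (((*v) B ^^ i) v)) = 0"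
proof -
  define M where "M i = ((**) B ^^ i) (mat 1)" for i
  have M: "M i *v v = ((*v) B ^^ i) v" for i v
    by (induction i) (auto simp: M_def simp flip: matrix_vector_mul_assoc)
  obtain N u where u: "\<exists>i\<le>N. u i \<noteq> 0" "(\<Sum>i\<le>N. u i *\<^sub>R M i) = 0"
    by (rule sequence_linearly_dependent)
  define P where "P = (\<Sum>i\<le>N. monom (complex_of_real (u i)) i)"
  have coeff: "coeff P i = (if i \<le> N then of_real (u i) else 0)" for i
    by (simp add: P_def coeff_sum)
  have deg: "degree P \<le> N" by (rule degree_le) (simp add: coeff)
  have "P \<noteq> 0" using u(1) coeff by (metis coeff_0 of_real_eq_0_iff)
  moreover have "(\<Sum>i\<le>degree P. coeff P i *s (((*v) B ^^ i) v)) = 0" for v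
  proof -
    have "(\<Sum>i\<le>degree P. coeff P i *s (((*v) B ^^ i) v)) = (\<Sum>i\<le>N. coeff P i *s (((*v) B ^^ i) v))"
      by (rule sum.mono_neutral_left) (use deg in \<open>auto simp: coeff_eq_0\<close>)
    also have "\<dots> = (\<Sum>i\<le>N. u i *\<^sub>R (M i *v v))"
      by (intro sum.cong refl) (simp add: M coeff vec_eq_iff scaleR_conv_of_real[where 'a = complex])
    also have "\<dots> = (\<Sum>i\<le>N. u i *\<^sub>R M i) *v v"
      by (simp add: vec_eq_iff matrix_vector_mult_def sum_distrib_right scaleR_right_distrib
          sum_component sum.swap[of _ UNIV] scaleR_sum_right)
    also have "\<dots> = 0" by (simp add: u(2))
    finally show ?thesis .
  qed
  ultimately show thesis by (rule that)
qed

text \<open>Linear operators on the space of complex functions on a type.\<close>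
definition linear_operator :: "(('x \<Rightarrow> complex) \<Rightarrow> 'x \<Rightarrow> complex) \<Rightarrow> bool" where
  "linear_operator Op \<longleftrightarrow>
     (\<forall>f g. Op (\<lambda>x. f x + g x) = (\<lambda>x. Op f x + Op g x)) \<and>
     (\<forall>c f. Op (\<lambda>x. c * f x) = (\<lambda>x. c * Op f x))"

lemma linear_operator_add: "linear_operator Op \<Longrightarrow> Op (\<lambda>x. f x + g x) = (\<lambda>x. Op f x + Op g x)"
  and linear_operator_cmult: "linear_operator Op \<Longrightarrow> Op (\<lambda>x. c * f x) = (\<lambda>x. c * Op f x)"
  by (simp_all add: linear_operator_def)

lemma linear_operator_zero: "linear_operator Op \<Longrightarrow> Op (\<lambda>x. 0) = (\<lambda>x. 0)"
  using linear_operator_cmult[of Op 0 "\<lambda>x. 0"] by simp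

lemma linear_operator_sum:
  assumes "linear_operator Op" "finite I"
  shows "Op (\<lambda>x. \<Sum>i\<in>I. f i x) = (\<lambda>x. \<Sum>i\<in>I. Op (f i) x)"
  using assms(2)
  by (induction I rule: finite_induct) (auto simp: linear_operator_zero[OF assms(1)] linear_operator_add[OF assms(1)])

text \<open>The function \<open>P(Op) f\<close>.\<close>
definition poly_operator ::
    "(('x \<Rightarrow> complex) \<Rightarrow> 'x \<Rightarrow> complex) \<Rightarrow> complex poly \<Rightarrow> ('x \<Rightarrow> complex) \<Rightarrow> 'x \<Rightarrow> complex" where
  "poly_operator Op P f = (\<lambda>x. \<Sum>i\<le>degree P. coeff P i * (Op ^^ i) f x)"

lemma poly_operator_bound:
  "degree P \<le> N \<Longrightarrow> poly_operator Op P f = (\<lambda>x. \<Sum>i\<le>N. coeff P i * (Op ^^ i) f x)"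
  unfolding poly_operator_def
  by (rule ext, rule sum.mono_neutral_left) (auto simp: coeff_eq_0)

lemma poly_operator_add:
  "poly_operator Op (P + Q) f = (\<lambda>x. poly_operator Op P f x + poly_operator Op Q f x)"
proof -
  let ?N = "max (degree P) (degree Q)"
  have "degree (P + Q) \<le> ?N" by (rule degree_add_le_max)
  then show ?thesis
    by (simp add: poly_operator_bound[of _ ?N] distrib_right sum.distrib)
qed

lemma poly_operator_smult: "poly_operator Op (smult c P) f = (\<lambda>x. c * poly_operator Op P f x)"
  by (subst poly_operator_bound[of _ "degree P"])
    (auto simp: degree_smult_le poly_operator_def sum_distrib_left mult.assoc)

lemma poly_operator_pCons_0:
  assumes "linear_operator Op"
  shows "poly_operator Op (pCons 0 P) f = Op (poly_operator Op P f)"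
proof -
  have "poly_operator Op (pCons 0 P) f = (\<lambda>x. \<Sum>i\<le>Suc (degree P). coeff (pCons 0 P) i * (Op ^^ i) f x)"
    by (rule poly_operator_bound) (simp add: degree_pCons_le)
  also have "\<dots> = (\<lambda>x. \<Sum>i\<le>degree P. coeff P i * Op ((Op ^^ i) f) x)"
    by (simp add: sum.atMost_Suc_shift del: sum.atMost_Suc)
  also have "\<dots> = Op (poly_operator Op P f)"
    unfolding poly_operator_def
    by (simp add: linear_operator_sum[OF assms] linear_operator_cmult[OF assms])
  finally show ?thesis .
qed

text \<open>An operator that is annihilated at \<open>f\<close> by some nonzero polynomial has an eigenvector of the form
  \<open>Q(Op) f\<close>, because complex polynomials split.\<close>
lemma poly_operator_eigenvector:
  assumes lin: "linear_operator Op" and f: "f \<noteq> (\<lambda>x. 0)"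
    and "P \<noteq> 0" "poly_operator Op P f = (\<lambda>x. 0)"
  obtains Q z where "poly_operator Op Q f \<noteq> (\<lambda>x. 0)"
    "Op (poly_operator Op Q f) = (\<lambda>x. z * poly_operator Op Q f x)"
  using assms(3,4)
proof (induction "degree P" arbitrary: P thesis)
  case 0
  then obtain c where P: "P = [:c:]" by (metis degree_eq_zeroE)
  then have "c \<noteq> 0" using 0 by auto
  then show ?case using 0 f by (auto simp: P poly_operator_def fun_eq_iff)
next
  case (Suc n)
  then have "\<not> constant (poly P)" by (simp add: constant_degree)
  then obtain z where "poly P z = 0" using fundamental_theorem_of_algebra by blast
  then obtain Q where PQ: "P = [:- z, 1:] * Q" by (auto simp: poly_eq_0_iff_dvd dvd_def)
  have Q: "Q \<noteq> 0" using PQ Suc(4) by auto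
  have deg: "n = degree Q" using Suc(2) Q unfolding PQ by (subst (asm) degree_mult_eq) auto
  have PQ': "P = smult (- z) Q + pCons 0 Q" by (simp add: PQ)
  show ?case
  proof (cases "poly_operator Op Q f = (\<lambda>x. 0)")
    case True
    show ?thesis by (rule Suc(1)[OF deg Suc(3) Q True])
  next
    case False
    have "(\<lambda>x. - z * poly_operator Op Q f x + Op (poly_operator Op Q f) x) = (\<lambda>x. 0)"
      using Suc(5) unfolding PQ'
      by (simp only: poly_operator_add poly_operator_smult poly_operator_pCons_0[OF lin])
    then have "Op (poly_operator Op Q f) = (\<lambda>x. z * poly_operator Op Q f x)"
      by (simp add: fun_eq_iff)
    then show ?thesis using Suc(3) False by blast
  qed
qed

lemma poly_operator_commuting_eigenvector:
  assumes lin: "linear_operator Op" "linear_operator Op'"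
    and comm: "\<And>f. Op' (Op f) = Op (Op' f)" and f: "Op' f = (\<lambda>x. c * f x)"
  shows "Op' (poly_operator Op Q f) = (\<lambda>x. c * poly_operator Op Q f x)"
proof -
  have "Op' ((Op ^^ i) f) = (\<lambda>x. c * (Op ^^ i) f x)" for i
    by (induction i) (simp_all add: f comm linear_operator_cmult[OF lin(1)])
  then show ?thesis
    unfolding poly_operator_def
    by (simp add: linear_operator_sum[OF lin(2)] linear_operator_cmult[OF lin(2)] sum_distrib_left mult_ac)
qed

text \<open>Commuting operators have a common eigenvector inside any eigenspace of their sum.\<close>
lemma common_eigenvector:
  fixes Op :: "nat \<Rightarrow> ('x \<Rightarrow> complex) \<Rightarrow> 'x \<Rightarrow> complex"
  assumes lin: "\<And>b. linear_operator (Op b)"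
    and comm: "\<And>b b' f. Op b (Op b' f) = Op b' (Op b f)"
    and ann: "\<And>b f. \<exists>P. P \<noteq> 0 \<and> poly_operator (Op b) P f = (\<lambda>x. 0)"
    and f: "f \<noteq> (\<lambda>x. 0)" "(\<lambda>x. \<Sum>b<N. Op b f x) = (\<lambda>x. \<mu> * f x)"
  obtains h \<nu> where "h \<noteq> (\<lambda>x. 0)" "\<And>b. b < N \<Longrightarrow> Op b h = (\<lambda>x. \<nu> b * h x)" "\<mu> = (\<Sum>b<N. \<nu> b)"
proof -
  define S where "S f = (\<lambda>x. \<Sum>b<N. Op b f x)" for f
  have S: "linear_operator S"
    unfolding linear_operator_def S_def
    by (simp add: linear_operator_add[OF lin] linear_operator_cmult[OF lin] sum.distrib sum_distrib_left)
  have S_comm: "S (Op b f) = Op b (S f)" for b f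
    unfolding S_def by (simp add: comm[of _ b] linear_operator_sum[OF lin])
  have "\<exists>h \<nu>. h \<noteq> (\<lambda>x. 0) \<and> S h = (\<lambda>x. \<mu> * h x) \<and> (\<forall>b<M. Op b h = (\<lambda>x. \<nu> b * h x))" for M :: nat
  proof (induction M)
    case 0
    then show ?case using f by (auto simp: S_def)
  next
    case (Suc M)
    then obtain h \<nu> where h: "h \<noteq> (\<lambda>x. 0)" "S h = (\<lambda>x. \<mu> * h x)"
      "\<And>b. b < M \<Longrightarrow> Op b h = (\<lambda>x. \<nu> b * h x)" by blast
    obtain P where "P \<noteq> 0" "poly_operator (Op M) P h = (\<lambda>x. 0)" using ann by blast
    then obtain Q z where Q: "poly_operator (Op M) Q h \<noteq> (\<lambda>x. 0)"
      "Op M (poly_operator (Op M) Q h) = (\<lambda>x. z * poly_operator (Op M) Q h x)"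
      using poly_operator_eigenvector[where Op = "Op M" and f = h and P = P, OF lin h(1)] by blast
    let ?h = "poly_operator (Op M) Q h"
    have "S ?h = (\<lambda>x. \<mu> * ?h x)"
      by (rule poly_operator_commuting_eigenvector[where Op = "Op M" and Op' = S, OF lin S S_comm h(2)])
    moreover have "Op b ?h = (\<lambda>x. (\<nu>(M := z)) b * ?h x)" if "b < Suc M" for b
    proof (cases "b = M")
      case False
      then have "Op b h = (\<lambda>x. \<nu> b * h x)" using that h(3) by simp
      from poly_operator_commuting_eigenvector[where Op = "Op M" and Op' = "Op b" and Q = Q, OF lin lin comm this]
      show ?thesis using False by simp
    qed (use Q(2) in simp)
    ultimately show ?case using Q(1) by blast
  qed
  from this[of N] obtain h \<nu> where h: "h \<noteq> (\<lambda>x. 0)" "S h = (\<lambda>x. \<mu> * h x)"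
      "\<And>b. b < N \<Longrightarrow> Op b h = (\<lambda>x. \<nu> b * h x)" by blast
  obtain x where x: "h x \<noteq> 0" using h(1) by auto
  have "\<mu> * h x = (\<Sum>b<N. \<nu> b * h x)"
    using fun_cong[OF h(2), of x] h(3) by (simp add: S_def)
  then have "\<mu> = (\<Sum>b<N. \<nu> b)" using x by (simp flip: sum_distrib_right)
  with h that show thesis by blast
qed

text \<open>The action of the matrix \<open>B b\<close> on the index number \<open>b\<close> of an array. The entries of an array are numbered
  by functions that assign a value to every index number; an array with \<open>N\<close> indices depends only on
  the first \<open>N\<close> values.\<close>
definition index_operator ::
    "(nat \<Rightarrow> complex^'n^'n) \<Rightarrow> nat \<Rightarrow> ((nat \<Rightarrow> 'n::finite) \<Rightarrow> complex) \<Rightarrow> (nat \<Rightarrow> 'n) \<Rightarrow> complex" where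
  "index_operator B b f \<phi> = (\<Sum>k\<in>UNIV. B b $ (\<phi> b) $ k * f (\<phi>(b := k)))"

lemma linear_index_operator: "linear_operator (index_operator B b)"
  unfolding linear_operator_def index_operator_def
  by (simp add: distrib_left sum.distrib sum_distrib_left mult_ac)

lemma index_operator_commute:
  "index_operator B b (index_operator B b' f) = index_operator B b' (index_operator B b f)"
proof (cases "b = b'")
  case False
  show ?thesis
  proof
    fix \<phi>
    have "index_operator B b (index_operator B b' f) \<phi>
        = (\<Sum>k\<in>UNIV. \<Sum>k'\<in>UNIV. B b $ (\<phi> b) $ k * (B b' $ (\<phi> b') $ k' * f (\<phi>(b := k, b' := k'))))"
      using False by (simp add: index_operator_def sum_distrib_left)
    also have "\<dots> = (\<Sum>k'\<in>UNIV. \<Sum>k\<in>UNIV. B b' $ (\<phi> b') $ k' * (B b $ (\<phi> b) $ k * f (\<phi>(b' := k', b := k))))"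
      by (subst sum.swap) (simp add: fun_upd_twist[OF False] mult_ac)
    also have "\<dots> = index_operator B b' (index_operator B b f) \<phi>"
      using False by (simp add: index_operator_def sum_distrib_left)
    finally show "index_operator B b (index_operator B b' f) \<phi> = index_operator B b' (index_operator B b f) \<phi>" .
  qed
qed simp

text \<open>When all indices but one are fixed, the array becomes a vector on which the matrix acts.\<close>
lemma index_operator_fiber:
  "(\<chi> i. index_operator B b f (\<phi>(b := i))) = B b *v (\<chi> k. f (\<phi>(b := k)))"
  by (simp add: vec_eq_iff index_operator_def matrix_vector_mult_def)

lemma index_operator_power_fiber:
  "(\<chi> i. (index_operator B b ^^ n) f (\<phi>(b := i))) = ((*v) (B b) ^^ n) (\<chi> k. f (\<phi>(b := k)))"
  by (induction n) (simp_all only: funpow.simps o_apply id_apply index_operator_fiber)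

lemma index_operator_annihilating_poly:
  "\<exists>P. P \<noteq> 0 \<and> poly_operator (index_operator B b) P f = (\<lambda>x. 0)"
proof -
  obtain P where P: "P \<noteq> 0" "\<And>v. (\<Sum>i\<le>degree P. coeff P i *s (((*v) (B b) ^^ i) v)) = 0"
    using matrix_annihilating_poly[of "B b"] by blast
  have "poly_operator (index_operator B b) P f \<phi> = 0" for \<phi>
  proof -
    have "(\<Sum>n\<le>degree P. coeff P n *s (\<chi> i. (index_operator B b ^^ n) f (\<phi>(b := i)))) $ \<phi> b = 0"
      unfolding index_operator_power_fiber P(2) by simp
    then show ?thesis by (simp add: poly_operator_def sum_component)
  qed
  then show ?thesis using P(1) by blast
qed

lemma mat_scalar_mult_vec: "mat z *v v = z *s (v :: complex^'n::finite)"
proof -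
  have "(\<Sum>j\<in>UNIV. mat z $ i $ j * v $ j) = (\<Sum>j\<in>UNIV. if i = j then z * v $ j else 0)" for i
    by (intro sum.cong) (auto simp: mat_def)
  then show ?thesis by (simp add: vec_eq_iff matrix_vector_mult_def)
qed

text \<open>The eigenvalues of the sum of the actions on the \<open>N\<close> indices are sums of eigenvalues of the
  individual matrices.\<close>
lemma index_operator_sum_eigenvalue:
  fixes B :: "nat \<Rightarrow> complex^'n::finite^'n"
  assumes "f \<noteq> (\<lambda>\<phi>. 0)" "\<And>\<phi>. (\<Sum>b<N. index_operator B b f \<phi>) = \<mu> * f \<phi>"
  obtains \<nu> where "\<And>b. b < N \<Longrightarrow> det (mat (\<nu> b) - B b) = 0" "\<mu> = (\<Sum>b<N. \<nu> b)"
proof -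
  obtain h \<nu> where h: "h \<noteq> (\<lambda>x. 0)" "\<And>b. b < N \<Longrightarrow> index_operator B b h = (\<lambda>x. \<nu> b * h x)"
    and \<nu>: "\<mu> = (\<Sum>b<N. \<nu> b)"
    using common_eigenvector[of "index_operator B" f N \<mu>, OF linear_index_operator index_operator_commute
        index_operator_annihilating_poly assms(1)] assms(2) by blast
  obtain \<phi> where \<phi>: "h \<phi> \<noteq> 0" using h(1) by auto
  have "det (mat (\<nu> b) - B b) = 0" if "b < N" for b
  proof -
    define v where "v = (\<chi> k. h (\<phi>(b := k)))"
    have "v $ \<phi> b \<noteq> 0" using \<phi> by (simp add: v_def)
    then have "v \<noteq> 0" by auto
    have "B b *v v = \<nu> b *s v"
      using index_operator_fiber[of B b h \<phi>] unfolding h(2)[OF that] v_def by (simp add: vec_eq_iff)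
    then have "(mat (\<nu> b) - B b) *v v = 0"
      by (simp add: matrix_vector_mult_diff_rdistrib mat_scalar_mult_vec)
    then have "\<not> invertible (mat (\<nu> b) - B b)"
      using \<open>v \<noteq> 0\<close> by (metis invertible_left_inverse matrix_left_invertible_ker)
    then show ?thesis by (simp add: invertible_det_nz)
  qed
  then show thesis using that \<nu> by blast
qed

section \<open>Series of quasi-homogeneous functions\<close>

text \<open>A pointwise bounded family of continuous functions is uniformly bounded on some ball.\<close>
lemma baire_locally_bounded:
  fixes F :: "(complex^'n::finite \<Rightarrow> complex) set"
  assumes U: "open U" "x0 \<in> U" and cont: "\<And>f. f \<in> F \<Longrightarrow> continuous_on U f"
    and bdd: "\<And>x. x \<in> U \<Longrightarrow> bounded ((\<lambda>f. f x) ` F)"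
  obtains a r N where "r > 0" "ball a r \<subseteq> U" "\<And>f x. f \<in> F \<Longrightarrow> x \<in> ball a r \<Longrightarrow> norm (f x) \<le> N"
proof -
  obtain e where e: "e > 0" "cball x0 e \<subseteq> U" using U open_contains_cball by blast
  let ?S = "cball x0 e"
  define C where "C N = {x \<in> ?S. \<forall>f\<in>F. norm (f x) \<le> real N}" for N :: nat
  have cov: "\<exists>N. x \<in> C N" if "x \<in> ?S" for x
  proof -
    have "x \<in> U" using e that by blast
    then obtain B where B: "\<And>f. f \<in> F \<Longrightarrow> norm (f x) \<le> B"
      using bdd[of x] unfolding bounded_iff by blast
    obtain N :: nat where "B \<le> real N" using real_arch_simple by blast
    then have "x \<in> C N" using that B by (force simp: C_def)
    then show ?thesis by blast
  qed
  have clo: "closedin (top_of_set ?S) (C N)" for N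
  proof -
    have "closedin (top_of_set ?S) {x \<in> ?S. norm (f x) \<le> real N}" if "f \<in> F" for f
    proof -
      have "continuous_on ?S (\<lambda>x. norm (f x))"
        using e by (intro continuous_on_norm continuous_on_subset[OF cont[OF that]])
      then have "closedin (top_of_set ?S) (?S \<inter> (\<lambda>x. norm (f x)) -` {..real N})"
        by (rule continuous_closedin_preimage) simp
      moreover have "?S \<inter> (\<lambda>x. norm (f x)) -` {..real N} = {x \<in> ?S. norm (f x) \<le> real N}" by auto
      ultimately show ?thesis by simp
    qed
    moreover have "C N = ?S \<inter> (\<Inter>f\<in>F. {x \<in> ?S. norm (f x) \<le> real N})" by (auto simp: C_def)
    ultimately show ?thesis
      by (cases "F = {}") (auto intro!: closedin_Int closedin_Inter)
  qed
  have "\<exists>N. \<not> ?S \<subseteq> closure (?S - C N)"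
  proof (rule ccontr)
    assume "\<not> ?thesis"
    then have "?S \<subseteq> closure (\<Inter>(range (\<lambda>N. ?S - C N)))"
      using clo by (intro Baire) (auto simp: openin_diff)
    moreover have "\<Inter>(range (\<lambda>N. ?S - C N)) = {}" using cov by auto
    ultimately have "?S \<subseteq> {}" by (simp only: closure_empty)
    then show False using e by simp
  qed
  then obtain N y where y: "y \<in> ?S" "y \<notin> closure (?S - C N)" by blast
  then obtain d where d: "d > 0" "\<And>z. z \<in> ?S - C N \<Longrightarrow> dist z y \<ge> d"
    unfolding closure_approachable by (auto simp: not_less)
  have "y \<in> closure (ball x0 e)" using y(1) e(1) by simp
  then obtain a where a: "a \<in> ball x0 e" "dist a y < d"
    unfolding closure_approachable using d(1) by blast
  have "open (ball x0 e \<inter> ball y d)" "a \<in> ball x0 e \<inter> ball y d"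
    using a by (auto simp: dist_commute)
  then obtain r where r: "r > 0" "ball a r \<subseteq> ball x0 e \<inter> ball y d" using openE by blast
  have "ball a r \<subseteq> C N"
  proof
    fix z assume "z \<in> ball a r"
    then have z: "z \<in> ball x0 e" "dist z y < d" using r by (auto simp: dist_commute)
    then show "z \<in> C N" using d(2)[of z] by force
  qed
  then have "\<And>f x. f \<in> F \<Longrightarrow> x \<in> ball a r \<Longrightarrow> norm (f x) \<le> real N" unfolding C_def by blast
  moreover have "ball a r \<subseteq> U" using r e by (meson Int_subset_iff ball_subset_cball order_trans)
  ultimately show thesis using that r(1) by blast
qed

text \<open>The partial derivative is also the derivative along the coordinate line through \<open>a\<close> at points
  other than \<open>a\<close> itself.\<close>
lemma has_partial_deriv_at:
  assumes "mv_analytic_on f U" "a + axis i z \<in> U"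
  shows "((\<lambda>z. f (a + axis i z)) has_field_derivative partial_deriv i f (a + axis i z)) (at z)"
proof -
  have "((\<lambda>h. h - z) has_field_derivative 1) (at z)" by (auto intro!: derivative_eq_intros)
  moreover have "((\<lambda>h. f (a + axis i z + axis i h)) has_field_derivative partial_deriv i f (a + axis i z))
      (at (z - z))"
    using has_partial_deriv[OF assms, of i] by simp
  ultimately have "((\<lambda>h. f (a + axis i z + axis i (h - z))) has_field_derivative
      partial_deriv i f (a + axis i z) * 1) (at z)"
    by (rule DERIV_chain')
  moreover have "a + axis i z + axis i (h - z) = a + axis i h" for h
    by (simp add: vec_eq_iff axis_def)
  ultimately show ?thesis by (simp only: mult_1_right)
qed

text \<open>Cauchy's estimate. The radius is halved so that the closed disc stays inside the ball.\<close>
lemma partial_deriv_bound: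
  assumes f: "mv_analytic_on f U" and b: "r > 0" "ball a r \<subseteq> U" "\<And>x. x \<in> ball a r \<Longrightarrow> norm (f x) \<le> N"
  shows "norm (partial_deriv i f a) \<le> N / (r / 2)"
proof -
  have in_ball: "a + axis i z \<in> ball a r" if "norm z < r" for z
    using that by (simp add: dist_norm norm_axis_complex)
  have hol: "(\<lambda>z. f (a + axis i z)) holomorphic_on ball 0 r"
    unfolding holomorphic_on_open[OF open_ball]
  proof
    fix z :: complex assume "z \<in> ball 0 r"
    then have "a + axis i z \<in> U" using in_ball[of z] b(2) by auto
    from has_partial_deriv_at[OF f this]
    show "\<exists>f'. ((\<lambda>z. f (a + axis i z)) has_field_derivative f') (at z)" ..
  qed
  have "norm ((deriv ^^ 1) (\<lambda>z. f (a + axis i z)) 0) \<le> fact 1 * N / (r / 2) ^ 1"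
  proof (rule Cauchy_inequality)
    show "(\<lambda>z. f (a + axis i z)) holomorphic_on ball 0 (r / 2)"
      by (rule holomorphic_on_subset[OF hol]) (use b(1) in auto)
    show "continuous_on (cball 0 (r / 2)) (\<lambda>z. f (a + axis i z))"
      by (rule holomorphic_on_imp_continuous_on[OF holomorphic_on_subset[OF hol]]) (use b(1) in auto)
    show "norm (f (a + axis i z)) \<le> N" if "norm (0 - z) = r / 2" for z
      using that b(1) by (intro b(3) in_ball) simp
  qed (use b(1) in simp)
  then show ?thesis by (simp add: partial_deriv_def)
qed

lemma dilation_add_axis:
  "dilation s \<rho> (a + axis i z) = dilation s \<rho> a + axis i (of_real (\<rho> ^ s i) * z)"
  by (simp add: dilation_def vec_eq_iff axis_def distrib_left)

text \<open>A series of quasi-homogeneous functions is, along a dilation, a power series in a power of the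
  dilation factor; so are its derivatives, if the terms are bounded near the given point.\<close>
lemma quasi_homogeneous_series:
  fixes f :: "nat \<Rightarrow> complex^'n::finite \<Rightarrow> complex"
  assumes an: "\<And>k. mv_analytic_on (f k) U" and F: "mv_analytic_on F U"
    and qh: "\<And>k x. f k (dilation s \<rho> x) = of_real (\<rho> powi (w + d * int k)) * f k x"
    and sm: "\<And>x. x \<in> U \<Longrightarrow> (\<lambda>k. f k x) sums F x" and U: "open U"
    and bd: "r > 0" "ball a r \<subseteq> U" "\<And>k x. x \<in> ball a r \<Longrightarrow> norm (f k x) \<le> N"
    and \<rho>: "\<rho> > 0" "\<rho> powi d < 1" and a': "dilation s \<rho> a \<in> U"
  shows "F (dilation s \<rho> a) = of_real (\<rho> powi w) * (\<Sum>k. f k a * of_real (\<rho> powi d) ^ k)"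
    and "partial_deriv i F (dilation s \<rho> a)
       = of_real (\<rho> powi (w - int (s i))) * (\<Sum>k. partial_deriv i (f k) a * of_real (\<rho> powi d) ^ k)"
proof -
  define \<epsilon> where "\<epsilon> = \<rho> powi d"
  have \<epsilon>: "0 < \<epsilon>" "\<epsilon> < 1" using \<rho> by (auto simp: \<epsilon>_def)
  have pw: "complex_of_real (\<rho> powi (w + d * int k)) = of_real (\<rho> powi w) * of_real \<epsilon> ^ k" for k
    using \<rho>(1) by (simp add: \<epsilon>_def power_int_add power_int_mult)
  have nz: "complex_of_real (\<rho> powi w) \<noteq> 0" using \<rho>(1) by simp
  have ser: "(\<lambda>k. f k x * of_real \<epsilon> ^ k) sums (F (dilation s \<rho> x) / of_real (\<rho> powi w))"
    if "dilation s \<rho> x \<in> U" for x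
    using sums_divide[OF sm[OF that], of "of_real (\<rho> powi w)"] nz \<rho>(1) unfolding qh pw by (simp add: mult_ac)
  show "F (dilation s \<rho> a) = of_real (\<rho> powi w) * (\<Sum>k. f k a * of_real (\<rho> powi d) ^ k)"
    using sums_unique[OF ser[OF a']] \<rho>(1) unfolding \<epsilon>_def[symmetric] by (simp add: field_simps)
  have "N \<ge> 0" using bd(3)[of a 0] bd(1) norm_ge_zero order_trans by (metis centre_in_ball)
  have in_ball: "a + axis i z \<in> ball a r" if "z \<in> ball 0 r" for z
    using that by (simp add: dist_norm norm_axis_complex)
  have der: "((\<lambda>z. f k (a + axis i z) * of_real \<epsilon> ^ k) has_field_derivative
      partial_deriv i (f k) (a + axis i z) * of_real \<epsilon> ^ k) (at z)" if "z \<in> ball 0 r" for k z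
    using in_ball[OF that] bd(2) by (intro DERIV_cmult_right has_partial_deriv_at[OF an]) auto
  have "\<exists>g g'. \<forall>z\<in>ball 0 r. (\<lambda>k. f k (a + axis i z) * of_real \<epsilon> ^ k) sums g z \<and>
     (\<lambda>k. partial_deriv i (f k) (a + axis i z) * of_real \<epsilon> ^ k) sums g' z \<and> (g has_field_derivative g' z) (at z)"
  proof (rule series_and_derivative_comparison_complex[OF open_ball der])
    fix z :: complex assume "z \<in> ball 0 r"
    show "\<exists>d (h :: nat \<Rightarrow> complex). 0 < d \<and> summable h \<and> range h \<subseteq> \<real>\<^sub>\<ge>\<^sub>0 \<and> (\<forall>\<^sub>F n in sequentially.
       \<forall>y\<in>ball z d \<inter> ball 0 r. norm (f n (a + axis i y) * of_real \<epsilon> ^ n) \<le> norm (h n))"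
    proof (intro exI[of _ 1] exI[of _ "\<lambda>k. of_real (N * \<epsilon> ^ k) :: complex"] conjI always_eventually allI ballI)
      have "summable (\<lambda>k. N * \<epsilon> ^ k)" using \<epsilon> by (intro summable_mult summable_geometric) simp
      then show "summable (\<lambda>k. of_real (N * \<epsilon> ^ k) :: complex)" by (rule summable_of_real)
      show "range (\<lambda>k. of_real (N * \<epsilon> ^ k) :: complex) \<subseteq> \<real>\<^sub>\<ge>\<^sub>0"
        using \<open>N \<ge> 0\<close> \<epsilon> by (auto simp del: of_real_mult of_real_power)
    next
      fix n and y :: complex assume "y \<in> ball z 1 \<inter> ball 0 r"
      then have "norm (f n (a + axis i y)) \<le> N" by (intro bd(3) in_ball) simp
      then show "norm (f n (a + axis i y) * of_real \<epsilon> ^ n) \<le> norm (of_real (N * \<epsilon> ^ n) :: complex)"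
        using \<epsilon> \<open>N \<ge> 0\<close> unfolding norm_mult norm_power norm_of_real
        by (simp add: abs_mult power_abs mult_right_mono)
    qed simp
  qed
  then obtain g g' where g: "\<And>z. z \<in> ball 0 r \<Longrightarrow> (\<lambda>k. f k (a + axis i z) * of_real \<epsilon> ^ k) sums g z"
    and g': "\<And>z. z \<in> ball 0 r \<Longrightarrow> (\<lambda>k. partial_deriv i (f k) (a + axis i z) * of_real \<epsilon> ^ k) sums g' z"
    and gg': "\<And>z. z \<in> ball 0 r \<Longrightarrow> (g has_field_derivative g' z) (at z)" by blast
  obtain e where e: "e > 0" "ball (dilation s \<rho> a) e \<subseteq> U" using U a' openE by blast
  define e' where "e' = min r (e / \<rho> ^ s i)"
  have e': "e' > 0" using bd(1) e(1) \<rho>(1) by (simp add: e'_def)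
  have geq: "g z = F (dilation s \<rho> a + axis i (of_real (\<rho> ^ s i) * z)) / of_real (\<rho> powi w)"
    if z: "z \<in> ball 0 e'" for z
  proof -
    have "norm (complex_of_real (\<rho> ^ s i) * z) < e"
      using z \<rho>(1) by (simp add: e'_def norm_mult field_simps norm_power)
    then have "dilation s \<rho> (a + axis i z) \<in> U"
      using e(2) unfolding dilation_add_axis by (auto simp: subset_iff dist_norm norm_axis_complex)
    then have "(\<lambda>k. f k (a + axis i z) * of_real \<epsilon> ^ k) sums
        (F (dilation s \<rho> (a + axis i z)) / of_real (\<rho> powi w))" by (rule ser)
    moreover have "(\<lambda>k. f k (a + axis i z) * of_real \<epsilon> ^ k) sums g z"
      using z by (intro g) (simp add: e'_def)
    ultimately show ?thesis unfolding dilation_add_axis using sums_unique2 by blast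
  qed
  have "((\<lambda>h. F (dilation s \<rho> a + axis i h)) has_field_derivative partial_deriv i F (dilation s \<rho> a))
      (at (of_real (\<rho> ^ s i) * 0))"
    using has_partial_deriv[OF F a'] by simp
  then have "((\<lambda>z. F (dilation s \<rho> a + axis i (of_real (\<rho> ^ s i) * z)) / of_real (\<rho> powi w))
      has_field_derivative (partial_deriv i F (dilation s \<rho> a) * of_real (\<rho> ^ s i)) / of_real (\<rho> powi w)) (at 0)"
    by (intro DERIV_cdivide DERIV_chain'[where f = "\<lambda>z. of_real (\<rho> ^ s i) * z"])
      (auto intro!: derivative_eq_intros)
  then have "(g has_field_derivative (partial_deriv i F (dilation s \<rho> a) * of_real (\<rho> ^ s i)) / of_real (\<rho> powi w)) (at 0)"
    by (rule has_field_derivative_transform_within_open[of _ _ _ "ball 0 e'"]) (use e' geq in auto)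
  moreover have "(g has_field_derivative g' 0) (at 0)" using bd(1) by (intro gg') simp
  ultimately have "g' 0 = (partial_deriv i F (dilation s \<rho> a) * of_real (\<rho> ^ s i)) / of_real (\<rho> powi w)"
    by (rule DERIV_unique[rotated])
  moreover have "g' 0 = (\<Sum>k. partial_deriv i (f k) a * of_real \<epsilon> ^ k)"
    using sums_unique[OF g'[of 0]] bd(1) by (simp add: axis_0)
  moreover have "complex_of_real (\<rho> powi (w - int (s i))) = of_real (\<rho> powi w) / of_real (\<rho> ^ s i)"
    using \<rho>(1) by (simp add: power_int_diff)
  moreover have "D = C * S" if "G = D * q / R" "G = S" "C = R / q" "q \<noteq> 0" "R \<noteq> 0"
    for G D q R S C :: complex
    using that by (auto simp: field_simps)
  ultimately show "partial_deriv i F (dilation s \<rho> a)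
       = of_real (\<rho> powi (w - int (s i))) * (\<Sum>k. partial_deriv i (f k) a * of_real (\<rho> powi d) ^ k)"
    using \<rho>(1) nz unfolding \<epsilon>_def[symmetric] by (metis of_real_eq_0_iff power_not_zero less_irrefl)
qed

lemma bounded_power_series_holomorphic:
  fixes c :: "nat \<Rightarrow> complex"
  assumes "\<And>k. norm (c k) \<le> N"
  shows "(\<lambda>z. \<Sum>k. c k * z ^ k) holomorphic_on ball 0 1"
proof (rule power_series_holomorphic)
  fix z :: complex assume "z \<in> ball 0 1"
  then have "summable (\<lambda>k. N * norm z ^ k)" by (intro summable_mult summable_geometric) simp
  then have "summable (\<lambda>k. c k * z ^ k)"
    by (rule summable_comparison_test') (auto simp: norm_mult norm_power assms mult_right_mono)
  then show "(\<lambda>k. c k * (z - 0) ^ k) sums (\<Sum>k. c k * z ^ k)" by (simp add: summable_sums)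
qed

lemma holomorphic_zero_on_segment:
  assumes hol: "\<Psi> holomorphic_on ball 0 1" and \<eta>: "\<eta> > 0"
    and z: "\<And>\<epsilon>. 1 - \<eta> < \<epsilon> \<Longrightarrow> 0 < \<epsilon> \<Longrightarrow> \<epsilon> < 1 \<Longrightarrow> \<Psi> (complex_of_real \<epsilon>) = 0"
  shows "\<Psi> 0 = 0"
proof -
  define \<epsilon>0 where "\<epsilon>0 = max (1 - \<eta> / 2) (1 / 2)"
  define S where "S = complex_of_real ` {\<epsilon>0 <..< 1}"
  have \<epsilon>0: "1 - \<eta> < \<epsilon>0" "0 < \<epsilon>0" "\<epsilon>0 < 1" using \<eta> by (auto simp: \<epsilon>0_def)
  have "complex_of_real \<epsilon>0 islimpt S"
    unfolding islimpt_approachable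
  proof (intro allI impI)
    fix e :: real assume "e > 0"
    define t where "t = min (\<epsilon>0 + e / 2) ((\<epsilon>0 + 1) / 2)"
    have "\<epsilon>0 < t" "t < 1" "t < \<epsilon>0 + e" using \<epsilon>0 \<open>e > 0\<close> by (auto simp: t_def min_def)
    then have "complex_of_real t \<in> S" "complex_of_real t \<noteq> of_real \<epsilon>0"
      "dist (complex_of_real t) (of_real \<epsilon>0) < e"
      by (auto simp: S_def dist_norm simp flip: of_real_diff)
    then show "\<exists>x'\<in>S. x' \<noteq> complex_of_real \<epsilon>0 \<and> dist x' (complex_of_real \<epsilon>0) < e" by blast
  qed
  moreover have "S \<subseteq> ball 0 1" using \<epsilon>0 by (auto simp: S_def)
  moreover have "\<Psi> z = 0" if "z \<in> S" for z
    using that \<epsilon>0 by (auto simp: S_def intro!: z)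
  ultimately show ?thesis
    using analytic_continuation[OF hol open_ball connected_ball, of S "of_real \<epsilon>0" 0] \<epsilon>0 by auto
qed

section \<open>The leading term of an invariant\<close>

lemma sum_list_map_update:
  fixes f :: "'a \<Rightarrow> int"
  assumes "b < length J"
  shows "(\<Sum>j\<leftarrow>J[b := k]. f j) = (\<Sum>j\<leftarrow>J. f j) + f k - f (J ! b)"
  using assms
proof (induction J arbitrary: b)
  case (Cons j J)
  then show ?case by (cases b) auto
qed simp

lemma component_degree_update_lower:
  "b < length J \<Longrightarrow> component_degree s r I (J[b := k]) = component_degree s r I J + int (s (J ! b)) - int (s k)"
  unfolding component_degree_def by (simp add: sum_list_map_update)

lemma component_degree_update_upper:
  "b < length I \<Longrightarrow> component_degree s r (I[b := k]) J = component_degree s r I J - int (s (I ! b)) + int (s k)"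
  unfolding component_degree_def by (simp add: sum_list_map_update)

text \<open>Here \<open>A\<close> and \<open>B\<close> are the terms of the expansions of \<open>T\<close> and \<open>g\<close>, with degrees moving in the
  direction \<open>d\<close>. The Lie derivative along \<open>g\<close>, evaluated at the dilated point, is a power of the dilation
  factor times a function \<open>\<Psi>\<close> holomorphic on the unit disc, and \<open>\<Psi> 0\<close> is the Lie derivative of the leading
  terms.\<close>
lemma truncated_lie_derivative_locally:
  fixes A :: "nat \<Rightarrow> 'n::finite tensor_field" and B :: "nat \<Rightarrow> 'n vector_field"
    and g :: "'n vector_field" and T :: "'n tensor_field" and a :: "complex^'n"
  assumes U: "open U" and d: "d = 1 \<or> d = - 1"
    and A_an: "\<And>k I J. length I = p \<Longrightarrow> length J = q \<Longrightarrow> mv_analytic_on (A k I J) U"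
    and T_an: "\<And>I J. length I = p \<Longrightarrow> length J = q \<Longrightarrow> mv_analytic_on (T I J) U"
    and A_qh: "\<And>k. quasi_homogeneous_tensor_field s p q (l + d * int k) (A k)"
    and A_sm: "\<And>I J x. length I = p \<Longrightarrow> length J = q \<Longrightarrow> x \<in> U \<Longrightarrow> (\<lambda>k. A k I J x) sums T I J x"
    and B_an: "\<And>k j. mv_analytic_on (\<lambda>x. B k x $ j) U"
    and g_an: "\<And>j. mv_analytic_on (\<lambda>x. g x $ j) U"
    and B_qh: "\<And>k. quasi_homogeneous_vector_field s (m + d * int k) (B k)"
    and B_sm: "\<And>j x. x \<in> U \<Longrightarrow> (\<lambda>k. B k x $ j) sums (g x $ j)"
    and inv: "\<And>I J x. length I = p \<Longrightarrow> length J = q \<Longrightarrow> x \<in> U \<Longrightarrow> lie_derivative g T I J x = 0"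
    and r: "r > 0" "ball a r \<subseteq> U"
    and A_bd: "\<And>k I J x. length I = p \<Longrightarrow> length J = q \<Longrightarrow> x \<in> ball a r \<Longrightarrow> norm (A k I J x) \<le> N"
    and B_bd: "\<And>k j x. x \<in> ball a r \<Longrightarrow> norm (B k x $ j) \<le> N"
    and I: "length I = p" and J: "length J = q"
  shows "lie_derivative (B 0) (A 0) I J a = 0"
proof -
  define PS where "PS c z = (\<Sum>k. c k * z ^ k)" for c :: "nat \<Rightarrow> complex" and z
  define cA where "cA I J k = A k I J a" for I J k
  define dA where "dA i I J k = partial_deriv i (A k I J) a" for i I J k
  define cB where "cB j k = B k a $ j" for j k
  define dB where "dB i j k = partial_deriv i (\<lambda>x. B k x $ j) a" for i j k
  define \<Psi> where "\<Psi> z =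
     (\<Sum>s\<in>UNIV. PS (cB s) z * PS (dA s I J) z)
     + (\<Sum>b<length J. \<Sum>k\<in>UNIV. PS (cA I (J[b := k])) z * PS (dB (J ! b) k) z)
     - (\<Sum>b<length I. \<Sum>k\<in>UNIV. PS (cA (I[b := k]) J) z * PS (dB k (I ! b)) z)" for z
  have hol: "PS (cB j) holomorphic_on ball 0 1" "PS (dB i j) holomorphic_on ball 0 1" for i j
    unfolding PS_def cB_def dB_def
    by (rule bounded_power_series_holomorphic, rule B_bd, use r in simp,
        rule bounded_power_series_holomorphic, rule partial_deriv_bound[OF B_an r B_bd])
  have hol': "PS (cA I J) holomorphic_on ball 0 1" "PS (dA i I J) holomorphic_on ball 0 1"
    if "length I = p" "length J = q" for i I J
    unfolding PS_def cA_def dA_def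
    by (rule bounded_power_series_holomorphic, rule A_bd[OF that], use r in simp,
        rule bounded_power_series_holomorphic, rule partial_deriv_bound[OF A_an[OF that] r A_bd[OF that]])
  have \<Psi>_hol: "\<Psi> holomorphic_on ball 0 1"
    unfolding \<Psi>_def by (intro holomorphic_intros hol hol') (auto simp: I J)
  have "((\<lambda>\<epsilon>. dilation s (\<epsilon> powi d) a) \<longlongrightarrow> dilation s (1 powi d) a) (at 1)"
    unfolding dilation_def by (intro tendsto_vec_lambda tendsto_intros) auto
  moreover have "dilation s (1 powi d) a = a" by (simp add: dilation_def vec_eq_iff)
  ultimately have "eventually (\<lambda>\<epsilon>. dilation s (\<epsilon> powi d) a \<in> U) (at 1)"
    using U r by (auto dest!: topological_tendstoD)
  then obtain \<eta> where \<eta>: "\<eta> > 0"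
    "\<And>\<epsilon>. \<epsilon> \<noteq> 1 \<Longrightarrow> dist \<epsilon> 1 < \<eta> \<Longrightarrow> dilation s (\<epsilon> powi d) a \<in> U"
    unfolding eventually_at by blast
  have "\<Psi> (complex_of_real \<epsilon>) = 0" if \<epsilon>: "1 - \<eta> < \<epsilon>" "0 < \<epsilon>" "\<epsilon> < 1" for \<epsilon>
  proof -
    \<comment> \<open>As \<open>d\<^sup>2 = 1\<close>, this is the dilation factor for which \<open>\<rho>\<^sup>d = \<epsilon>\<close>.\<close>
    define \<rho> where "\<rho> = \<epsilon> powi d"
    define R where "R w = complex_of_real (\<rho> powi w)" for w
    have \<rho>: "\<rho> > 0" "\<rho> powi d = \<epsilon>" "\<rho> powi d < 1" using \<epsilon> d by (auto simp: \<rho>_def)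
    have a': "dilation s \<rho> a \<in> U"
      unfolding \<rho>_def by (rule \<eta>(2)) (use \<epsilon> in \<open>auto simp: dist_norm\<close>)
    have R_add: "R (v + w) = R v * R w" for v w using \<rho>(1) by (simp add: R_def power_int_add)
    have R_nz: "R w \<noteq> 0" for w using \<rho>(1) by (simp add: R_def)
    have Bq: "B k (dilation s \<rho> x) $ j = of_real (\<rho> powi ((int (s j) + m - 1) + d * int k)) * B k x $ j" for k j x
      using B_qh[of k] \<rho>(1) unfolding quasi_homogeneous_vector_field_def by (simp add: algebra_simps)
    have Aq: "A k I J (dilation s \<rho> x) = of_real (\<rho> powi (component_degree s l I J + d * int k)) * A k I J x"
      if "length I = p" "length J = q" for k I J x
      using A_qh[of k] \<rho>(1) that unfolding quasi_homogeneous_tensor_field_def component_degree_def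
      by (simp add: algebra_simps)
    note SB = quasi_homogeneous_series[OF B_an g_an Bq B_sm U r B_bd \<rho>(1,3) a', unfolded \<rho>(2), folded R_def]
    note SA = quasi_homogeneous_series[OF A_an T_an Aq A_sm U r A_bd \<rho>(1,3) a', unfolded \<rho>(2), folded R_def]
    have gB: "g (dilation s \<rho> a) $ j = R (int (s j) + m - 1) * PS (cB j) \<epsilon>" for j
      unfolding PS_def cB_def by (rule SB(1))
    have gdB: "partial_deriv i (\<lambda>x. g x $ j) (dilation s \<rho> a) = R (int (s j) + m - 1 - int (s i)) * PS (dB i j) \<epsilon>" for i j
      unfolding PS_def dB_def by (rule SB(2))
    have TA: "T I J (dilation s \<rho> a) = R (component_degree s l I J) * PS (cA I J) \<epsilon>"
      if "length I = p" "length J = q" for I J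
      unfolding PS_def cA_def by (rule SA(1)) (use that in auto)
    have TdA: "partial_deriv i (T I J) (dilation s \<rho> a) = R (component_degree s l I J - int (s i)) * PS (dA i I J) \<epsilon>"
      if "length I = p" "length J = q" for i I J
      unfolding PS_def dA_def by (rule SA(2)) (use that in auto)
    define w where "w = component_degree s l I J + m - 1"
    have t1: "g (dilation s \<rho> a) $ i * partial_deriv i (T I J) (dilation s \<rho> a)
        = R w * (PS (cB i) \<epsilon> * PS (dA i I J) \<epsilon>)" for i
    proof -
      have "w = (int (s i) + m - 1) + (component_degree s l I J - int (s i))" by (simp add: w_def)
      then show ?thesis unfolding gB TdA[OF I J] by (simp only: R_add mult_ac)
    qed
    have t2: "T I (J[b := k]) (dilation s \<rho> a) * partial_deriv (J ! b) (\<lambda>x. g x $ k) (dilation s \<rho> a)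
        = R w * (PS (cA I (J[b := k])) \<epsilon> * PS (dB (J ! b) k) \<epsilon>)" if "b < length J" for b k
    proof -
      have "w = component_degree s l I (J[b := k]) + (int (s k) + m - 1 - int (s (J ! b)))"
        using that by (simp add: w_def component_degree_update_lower)
      moreover have "length (J[b := k]) = q" using J by simp
      ultimately show ?thesis unfolding gdB TA[OF I \<open>length (J[b := k]) = q\<close>] by (simp only: R_add mult_ac)
    qed
    have t3: "T (I[b := k]) J (dilation s \<rho> a) * partial_deriv k (\<lambda>x. g x $ (I ! b)) (dilation s \<rho> a)
        = R w * (PS (cA (I[b := k]) J) \<epsilon> * PS (dB k (I ! b)) \<epsilon>)" if "b < length I" for b k
    proof -
      have "w = component_degree s l (I[b := k]) J + (int (s (I ! b)) + m - 1 - int (s k))"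
        using that by (simp add: w_def component_degree_update_upper)
      moreover have "length (I[b := k]) = p" using I by simp
      ultimately show ?thesis unfolding gdB TA[OF \<open>length (I[b := k]) = p\<close> J] by (simp only: R_add mult_ac)
    qed
    have "lie_derivative g T I J (dilation s \<rho> a) = R w * \<Psi> \<epsilon>"
      unfolding lie_derivative_def \<Psi>_def by (simp add: t1 t2 t3 sum_distrib_left distrib_left right_diff_distrib)
    then show ?thesis using inv[OF I J a'] R_nz by simp
  qed
  then have "\<Psi> 0 = 0" by (rule holomorphic_zero_on_segment[OF \<Psi>_hol \<eta>(1)])
  moreover have "PS c 0 = c 0" for c unfolding PS_def using powser_zero[of c] by simp
  ultimately show ?thesis
    by (simp add: \<Psi>_def lie_derivative_def cA_def dA_def cB_def dB_def)
qed

lemma sums_bounded: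
  fixes f :: "nat \<Rightarrow> complex"
  assumes "f sums x"
  shows "bounded (range f)"
  by (rule convergent_imp_bounded[OF summable_LIMSEQ_zero[OF sums_summable[OF assms]]])

text \<open>If the Lie derivative of the leading terms were nonzero somewhere, it would be nonzero on an open
  set, and that set contains a ball on which all terms are bounded.\<close>
lemma truncated_lie_derivative:
  fixes A :: "nat \<Rightarrow> 'n::finite tensor_field" and B :: "nat \<Rightarrow> 'n vector_field"
    and g :: "'n vector_field" and T :: "'n tensor_field" and x :: "complex^'n"
  assumes U: "open U" and d: "d = 1 \<or> d = - 1"
    and A_an: "\<And>k I J. length I = p \<Longrightarrow> length J = q \<Longrightarrow> mv_analytic_on (A k I J) U"
    and T_an: "\<And>I J. length I = p \<Longrightarrow> length J = q \<Longrightarrow> mv_analytic_on (T I J) U"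
    and A_qh: "\<And>k. quasi_homogeneous_tensor_field s p q (l + d * int k) (A k)"
    and A_sm: "\<And>I J x. length I = p \<Longrightarrow> length J = q \<Longrightarrow> x \<in> U \<Longrightarrow> (\<lambda>k. A k I J x) sums T I J x"
    and B_an: "\<And>k j. mv_analytic_on (\<lambda>x. B k x $ j) U"
    and g_an: "\<And>j. mv_analytic_on (\<lambda>x. g x $ j) U"
    and B_qh: "\<And>k. quasi_homogeneous_vector_field s (m + d * int k) (B k)"
    and B_sm: "\<And>j x. x \<in> U \<Longrightarrow> (\<lambda>k. B k x $ j) sums (g x $ j)"
    and inv: "\<And>I J x. length I = p \<Longrightarrow> length J = q \<Longrightarrow> x \<in> U \<Longrightarrow> lie_derivative g T I J x = 0"
    and I: "length I = p" and J: "length J = q" and x: "x \<in> U"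
  shows "lie_derivative (B 0) (A 0) I J x = 0"
proof (rule ccontr)
  assume nz: "lie_derivative (B 0) (A 0) I J x \<noteq> 0"
  let ?L = "lie_derivative (B 0) (A 0) I J"
  have "continuous_on U ?L"
    unfolding lie_derivative_def
    by (intro continuous_intros mv_analytic_on_continuous_on mv_analytic_on_partial_deriv B_an A_an)
      (auto simp: I J)
  then have V: "open {y \<in> U. ?L y \<noteq> 0}"
  proof -
    have "open (U \<inter> ?L -` (- {0}))"
      by (rule continuous_open_preimage[OF \<open>continuous_on U ?L\<close> U]) auto
    moreover have "U \<inter> ?L -` (- {0}) = {y \<in> U. ?L y \<noteq> 0}" by auto
    ultimately show ?thesis by simp
  qed
  define F where "F = (\<Union>(I, J)\<in>{I. length I = p} \<times> {J. length J = q}. range (\<lambda>k. A k I J))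
      \<union> (\<Union>j. range (\<lambda>k x. B k x $ j))"
  have cont: "continuous_on {y \<in> U. ?L y \<noteq> 0} f" if "f \<in> F" for f
    using that unfolding F_def
    by (auto intro!: continuous_on_subset[OF mv_analytic_on_continuous_on] A_an B_an)
  have fin: "finite {I :: 'n list. length I = k}" for k
    using finite_lists_length_eq[of "UNIV :: 'n set" k] by simp
  have bdd: "bounded ((\<lambda>f. f y) ` F)" if "y \<in> {y \<in> U. ?L y \<noteq> 0}" for y
  proof -
    have yU: "y \<in> U" using that by blast
    have b1: "bounded ((\<lambda>f. f y) ` range (\<lambda>k. A k I J))" if "length I = p" "length J = q" for I J
      using sums_bounded[OF A_sm[OF that yU]] by (simp add: image_image)
    have b2: "bounded ((\<lambda>f. f y) ` range (\<lambda>k x. B k x $ j))" for j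
      using sums_bounded[OF B_sm[OF yU]] by (simp add: image_image)
    have "finite ({I :: 'n list. length I = p} \<times> {J :: 'n list. length J = q})"
      by (intro finite_cartesian_product fin)
    then show ?thesis
      unfolding F_def image_Un image_UN bounded_Un
      using b1 b2 by (intro conjI bounded_UN) auto
  qed
  obtain a r N where r: "r > 0" "ball a r \<subseteq> {y \<in> U. ?L y \<noteq> 0}"
    and N: "\<And>f y. f \<in> F \<Longrightarrow> y \<in> ball a r \<Longrightarrow> norm (f y) \<le> N"
  proof (rule baire_locally_bounded[OF V])
    show "x \<in> {y \<in> U. ?L y \<noteq> 0}" using x nz by blast
  next
    fix f assume "f \<in> F" then show "continuous_on {y \<in> U. ?L y \<noteq> 0} f" by (rule cont)
  next
    fix y assume "y \<in> {y \<in> U. ?L y \<noteq> 0}" then show "bounded ((\<lambda>f. f y) ` F)" by (rule bdd)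
  next
    fix a and r N :: real
    assume "r > 0" "ball a r \<subseteq> {y \<in> U. ?L y \<noteq> 0}"
      "\<And>f y. f \<in> F \<Longrightarrow> y \<in> ball a r \<Longrightarrow> norm (f y) \<le> N"
    then show thesis by (rule that)
  qed
  have A_bd: "norm (A k I J y) \<le> N" if "length I = p" "length J = q" "y \<in> ball a r" for k I J y
    using that by (intro N) (auto simp: F_def)
  have B_bd: "norm (B k y $ j) \<le> N" if "y \<in> ball a r" for k j y
  proof (rule N[OF _ that])
    have "(\<lambda>y. B k y $ j) \<in> range (\<lambda>k y. B k y $ j)" by blast
    then show "(\<lambda>y. B k y $ j) \<in> F" unfolding F_def by blast
  qed
  have r': "ball a r \<subseteq> U" using r(2) by blast
  have "?L a = 0"
    by (rule truncated_lie_derivative_locally[OF U d A_an T_an A_qh A_sm B_an g_an B_qh B_sm inv r(1) r' A_bd B_bd I J])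
  moreover have "a \<in> {y \<in> U. ?L y \<noteq> 0}" by (rule subsetD[OF r(2)]) (use r(1) in simp)
  ultimately show False by simp
qed

lemma expansion_homogeneous_term:
  assumes "quasi_homogeneous_expansion_on \<sigma> s p q l T TT U"
  shows "homogeneous_term_on \<sigma> s p q l (TT l) U"
  using assms unfolding quasi_homogeneous_expansion_on_def by (cases \<sigma>) auto

text \<open>The leading term of an invariant of the full system is an invariant of the truncated system.\<close>
lemma leading_term_invariant:
  fixes g gm :: "'n::finite vector_field"
  assumes U: "open U" and g: "semi_quasihomogeneous_on \<sigma> s m g gm U"
    and T: "tensor_invariant_on p q g T U"
    and ex: "quasi_homogeneous_expansion_on \<sigma> s p q l T TT U"
  shows "tensor_invariant_on p q gm (TT l) U"
proof -
  obtain G where gan: "analytic_vector_field_on g U" "analytic_vector_field_on gm U"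
    and gm: "quasi_homogeneous_vector_field s (int m) gm"
    and G: "\<And>k. analytic_vector_field_on (G k) U"
      "\<And>k. quasi_homogeneous_vector_field s (int m + direction \<sigma> * int (Suc k)) (G k)"
      "\<And>x. x \<in> U \<Longrightarrow> (\<lambda>k. G k x) sums (g x - gm x)"
    using g unfolding semi_quasihomogeneous_on_def by blast
  define B where "B = case_nat gm G"
  have B: "analytic_vector_field_on (B k) U"
    "quasi_homogeneous_vector_field s (int m + direction \<sigma> * int k) (B k)" for k
    using gan gm G by (auto simp: B_def split: nat.split)
  have B_sm: "(\<lambda>k. B k x $ j) sums (g x $ j)" if "x \<in> U" for x j
  proof -
    have "(\<lambda>k. G k x $ j) sums ((g x - gm x) $ j)"
      by (rule bounded_linear.sums[OF bounded_linear_vec_nth G(3)[OF that]])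
    then have "(\<lambda>k. B (Suc k) x $ j) sums (g x $ j - B 0 x $ j)" by (simp add: B_def)
    from iffD1[OF sums_Suc_iff[of "\<lambda>k. B k x $ j"] this] show ?thesis by simp
  qed
  have hom: "homogeneous_term_on \<sigma> s p q l (TT l) U" by (rule expansion_homogeneous_term[OF ex])
  have "\<exists>A. A 0 = TT l \<and>
     (\<forall>k I J. length I = p \<longrightarrow> length J = q \<longrightarrow> mv_analytic_on (A k I J) U) \<and>
     (\<forall>k. quasi_homogeneous_tensor_field s p q (l + direction \<sigma> * int k) (A k)) \<and>
     (\<forall>I J x. length I = p \<longrightarrow> length J = q \<longrightarrow> x \<in> U \<longrightarrow> (\<lambda>k. A k I J x) sums T I J x)"
  proof (cases \<sigma>)
    case Positive
    have h: "homogeneous_term_on Positive s p q (l + int k) (TT (l + int k)) U" for k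
      using ex Positive by (simp add: quasi_homogeneous_expansion_on_def)
    show ?thesis
    proof (intro exI[of _ "\<lambda>k. TT (l + int k)"] conjI allI impI)
      show "mv_analytic_on (TT (l + int k) I J) U" if "length I = p" "length J = q" for k I J
        by (rule weighted_series_on_mv_analytic_on[OF homogeneous_term_on_weighted_series[OF h that] U])
      show "quasi_homogeneous_tensor_field s p q (l + direction \<sigma> * int k) (TT (l + int k))" for k
        using h[of k] Positive by (simp add: homogeneous_term_on_def)
      show "(\<lambda>k. TT (l + int k) I J x) sums T I J x" if "length I = p" "length J = q" "x \<in> U" for I J x
        using ex Positive that by (simp add: quasi_homogeneous_expansion_on_def)
    qed simp
  next
    case Negative
    have "\<exists>L::nat. (\<forall>r\<in>{l - int L..l}. homogeneous_term_on Negative s p q r (TT r) U) \<and>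
        (\<forall>I J. length I = p \<longrightarrow> length J = q \<longrightarrow> (\<forall>x. T I J x = (\<Sum>r\<in>{l - int L..l}. TT r I J x)))"
      using ex unfolding quasi_homogeneous_expansion_on_def Negative kind.case by blast
    then obtain L :: nat
      where h: "\<And>r. r \<in> {l - int L..l} \<Longrightarrow> homogeneous_term_on Negative s p q r (TT r) U"
        and sm: "\<And>I J x. length I = p \<Longrightarrow> length J = q \<Longrightarrow> T I J x = (\<Sum>r\<in>{l - int L..l}. TT r I J x)"
      by blast
    \<comment> \<open>The finite expansion is continued by zero, which is quasi-homogeneous of every degree.\<close>
    define A :: "nat \<Rightarrow> 'n tensor_field"
      where "A k = (if k \<le> L then TT (l - int k) else (\<lambda>_ _ _. 0))" for k
    have hA: "homogeneous_term_on Negative s p q (l - int k) (A k) U" if "k \<le> L" for k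
      using h[of "l - int k"] that by (simp add: A_def)
    show ?thesis
    proof (intro exI[of _ A] conjI allI impI)
      show "A 0 = TT l" by (simp add: A_def)
      show "mv_analytic_on (A k I J) U" if "length I = p" "length J = q" for k I J
      proof (cases "k \<le> L")
        case True
        show ?thesis
          by (rule weighted_series_on_mv_analytic_on[OF homogeneous_term_on_weighted_series[OF hA[OF True] that] U])
      qed (simp add: A_def mv_analytic_on_const)
      show "quasi_homogeneous_tensor_field s p q (l + direction \<sigma> * int k) (A k)" for k
      proof (cases "k \<le> L")
        case True
        then show ?thesis using hA[OF True] Negative by (simp add: homogeneous_term_on_def)
      qed (simp add: A_def quasi_homogeneous_tensor_field_def)
      show "(\<lambda>k. A k I J x) sums T I J x" if "length I = p" "length J = q" "x \<in> U" for I J x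
      proof -
        have "(\<lambda>k. A k I J x) sums (\<Sum>k\<le>L. A k I J x)"
          by (rule sums_finite) (auto simp: A_def)
        also have "(\<Sum>k\<le>L. A k I J x) = (\<Sum>r\<in>{l - int L..l}. TT r I J x)"
          by (rule sum.reindex_bij_witness[of _ "\<lambda>r. nat (l - r)" "\<lambda>k. l - int k"]) (auto simp: A_def)
        finally show ?thesis using sm[OF that(1,2)] by simp
      qed
    qed
  qed
  then obtain A where A0: "A 0 = TT l"
    and A: "\<And>k I J. length I = p \<Longrightarrow> length J = q \<Longrightarrow> mv_analytic_on (A k I J) U"
      "\<And>k. quasi_homogeneous_tensor_field s p q (l + direction \<sigma> * int k) (A k)"
      "\<And>I J x. length I = p \<Longrightarrow> length J = q \<Longrightarrow> x \<in> U \<Longrightarrow> (\<lambda>k. A k I J x) sums T I J x"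
    by blast
  have Tan: "\<And>I J. length I = p \<Longrightarrow> length J = q \<Longrightarrow> mv_analytic_on (T I J) U"
    and inv: "\<And>I J x. length I = p \<Longrightarrow> length J = q \<Longrightarrow> x \<in> U \<Longrightarrow> lie_derivative g T I J x = 0"
    using T unfolding tensor_invariant_on_def analytic_tensor_field_on_def by blast+
  have dir: "direction \<sigma> = 1 \<or> direction \<sigma> = - 1" by (cases \<sigma>) auto
  have "lie_derivative (B 0) (A 0) I J x = 0" if "length I = p" "length J = q" "x \<in> U" for I J x
    by (rule truncated_lie_derivative[OF U dir A(1) Tan A(2,3) _ _ B(2) B_sm inv that])
      (use B(1) gan(1) in \<open>auto simp: analytic_vector_field_on_def\<close>)
  moreover have "analytic_tensor_field_on p q (TT l) U"
    using A(1)[of _ _ 0] unfolding analytic_tensor_field_on_def A0 by blast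
  ultimately show ?thesis unfolding tensor_invariant_on_def A0 by (simp add: B_def)
qed

section \<open>Eigentensors of the Lie derivative at a zero of the field\<close>

lemma sum_lessThan_add:
  fixes f :: "nat \<Rightarrow> complex"
  shows "(\<Sum>i<m + n. f i) = (\<Sum>i<m. f i) + (\<Sum>i<n. f (m + i))"
  by (induction n) (auto simp: add.assoc)

text \<open>Changing one value of an index function changes one entry of the index list that contains it.\<close>
lemma map_fun_upd_upt:
  "map (\<phi>(b := k)) [u..<v] = (if u \<le> b \<and> b < v then (map \<phi> [u..<v])[b - u := k] else map \<phi> [u..<v])"
  by (rule nth_equalityI) (auto simp: nth_list_update)

lemma det_scale_rows_columns:
  fixes A :: "complex^'n::finite^'n"
  shows "det (\<chi> i j. x i * A $ i $ j * y j) = prod x UNIV * det A * prod y UNIV"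
proof -
  have "det (\<chi> i j. x i * A $ i $ j * y j) = det (\<chi> i. x i *s (\<chi> j. A $ i $ j * y j))"
    by (rule arg_cong[of _ _ det]) (simp add: vec_eq_iff)
  also have "\<dots> = prod x UNIV * det (\<chi> i. \<chi> j. A $ i $ j * y j)" by (rule det_rows_mul)
  also have "det (\<chi> i. \<chi> j. A $ i $ j * y j) = det (transpose (\<chi> i. \<chi> j. A $ i $ j * y j))"
    by (simp add: det_transpose)
  also have "transpose (\<chi> i. \<chi> j. A $ i $ j * y j) = (\<chi> i. y i *s transpose A $ i)"
    by (simp add: vec_eq_iff transpose_def mult.commute)
  also have "det \<dots> = prod y UNIV * det (\<chi> i. transpose A $ i)" by (rule det_rows_mul)
  also have "(\<chi> i. transpose A $ i) = transpose A" by (simp add: vec_eq_iff)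
  finally show ?thesis by (simp add: det_transpose mult_ac)
qed

text \<open>Adding to the truncated field a multiple of the Euler field \<open>s\<^sub>i x\<^sub>i\<close> turns an invariant of
  degree \<open>l\<close> into an eigentensor of the Lie derivative.\<close>
lemma lie_derivative_plus_euler:
  fixes gm :: "'n::finite vector_field" and \<beta> :: complex
  assumes U: "open U" "x \<in> U" and gm: "\<And>j. mv_analytic_on (\<lambda>x. gm x $ j) U"
    and inv: "lie_derivative gm \<tau> I J x = 0"
    and ws: "weighted_series_on s (component_degree s l I J) (\<tau> I J) U"
  shows "lie_derivative (\<lambda>x. \<chi> i. gm x $ i + \<beta> * of_nat (s i) * x $ i) \<tau> I J x = \<beta> * of_int l * \<tau> I J x"
proof -
  let ?F = "\<lambda>x. \<chi> i. gm x $ i + \<beta> * of_nat (s i) * x $ i"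
  have pF: "partial_deriv j (\<lambda>y. ?F y $ k) x
      = partial_deriv j (\<lambda>y. gm y $ k) x + (if k = j then \<beta> * of_nat (s j) else 0)" for j k
  proof -
    have "partial_deriv j (\<lambda>y. gm y $ k + \<beta> * of_nat (s k) * y $ k) x
       = partial_deriv j (\<lambda>y. gm y $ k) x + partial_deriv j (\<lambda>y. \<beta> * of_nat (s k) * y $ k) x"
      by (rule partial_deriv_add[OF gm _ U(2)]) (intro mv_analytic_on_cmult mv_analytic_on_coord)
    also have "partial_deriv j (\<lambda>y. \<beta> * of_nat (s k) * y $ k) x = \<beta> * of_nat (s k) * (if j = k then 1 else 0)"
      by (subst partial_deriv_cmult[OF mv_analytic_on_coord U(2)]) (simp add: partial_deriv_coord)
    finally show ?thesis by auto
  qed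
  have sum_if: "(\<Sum>k\<in>UNIV. h k * (if k = j then c else 0)) = h j * c" for h :: "'n \<Rightarrow> complex" and j c
    by (subst sum.cong[OF refl, of _ _ "\<lambda>k. if k = j then h j * c else 0"]) auto
  have sum_if': "(\<Sum>k\<in>UNIV. h k * (if j = k then \<beta> * of_nat (s k) else 0)) = h j * (\<beta> * of_nat (s j))"
    for h :: "'n \<Rightarrow> complex" and j
    by (subst sum.cong[OF refl, of _ _ "\<lambda>k. if k = j then h j * (\<beta> * of_nat (s j)) else 0"]) auto
  have lJ: "(\<Sum>b<length J. of_nat (s (J ! b))) = complex_of_int (\<Sum>j\<leftarrow>J. int (s j))" for J
    by (simp add: sum_list_sum_nth atLeast0LessThan)
  have euler: "(\<Sum>i\<in>UNIV. of_nat (s i) * x $ i * partial_deriv i (\<tau> I J) x)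
      = of_int (component_degree s l I J) * \<tau> I J x"
    by (rule weighted_series_on_euler[OF ws U])
  have "(\<Sum>i\<in>UNIV. ?F x $ i * partial_deriv i (\<tau> I J) x)
      = (\<Sum>i\<in>UNIV. gm x $ i * partial_deriv i (\<tau> I J) x) + \<beta> * (of_int (component_degree s l I J) * \<tau> I J x)"
    unfolding euler[symmetric] by (simp add: distrib_right sum.distrib sum_distrib_left mult.assoc)
  moreover have "(\<Sum>b<length J. \<Sum>k\<in>UNIV. \<tau> I (J[b := k]) x * partial_deriv (J ! b) (\<lambda>y. ?F y $ k) x)
      = (\<Sum>b<length J. \<Sum>k\<in>UNIV. \<tau> I (J[b := k]) x * partial_deriv (J ! b) (\<lambda>y. gm y $ k) x)
        + \<beta> * of_int (\<Sum>j\<leftarrow>J. int (s j)) * \<tau> I J x"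
    unfolding lJ[symmetric] pF
    by (simp add: distrib_left sum.distrib sum_if sum_distrib_left sum_distrib_right mult_ac)
  moreover have "(\<Sum>a<length I. \<Sum>k\<in>UNIV. \<tau> (I[a := k]) J x * partial_deriv k (\<lambda>y. ?F y $ (I ! a)) x)
      = (\<Sum>a<length I. \<Sum>k\<in>UNIV. \<tau> (I[a := k]) J x * partial_deriv k (\<lambda>y. gm y $ (I ! a)) x)
        + \<beta> * of_int (\<Sum>j\<leftarrow>I. int (s j)) * \<tau> I J x"
    unfolding lJ[symmetric] pF
    by (simp add: distrib_left sum.distrib sum_if' sum_distrib_left sum_distrib_right mult_ac)
  ultimately have "lie_derivative ?F \<tau> I J x
     = lie_derivative gm \<tau> I J x + \<beta> * of_int (component_degree s l I J) * \<tau> I J x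
       + \<beta> * of_int (\<Sum>j\<leftarrow>J. int (s j)) * \<tau> I J x - \<beta> * of_int (\<Sum>j\<leftarrow>I. int (s j)) * \<tau> I J x"
    unfolding lie_derivative_def by (simp add: algebra_simps)
  also have "\<dots> = \<beta> * of_int l * \<tau> I J x"
    unfolding inv component_degree_def by (simp add: algebra_simps)
  finally show ?thesis .
qed

text \<open>Let \<open>c\<close> be a zero of \<open>F\<close> at which all derivatives of \<open>\<tau>\<close> of order below \<open>length A\<close> vanish. Then the
  derivative of \<open>L\<^sub>F \<tau>\<close> along \<open>A\<close> at \<open>c\<close> involves only first derivatives of \<open>F\<close>, and the directions in
  \<open>A\<close> behave like further lower indices of \<open>\<tau>\<close>.\<close>
lemma iterated_partial_lie_derivative:
  fixes F :: "'n::finite vector_field"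
  assumes U: "open U" "c \<in> U" and F: "\<And>j. mv_analytic_on (\<lambda>x. F x $ j) U" "F c = 0"
    and \<tau>: "\<And>I J. length I = p \<Longrightarrow> length J = q \<Longrightarrow> mv_analytic_on (\<tau> I J) U"
    and van: "\<And>I J D. length I = p \<Longrightarrow> length J = q \<Longrightarrow> length D < length A \<Longrightarrow> iterated_partial D (\<tau> I J) c = 0"
    and I: "length I = p" and J: "length J = q"
  shows "iterated_partial A (lie_derivative F \<tau> I J) c
    = (\<Sum>a<length A. \<Sum>k\<in>UNIV. partial_deriv (A ! a) (\<lambda>x. F x $ k) c * iterated_partial (A[a := k]) (\<tau> I J) c)
    + (\<Sum>b<length J. \<Sum>k\<in>UNIV. partial_deriv (J ! b) (\<lambda>x. F x $ k) c * iterated_partial A (\<tau> I (J[b := k])) c)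
    - (\<Sum>b<length I. \<Sum>k\<in>UNIV. partial_deriv k (\<lambda>x. F x $ (I ! b)) c * iterated_partial A (\<tau> (I[b := k]) J) c)"
proof -
  note dF = mv_analytic_on_partial_deriv[OF F(1)]
  have \<tau>J: "mv_analytic_on (\<tau> I (J[b := k])) U" and \<tau>I: "mv_analytic_on (\<tau> (I[b := k]) J) U" for b k
    by (auto intro!: \<tau> simp: I J)
  note d\<tau> = mv_analytic_on_partial_deriv[OF \<tau>[OF I J]]
  have 1: "iterated_partial A (\<lambda>x. F x $ k * partial_deriv k (\<tau> I J) x) c
      = (\<Sum>a<length A. partial_deriv (A ! a) (\<lambda>x. F x $ k) c * iterated_partial (A[a := k]) (\<tau> I J) c)" for k
  proof -
    have "iterated_partial A (\<lambda>x. F x $ k * partial_deriv k (\<tau> I J) x) c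
      = (\<Sum>a<length A. partial_deriv (A ! a) (\<lambda>x. F x $ k) c
          * iterated_partial (take a A @ drop (Suc a) A) (partial_deriv k (\<tau> I J)) c)"
    proof (rule iterated_partial_mult_first_order[OF U _ F(1) d\<tau>])
      show "F c $ k = 0" by (simp add: F(2))
      show "length A \<le> Suc (length A - 1)" by simp
      fix D :: "'n list" assume "length D < length A - 1"
      then show "iterated_partial D (partial_deriv k (\<tau> I J)) c = 0"
        using van[OF I J, of "k # D"] by simp
    qed
    also have "\<dots> = (\<Sum>a<length A. partial_deriv (A ! a) (\<lambda>x. F x $ k) c * iterated_partial (A[a := k]) (\<tau> I J) c)"
    proof (rule sum.cong[OF refl])
      fix a assume "a \<in> {..<length A}"
      then have "A[a := k] = take a A @ k # drop (Suc a) A" by (simp add: upd_conv_take_nth_drop)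
      then show "partial_deriv (A ! a) (\<lambda>x. F x $ k) c
          * iterated_partial (take a A @ drop (Suc a) A) (partial_deriv k (\<tau> I J)) c
        = partial_deriv (A ! a) (\<lambda>x. F x $ k) c * iterated_partial (A[a := k]) (\<tau> I J) c"
        using iterated_partial_move[OF U \<tau>[OF I J], of k "take a A" "drop (Suc a) A"] by simp
    qed
    finally show ?thesis .
  qed
  have 2: "iterated_partial A (\<lambda>x. \<tau> I (J[b := k]) x * partial_deriv (J ! b) (\<lambda>y. F y $ k) x) c
      = partial_deriv (J ! b) (\<lambda>x. F x $ k) c * iterated_partial A (\<tau> I (J[b := k])) c" for b k
    by (subst mult.commute, rule iterated_partial_mult_vanishing[OF U dF \<tau>J, of "length A"])
      (auto intro!: van simp: I J)
  have 3: "iterated_partial A (\<lambda>x. \<tau> (I[b := k]) J x * partial_deriv k (\<lambda>y. F y $ (I ! b)) x) c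
      = partial_deriv k (\<lambda>x. F x $ (I ! b)) c * iterated_partial A (\<tau> (I[b := k]) J) c" for b k
    by (subst mult.commute, rule iterated_partial_mult_vanishing[OF U dF \<tau>I, of "length A"])
      (auto intro!: van simp: I J)
  define L1 where "L1 x = (\<Sum>k\<in>UNIV. F x $ k * partial_deriv k (\<tau> I J) x)" for x
  define L2 where "L2 x = (\<Sum>b<length J. \<Sum>k\<in>UNIV. \<tau> I (J[b := k]) x * partial_deriv (J ! b) (\<lambda>y. F y $ k) x)" for x
  define L3 where "L3 x = (\<Sum>b<length I. \<Sum>k\<in>UNIV. \<tau> (I[b := k]) J x * partial_deriv k (\<lambda>y. F y $ (I ! b)) x)" for x
  note an = mv_analytic_on_sum mv_analytic_on_mult mv_analytic_on_cmult
  have an1: "mv_analytic_on L1 U" unfolding L1_def by (intro an F d\<tau>)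
  have an2: "mv_analytic_on L2 U" unfolding L2_def by (intro an dF \<tau>J)
  have an3: "mv_analytic_on L3 U" unfolding L3_def by (intro an dF \<tau>I)
  have "lie_derivative F \<tau> I J = (\<lambda>x. (L1 x + L2 x) + (- 1) * L3 x)"
    by (rule ext) (simp add: lie_derivative_def L1_def L2_def L3_def)
  then have "iterated_partial A (lie_derivative F \<tau> I J) c
      = iterated_partial A L1 c + iterated_partial A L2 c + (- 1) * iterated_partial A L3 c"
    by (simp only: iterated_partial_add[OF U mv_analytic_on_add[OF an1 an2] mv_analytic_on_cmult[OF an3]]
        iterated_partial_add[OF U an1 an2] iterated_partial_cmult[OF U an3])
  moreover have "iterated_partial A L1 c
      = (\<Sum>k\<in>UNIV. iterated_partial A (\<lambda>x. F x $ k * partial_deriv k (\<tau> I J) x) c)"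
    unfolding L1_def by (rule iterated_partial_sum[OF U]) (intro an F d\<tau>)
  moreover have "iterated_partial A L2 c
      = (\<Sum>b<length J. \<Sum>k\<in>UNIV. iterated_partial A (\<lambda>x. \<tau> I (J[b := k]) x * partial_deriv (J ! b) (\<lambda>y. F y $ k) x) c)"
    unfolding L2_def
    by (subst iterated_partial_sum[OF U], (intro an dF \<tau>J)[1], subst iterated_partial_sum[OF U], (intro an dF \<tau>J)[1], rule refl)
  moreover have "iterated_partial A L3 c
      = (\<Sum>b<length I. \<Sum>k\<in>UNIV. iterated_partial A (\<lambda>x. \<tau> (I[b := k]) J x * partial_deriv k (\<lambda>y. F y $ (I ! b)) x) c)"
    unfolding L3_def
    by (subst iterated_partial_sum[OF U], (intro an dF \<tau>I)[1], subst iterated_partial_sum[OF U], (intro an dF \<tau>I)[1], rule refl)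
  ultimately show ?thesis unfolding 1 2 3 by (simp add: sum.swap[of _ UNIV])
qed

text \<open>An eigenvalue of the Lie derivative along \<open>F\<close>, with an eigentensor that does not vanish near the zero
  \<open>c\<close> of \<open>F\<close>, is a combination of eigenvalues of the Jacobian matrix \<open>K0\<close> at \<open>c\<close>. The first \<open>d\<close> of them
  belong to directions of differentiation, the next \<open>q\<close> to lower and the last \<open>p\<close> to upper
  indices.\<close>
lemma lie_derivative_eigenvalue:
  fixes F :: "'n::finite vector_field"
  assumes U: "open U" "c \<in> U" and F: "\<And>j. mv_analytic_on (\<lambda>x. F x $ j) U" "F c = 0"
    and \<tau>: "\<And>I J. length I = p \<Longrightarrow> length J = q \<Longrightarrow> mv_analytic_on (\<tau> I J) U"
    and eig: "\<And>I J x. length I = p \<Longrightarrow> length J = q \<Longrightarrow> x \<in> U \<Longrightarrow> lie_derivative F \<tau> I J x = \<mu> * \<tau> I J x"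
    and nz: "length I0 = p" "length J0 = q" "iterated_partial A0 (\<tau> I0 J0) c \<noteq> 0"
    and K0: "K0 = (\<chi> i j. partial_deriv j (\<lambda>x. F x $ i) c)"
  obtains d :: nat and e :: "nat \<Rightarrow> complex"
  where "\<And>b. b < d + q + p \<Longrightarrow> det (mat (e b) - K0) = 0"
    "\<mu> = (\<Sum>b<d. e b) + (\<Sum>b<q. e (d + b)) - (\<Sum>b<p. e (d + q + b))"
proof -
  define Q where "Q d \<longleftrightarrow> (\<exists>A I J. length A = d \<and> length I = p \<and> length J = q \<and> iterated_partial A (\<tau> I J) c \<noteq> 0)" for d
  define d where "d = (LEAST d. Q d)"
  have "Q (length A0)" using nz unfolding Q_def by blast
  then have "Q d" unfolding d_def by (rule LeastI)
  then obtain A1 I1 J1 where 1: "length A1 = d" "length I1 = p" "length J1 = q" "iterated_partial A1 (\<tau> I1 J1) c \<noteq> 0"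
    unfolding Q_def by blast
  have van: "iterated_partial D (\<tau> I J) c = 0" if "length I = p" "length J = q" "length D < d" for I J D
    using not_less_Least[of "length D" Q] that unfolding Q_def d_def by blast
  \<comment> \<open>The array of the derivatives of order \<open>d\<close>: first the directions, then the lower, then the upper
    indices.\<close>
  define M where "M \<phi> = iterated_partial (map \<phi> [0..<d]) (\<tau> (map \<phi> [d + q..<d + q + p]) (map \<phi> [d..<d + q])) c"
    for \<phi> :: "nat \<Rightarrow> 'n"
  define B where "B b = (if b < d + q then transpose K0 else - K0)" for b
  define \<psi> where "\<psi> = (\<lambda>b. (A1 @ J1 @ I1) ! b)"
  have \<psi>: "map \<psi> [0..<d] = A1" "map \<psi> [d..<d + q] = J1" "map \<psi> [d + q..<d + q + p] = I1"
    unfolding \<psi>_def by (rule nth_equalityI; use 1 in \<open>simp add: nth_append\<close>)+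
  have "M \<psi> \<noteq> 0" unfolding M_def \<psi> by (rule 1(4))
  then have M_nz: "M \<noteq> (\<lambda>\<phi>. 0)" by auto
  have sum_M: "(\<Sum>b<d + q + p. index_operator B b M \<phi>) = \<mu> * M \<phi>" for \<phi>
  proof -
    define A where "A = map \<phi> [0..<d]"
    define J where "J = map \<phi> [d..<d + q]"
    define I where "I = map \<phi> [d + q..<d + q + p]"
    have len: "length A = d" "length J = q" "length I = p" by (auto simp: A_def J_def I_def)
    have "(\<Sum>b<d. index_operator B b M \<phi>)
        = (\<Sum>a<length A. \<Sum>k\<in>UNIV. partial_deriv (A ! a) (\<lambda>x. F x $ k) c * iterated_partial (A[a := k]) (\<tau> I J) c)"
      unfolding index_operator_def M_def len
      by (intro sum.cong refl) (simp add: map_fun_upd_upt A_def I_def J_def B_def K0 transpose_def)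
    moreover have "(\<Sum>b<q. index_operator B (d + b) M \<phi>)
        = (\<Sum>b<length J. \<Sum>k\<in>UNIV. partial_deriv (J ! b) (\<lambda>x. F x $ k) c * iterated_partial A (\<tau> I (J[b := k])) c)"
      unfolding index_operator_def M_def len
      by (intro sum.cong refl) (simp add: map_fun_upd_upt A_def I_def J_def B_def K0 transpose_def)
    moreover have "(\<Sum>b<p. index_operator B (d + q + b) M \<phi>)
        = - (\<Sum>b<length I. \<Sum>k\<in>UNIV. partial_deriv k (\<lambda>x. F x $ (I ! b)) c * iterated_partial A (\<tau> (I[b := k]) J) c)"
      unfolding index_operator_def M_def len sum_negf[symmetric]
      by (intro sum.cong refl) (simp add: map_fun_upd_upt A_def I_def J_def B_def K0)
    moreover have "iterated_partial D (\<tau> I J) c = 0" if "length I = p" "length J = q" "length D < length A" for I J D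
      using van that len by simp
    note iterated_partial_lie_derivative[OF U F \<tau> this len(3,2)]
    ultimately have "(\<Sum>b<d + q + p. index_operator B b M \<phi>) = iterated_partial A (lie_derivative F \<tau> I J) c"
      by (simp add: sum_lessThan_add)
    also have "\<dots> = iterated_partial A (\<lambda>x. \<mu> * \<tau> I J x) c"
      by (rule iterated_partial_cong[OF U]) (rule eig[OF len(3,2)])
    also have "\<dots> = \<mu> * M \<phi>"
      unfolding M_def A_def[symmetric] I_def[symmetric] J_def[symmetric]
      by (rule iterated_partial_cmult[OF U \<tau>[OF len(3,2)]])
    finally show ?thesis .
  qed
  obtain \<nu> where \<nu>: "\<And>b. b < d + q + p \<Longrightarrow> det (mat (\<nu> b) - B b) = 0" "\<mu> = (\<Sum>b<d + q + p. \<nu> b)"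
    using index_operator_sum_eigenvalue[OF M_nz sum_M] by blast
  define e where "e b = (if b < d + q then \<nu> b else - \<nu> b)" for b
  have "det (mat (e b) - K0) = 0" if "b < d + q + p" for b
  proof (cases "b < d + q")
    case True
    have "mat (\<nu> b) - transpose K0 = transpose (mat (\<nu> b) - K0)"
      by (simp add: vec_eq_iff transpose_def mat_def)
    then show ?thesis using \<nu>(1)[OF that] True by (simp add: B_def e_def det_transpose)
  next
    case False
    have "mat (- \<nu> b) - K0 = (\<chi> i. (- 1) *s (mat (\<nu> b) - - K0) $ i)"
      by (simp add: vec_eq_iff mat_def)
    then have "det (mat (- \<nu> b) - K0) = (\<Prod>i\<in>(UNIV :: 'n set). - 1) * det (\<chi> i. (mat (\<nu> b) - - K0) $ i)"
      using det_rows_mul[of "\<lambda>_. - 1" "\<lambda>i. (mat (\<nu> b) - - K0) $ i"] by simp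
    moreover have "(\<chi> i. (mat (\<nu> b) - - K0) $ i) = mat (\<nu> b) - - K0" by (simp add: vec_eq_iff)
    ultimately show ?thesis using \<nu>(1)[OF that] False by (simp add: B_def e_def)
  qed
  moreover have "\<mu> = (\<Sum>b<d. e b) + (\<Sum>b<q. e (d + b)) - (\<Sum>b<p. e (d + q + b))"
    unfolding \<nu>(2) by (simp add: sum_lessThan_add e_def sum_negf)
  ultimately show thesis by (rule that)
qed

section \<open>The resonance relation\<close>

text \<open>The scaling behaviour of the Jacobian matrix of a quasi-homogeneous field; the field need only be
  analytic near the dilated point.\<close>
lemma quasi_homogeneous_partial_deriv:
  fixes gm :: "'n::finite vector_field" and c :: "complex^'n"
  assumes qh: "quasi_homogeneous_vector_field s m gm" and \<rho>: "\<rho> > 0"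
    and an: "mv_analytic_on (\<lambda>x. gm x $ i) U" and U: "dilation s \<rho> c \<in> U"
  shows "partial_deriv j (\<lambda>x. gm x $ i) (dilation s \<rho> c)
    = of_real (\<rho> ^ s i) * of_real (\<rho> powi (m - 1)) * partial_deriv j (\<lambda>x. gm x $ i) c / of_real (\<rho> ^ s j)"
proof -
  define R where "R = complex_of_real (\<rho> ^ s i) * of_real (\<rho> powi (m - 1))"
  have R: "R \<noteq> 0" using \<rho> by (simp add: R_def)
  have pw: "complex_of_real (\<rho> powi (int (s i) + m - 1)) = R"
    using power_int_add[of \<rho> "int (s i)" "m - 1"] \<rho> by (simp add: R_def add_diff_eq)
  have gm: "gm (dilation s \<rho> x) $ i = R * gm x $ i" for x
    using qh \<rho> unfolding quasi_homogeneous_vector_field_def by (simp only: pw[symmetric])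
  have eq: "gm (c + axis j z) $ i = gm (dilation s \<rho> c + axis j (of_real (\<rho> ^ s j) * z)) $ i / R" for z
    using gm[of "c + axis j z"] R by (simp add: dilation_add_axis)
  have "((\<lambda>h. gm (dilation s \<rho> c + axis j h) $ i) has_field_derivative
      partial_deriv j (\<lambda>x. gm x $ i) (dilation s \<rho> c)) (at (of_real (\<rho> ^ s j) * 0))"
    using has_partial_deriv[OF an U] by simp
  then have "((\<lambda>z. gm (dilation s \<rho> c + axis j (of_real (\<rho> ^ s j) * z)) $ i / R) has_field_derivative
      partial_deriv j (\<lambda>x. gm x $ i) (dilation s \<rho> c) * of_real (\<rho> ^ s j) / R) (at 0)"
    by (intro DERIV_cdivide DERIV_chain'[where f = "\<lambda>z. of_real (\<rho> ^ s j) * z"])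
      (auto intro!: derivative_eq_intros)
  then have "partial_deriv j (\<lambda>x. gm x $ i) c
      = partial_deriv j (\<lambda>x. gm x $ i) (dilation s \<rho> c) * of_real (\<rho> ^ s j) / R"
    unfolding partial_deriv_def[of j _ c] eq by (rule DERIV_imp_deriv)
  moreover have "D' = R * D / q" if "D = D' * q / R" "q \<noteq> 0" for D D' q :: complex
    using that R by simp
  ultimately show ?thesis unfolding R_def[symmetric] using \<rho> by simp
qed

text \<open>The matrix \<open>K0\<close> is conjugate to \<open>K / t\<close> by the diagonal matrix with entries \<open>x i\<close>.\<close>
lemma kovalevskaya_eigenvalue_transfer:
  fixes K K0 :: "complex^'n::finite^'n"
  assumes K0: "\<And>i j. K0 $ i $ j = x i * K $ i $ j / (t * x j)" and nz: "t \<noteq> 0" "\<And>i. x i \<noteq> 0"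
    and det: "det (mat z - K0) = 0"
  shows "det (mat (t * z) - K) = 0"
proof -
  have "mat (t * z) - K = (\<chi> i j. (t / x i) * (mat z - K0) $ i $ j * x j)"
    using nz by (simp add: vec_eq_iff mat_def K0 field_simps)
  then have "det (mat (t * z) - K) = prod (\<lambda>i. t / x i) UNIV * det (mat z - K0) * prod x UNIV"
    by (simp only: det_scale_rows_columns)
  then show ?thesis using det by simp
qed

text \<open>Counting how often each eigenvalue occurs in a list of eigenvalues.\<close>
lemma sum_grouped_by_value:
  fixes ev :: "'n::finite \<Rightarrow> complex" and d :: nat
  shows "(\<Sum>b<d. ev (\<epsilon> b)) = (\<Sum>j\<in>UNIV. of_nat (card {b \<in> {..<d}. \<epsilon> b = j}) * ev j)"
proof -
  have "(\<Sum>b<d. ev (\<epsilon> b)) = (\<Sum>j\<in>UNIV. \<Sum>b\<in>{b \<in> {..<d}. \<epsilon> b = j}. ev (\<epsilon> b))"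
    by (rule sum.group[symmetric]) auto
  also have "\<dots> = (\<Sum>j\<in>UNIV. of_nat (card {b \<in> {..<d}. \<epsilon> b = j}) * ev j)"
    by (intro sum.cong refl) simp
  finally show ?thesis .
qed

text \<open>The resonance relation needs the truncated system only.\<close>
lemma resonance_of_truncated_invariant:
  fixes s :: "'n::finite \<Rightarrow> nat" and m p q :: nat and l :: int
    and gm :: "'n vector_field" and c :: "complex^'n" and ev :: "'n \<Rightarrow> complex"
    and \<tau> :: "'n tensor_field"
  assumes m: "m > 1" and U: "open U"
    and gm: "analytic_vector_field_on gm U" "quasi_homogeneous_vector_field s (int m) gm"
    and c: "H_matrix s m *v c + gm c = 0"
    and ev: "eigenvalue_enumeration (kovalevskaya_matrix s m gm c) ev"
    and t: "t > 0" "particular_solution s m c t \<in> U"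
    and inv: "tensor_invariant_on p q gm \<tau> U"
    and ws: "\<And>I J. length I = p \<Longrightarrow> length J = q \<Longrightarrow> weighted_series_on s (component_degree s l I J) (\<tau> I J) U"
    and nz: "tensor_nonzero_on p q \<tau> U"
  obtains I J and k :: "'n \<Rightarrow> nat" where "length I = p" "length J = q"
    "- of_int l / (of_nat m - 1) + (\<Sum>j\<in>UNIV. of_nat (k j) * ev j) = (\<Sum>i\<leftarrow>I. ev i) - (\<Sum>j\<leftarrow>J. ev j)"
proof -
  define \<alpha> where "\<alpha> = alpha m"
  have \<alpha>: "\<alpha> > 0" "\<alpha> * (real m - 1) = 1" using m by (auto simp: \<alpha>_def alpha_def)
  \<comment> \<open>The point of the solution at time \<open>t\<close> is the dilation of \<open>c\<close> by \<open>t powr (- \<alpha>)\<close>.\<close>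
  define \<rho> where "\<rho> = t powr (- \<alpha>)"
  have \<rho>: "\<rho> > 0" using t(1) by (simp add: \<rho>_def)
  define c0 where "c0 = dilation s \<rho> c"
  have "particular_solution s m c t = c0"
    using t(1) by (simp add: particular_solution_def c0_def dilation_def vec_eq_iff \<rho>_def \<alpha>_def
        powr_realpow[symmetric] powr_powr)
  with t(2) have c0: "c0 \<in> U" by simp
  have pw: "\<rho> powi (int m - 1) = 1 / t"
  proof -
    have "\<rho> powi (int m - 1) = \<rho> ^ (m - 1)" using m by (metis of_nat_1 of_nat_diff less_imp_le power_int_of_nat)
    also have "\<dots> = t powr (- \<alpha> * real (m - 1))" using t(1) by (simp add: \<rho>_def powr_realpow[symmetric] powr_powr)
    also have "- \<alpha> * real (m - 1) = - 1" using \<alpha>(2) m by (simp add: of_nat_diff)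
    finally show ?thesis using t(1) by (simp add: powr_minus_divide)
  qed
  define \<beta> where "\<beta> = complex_of_real (\<alpha> / t)"
  \<comment> \<open>The coefficient of the Euler field is chosen so that \<open>c0\<close> becomes a zero.\<close>
  define F where "F = (\<lambda>x. \<chi> i. gm x $ i + \<beta> * of_nat (s i) * x $ i)"
  have gm_an: "mv_analytic_on (\<lambda>x. gm x $ j) U" for j
    using gm(1) by (simp add: analytic_vector_field_on_def)
  have F_an: "mv_analytic_on (\<lambda>x. F x $ j) U" for j
    unfolding F_def by (simp, intro mv_analytic_on_add mv_analytic_on_cmult mv_analytic_on_coord gm_an)
  have gmc: "gm c $ i = - (of_real \<alpha> * of_nat (s i) * c $ i)" for i
  proof -
    have "(H_matrix s m *v c) $ i = (\<Sum>j\<in>UNIV. if i = j then of_real \<alpha> * of_nat (s i) * c $ i else 0)"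
      unfolding matrix_vector_mult_def H_matrix_def \<alpha>_def vec_lambda_beta
      by (intro sum.cong refl) auto
    also have "\<dots> = of_real \<alpha> * of_nat (s i) * c $ i" by simp
    finally have "(H_matrix s m *v c) $ i = of_real \<alpha> * of_nat (s i) * c $ i" .
    moreover have "(H_matrix s m *v c + gm c) $ i = 0" using c by simp
    ultimately show ?thesis by (simp add: add_eq_0_iff)
  qed
  have F0: "F c0 = 0"
  proof -
    have "gm c0 $ i = of_real (\<rho> powi (int (s i) + int m - 1)) * gm c $ i" for i
      using gm(2) \<rho> unfolding quasi_homogeneous_vector_field_def c0_def by blast
    moreover have "\<rho> powi (int (s i) + int m - 1) = \<rho> ^ s i / t" for i
      using power_int_add[of \<rho> "int (s i)" "int m - 1"] \<rho> pw by (simp add: add_diff_eq)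
    ultimately show ?thesis
      by (simp add: F_def vec_eq_iff gmc c0_def dilation_def \<beta>_def)
  qed
  define K where "K = kovalevskaya_matrix s m gm c"
  define K0 where "K0 = (\<chi> i j. partial_deriv j (\<lambda>x. F x $ i) c0)"
  have K0_eq: "K0 $ i $ j = of_real (\<rho> ^ s i) * K $ i $ j / (of_real t * of_real (\<rho> ^ s j))" for i j
  proof -
    have "partial_deriv j (\<lambda>x. F x $ i) c0
      = partial_deriv j (\<lambda>x. gm x $ i) c0 + partial_deriv j (\<lambda>x. \<beta> * of_nat (s i) * x $ i) c0"
      unfolding F_def vec_lambda_beta
      by (rule partial_deriv_add[OF gm_an _ c0]) (intro mv_analytic_on_cmult mv_analytic_on_coord)
    also have "partial_deriv j (\<lambda>x. \<beta> * of_nat (s i) * x $ i) c0 = \<beta> * of_nat (s i) * (if j = i then 1 else 0)"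
      by (subst partial_deriv_cmult[OF mv_analytic_on_coord c0]) (simp add: partial_deriv_coord)
    also have "partial_deriv j (\<lambda>x. gm x $ i) c0
        = of_real (\<rho> ^ s i) * of_real (1 / t) * partial_deriv j (\<lambda>x. gm x $ i) c / of_real (\<rho> ^ s j)"
      unfolding c0_def pw[symmetric]
      by (rule quasi_homogeneous_partial_deriv[OF gm(2) \<rho> gm_an c0[unfolded c0_def]])
    finally show ?thesis
      using \<rho> t(1) unfolding K0_def K_def kovalevskaya_matrix_def H_matrix_def \<alpha>_def[symmetric] \<beta>_def
      by (auto simp: field_simps)
  qed
  have \<tau>_an: "mv_analytic_on (\<tau> I J) U" if "length I = p" "length J = q" for I J
    using inv that by (simp add: tensor_invariant_on_def analytic_tensor_field_on_def)
  have eig: "lie_derivative F \<tau> I J x = (\<beta> * of_int l) * \<tau> I J x"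
    if "length I = p" "length J = q" "x \<in> U" for I J x
    unfolding F_def
    by (rule lie_derivative_plus_euler[where gm = gm and \<tau> = \<tau> and I = I and J = J,
          OF U that(3) gm_an _ ws[OF that(1,2)]])
      (use inv that in \<open>simp add: tensor_invariant_on_def\<close>)
  obtain I0 J0 x where x: "length I0 = p" "length J0 = q" "x \<in> U" "\<tau> I0 J0 x \<noteq> 0"
    using nz unfolding tensor_nonzero_on_def by blast
  obtain A0 where A0: "iterated_partial A0 (\<tau> I0 J0) c0 \<noteq> 0"
    using weighted_series_on_nonzero[OF ws[OF x(1,2)] U c0 x(3,4)] by blast
  obtain d e where e: "\<And>b. b < d + q + p \<Longrightarrow> det (mat (e b) - K0) = 0"
    and sum: "\<beta> * of_int l = (\<Sum>b<d. e b) + (\<Sum>b<q. e (d + b)) - (\<Sum>b<p. e (d + q + b))"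
  proof (rule lie_derivative_eigenvalue[OF U c0 F_an F0 \<tau>_an eig x(1,2) A0 K0_def])
    fix d :: nat and e :: "nat \<Rightarrow> complex"
    assume "\<And>b. b < d + q + p \<Longrightarrow> det (mat (e b) - K0) = 0"
      "\<beta> * of_int l = (\<Sum>b<d. e b) + (\<Sum>b<q. e (d + b)) - (\<Sum>b<p. e (d + q + b))"
    then show thesis by (rule that)
  qed
  have "\<exists>i. of_real t * e b = ev i" if "b < d + q + p" for b
  proof -
    have "det (mat (of_real t * e b) - K) = 0"
      by (rule kovalevskaya_eigenvalue_transfer[OF K0_eq _ _ e[OF that]]) (use t(1) \<rho> in auto)
    then have "(\<Prod>i\<in>UNIV. of_real t * e b - ev i) = 0"
      using ev unfolding eigenvalue_enumeration_def K_def by metis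
    then show ?thesis by (auto simp: prod_zero_iff)
  qed
  then obtain \<epsilon> where \<epsilon>: "\<And>b. b < d + q + p \<Longrightarrow> of_real t * e b = ev (\<epsilon> b)" by metis
  define I where "I = map (\<lambda>b. \<epsilon> (d + q + b)) [0..<p]"
  define J where "J = map (\<lambda>b. \<epsilon> (d + b)) [0..<q]"
  define k where "k j = card {b \<in> {..<d}. \<epsilon> b = j}" for j
  have sumI: "(\<Sum>i\<leftarrow>I. ev i) = (\<Sum>b<p. of_real t * e (d + q + b))"
    unfolding I_def by (simp add: sum_list_sum_nth atLeast0LessThan \<epsilon>)
  have sumJ: "(\<Sum>i\<leftarrow>J. ev i) = (\<Sum>b<q. of_real t * e (d + b))"
    unfolding J_def by (simp add: sum_list_sum_nth atLeast0LessThan \<epsilon>)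
  have sumk: "(\<Sum>j\<in>UNIV. of_nat (k j) * ev j) = (\<Sum>b<d. of_real t * e b)"
    unfolding k_def sum_grouped_by_value[symmetric] by (simp add: \<epsilon>)
  have "of_real t * (\<beta> * of_int l) = (\<Sum>b<d. of_real t * e b) + (\<Sum>b<q. of_real t * e (d + b)) - (\<Sum>b<p. of_real t * e (d + q + b))"
    unfolding sum by (simp add: distrib_left right_diff_distrib sum_distrib_left)
  moreover have "of_real t * (\<beta> * of_int l) = of_int l / (of_nat m - 1)"
    using t(1) by (simp add: \<beta>_def \<alpha>_def alpha_def)
  ultimately have "- of_int l / (of_nat m - 1) + (\<Sum>j\<in>UNIV. of_nat (k j) * ev j) = (\<Sum>i\<leftarrow>I. ev i) - (\<Sum>j\<leftarrow>J. ev j)"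
    unfolding sumI sumJ sumk by simp
  moreover have "length I = p" "length J = q" by (auto simp: I_def J_def)
  ultimately show thesis using that by blast
qed

theorem theorem3p9:
  fixes \<sigma> :: kind
    and s :: "'n::finite \<Rightarrow> nat" and m p q :: nat and l :: int
    and g gm :: "'n vector_field" and c :: "complex^'n"
    and ev :: "'n \<Rightarrow> complex"
    and times :: "real set" and U :: "(complex^'n) set"
    and T :: "'n tensor_field" and TT :: "int \<Rightarrow> 'n tensor_field"
  assumes "m > 1"
    and "open U"
    and "semi_quasihomogeneous_on \<sigma> s m g gm U"
    and "c \<noteq> 0" and "H_matrix s m *v c + gm c = 0"
    and "eigenvalue_enumeration (kovalevskaya_matrix s m gm c) ev"
    and "open times" and "is_interval times" and "times \<noteq> {}" and "times \<subseteq> {0<..}"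
    and "particular_solution s m c ` times \<subseteq> U"
    and "tensor_invariant_on p q g T U"
    and "quasi_homogeneous_expansion_on \<sigma> s p q l T TT U"
    and "tensor_nonzero_on p q (TT l) U"
  shows "(\<exists>\<tau>. homogeneous_term_on \<sigma> s p q l \<tau> U \<and> tensor_nonzero_on p q \<tau> U \<and>
              tensor_invariant_on p q gm \<tau> U)
    \<and> (\<exists>I J (k :: 'n \<Rightarrow> nat). length I = p \<and> length J = q \<and>
         - of_int l / (of_nat m - 1) + (\<Sum>j\<in>UNIV. of_nat (k j) * ev j)
           = (\<Sum>i\<leftarrow>I. ev i) - (\<Sum>j\<leftarrow>J. ev j))
    \<and> (\<forall>i1. l \<ge> 0 \<longrightarrow> ev i1 = -1 \<longrightarrow>
         (\<exists>I J (k :: 'n \<Rightarrow> nat). length I = p \<and> length J = q \<and> int (k i1) \<ge> l \<and>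
            (\<Sum>j\<in>UNIV. of_nat (k j) * ev j)
              = (of_nat m - 1) * ((\<Sum>i\<leftarrow>I. ev i) - (\<Sum>j\<leftarrow>J. ev j))))"
proof -
  have hom: "homogeneous_term_on \<sigma> s p q l (TT l) U"
    by (rule expansion_homogeneous_term[OF assms(13)])
  have inv: "tensor_invariant_on p q gm (TT l) U"
    by (rule leading_term_invariant[OF assms(2,3,12,13)])
  have gm: "analytic_vector_field_on gm U" "quasi_homogeneous_vector_field s (int m) gm"
    using assms(3) unfolding semi_quasihomogeneous_on_def by blast+
  obtain t where t: "t > 0" "particular_solution s m c t \<in> U"
    using assms(9-11) by blast
  obtain I J and k :: "'n \<Rightarrow> nat" where IJ: "length I = p" "length J = q"
    and res: "- of_int l / (of_nat m - 1) + (\<Sum>j\<in>UNIV. of_nat (k j) * ev j)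
      = (\<Sum>i\<leftarrow>I. ev i) - (\<Sum>j\<leftarrow>J. ev j)"
    by (rule resonance_of_truncated_invariant[OF assms(1,2) gm assms(5,6) t inv
          homogeneous_term_on_weighted_series[OF hom] assms(14)])
  have "\<exists>I J (k :: 'n \<Rightarrow> nat). length I = p \<and> length J = q \<and> int (k i1) \<ge> l \<and>
            (\<Sum>j\<in>UNIV. of_nat (k j) * ev j)
              = (of_nat m - 1) * ((\<Sum>i\<leftarrow>I. ev i) - (\<Sum>j\<leftarrow>J. ev j))"
    if l: "l \<ge> 0" and ev1: "ev i1 = -1" for i1
  proof -
    \<comment> \<open>After multiplication by \<open>m - 1\<close> the constant term is \<open>- l = l * ev i1\<close>, which adds \<open>l\<close> to the
      coefficient of \<open>ev i1\<close>.\<close>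
    define k' where "k' j = (m - 1) * k j + (if j = i1 then nat l else 0)" for j
    have m1: "of_nat (m - 1) = (of_nat m - 1 :: complex)" using assms(1) by (simp add: of_nat_diff)
    have "of_nat (m - 1) \<noteq> (0 :: complex)" using assms(1) by simp
    then have m_nz: "of_nat m - 1 \<noteq> (0 :: complex)" unfolding m1 .
    have k'_eq: "of_nat (k' j) = (of_nat m - 1) * of_nat (k j) + (if j = i1 then of_int l else (0::complex))" for j
      unfolding k'_def of_nat_add of_nat_mult m1 using l by simp
    have "(\<Sum>j\<in>UNIV. of_nat (k' j) * ev j)
        = (\<Sum>j\<in>UNIV. (of_nat m - 1) * (of_nat (k j) * ev j) + (if j = i1 then - of_int l else 0))"
      unfolding k'_eq using ev1 by (intro sum.cong) (auto simp: distrib_right mult.assoc)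
    also have "\<dots> = (of_nat m - 1) * (\<Sum>j\<in>UNIV. of_nat (k j) * ev j) - of_int l"
      by (simp add: sum.distrib sum_distrib_left)
    also have "\<dots> = (of_nat m - 1) * (- of_int l / (of_nat m - 1) + (\<Sum>j\<in>UNIV. of_nat (k j) * ev j))"
    proof -
      have "N * S - L = N * (- L / N + S)" if "N \<noteq> 0" for N S L :: complex
        using that by (simp add: field_simps)
      then show ?thesis using m_nz by blast
    qed
    finally have "(\<Sum>j\<in>UNIV. of_nat (k' j) * ev j)
        = (of_nat m - 1) * ((\<Sum>i\<leftarrow>I. ev i) - (\<Sum>j\<leftarrow>J. ev j))"
      unfolding res .
    moreover have "int (k' i1) \<ge> l" using l by (simp add: k'_def)
    ultimately show ?thesis using IJ by blast
  qed
  then show ?thesis using hom inv assms(14) IJ res by blast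
qed

end
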